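(* In the v-set interpretation the Power Set principle is false; in particular there is no set whose members are exactly the subsets of $\omega$ (i.e. $\mathcal P(\omega)$ is a proper class).
   Context: Work in Heyting arithmetic extended by unary predicates $\mathcal V$ ("v-set"), $\mathcal M$ ("Meaningful condition"), $\mathcal T$ ("True condition"). $\langle\cdot,\cdot\rangle$ is Cantor pairing with projections $(\cdot)_L,(\cdot)_R$; $en$ is Kleene application, $en\!\downarrow$ means it is defined. Write $\mathrm{cd}_x(n)=(xn)_R$, $\mathrm{el}_x(n)=(xn)_L$. $\Xi(f,g)$ is a fixed primitive recursive injective coding of pairs. Axioms: (V1) $\forall x\,[\forall n\,(xn\!\downarrow\wedge\mathcal M(\mathrm{cd}_x(n))\wedge(\mathcal T(\mathrm{cd}_x(n))\to\mathcal V(\mathrm{el}_x(n))))]\to\mathcal V(x)$; (V2) for every formula $\phi$: if the antecedent of (V1) with $\mathcal V$ replaced by $\phi$ implies $\phi(x)$ for all $x$, then $\forall x(\mathcal V(x)\to\phi(x))$; (X1) $\mathcal M(\Xi(f,g))\to(\mathcal T(\Xi(f,g))\leftrightarrow\forall n(fn\!\downarrow\wedge\mathcal T(fn)\to gn\!\downarrow\wedge\mathcal T(gn)))$; (X2) if $\forall n(fn\!\downarrow\to\mathcal M(fn))$ and $\forall n(fn\!\downarrow\wedge gn\!\downarrow\wedge\mathcal T(fn)\to\mathcal M(gn))$ then $\mathcal M(\Xi(f,g))$; ($\mathsf{ECT}_V$) $(\forall n(\phi(n)\to\exists m\,\psi(n,m)))\to\exists e\,\forall n(\phi(n)\to en\!\downarrow\wedge\psi(n,en))$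 for arbitrary $\psi$ and almost-negative $\phi$ (built from $\Sigma_1$ formulas and atoms $\mathcal V(t),\mathcal M(t),\mathcal T(t)$ by $\wedge,\to,\forall_{\mathbb N}$). Sets are interpreted as v-sets (numbers $x$ with $\mathcal V(x)$); $EL(x)=\{\mathrm{el}_x(n):\mathcal T(\mathrm{cd}_x(n))\}$. Set equality is extensional equality $\simeq$ of v-sets, characterized by $x\simeq y\iff(\forall a\in EL(x)\exists b\in EL(y)\,a\simeq b)\wedge(\forall b\in EL(y)\exists a\in EL(x)\,b\simeq a)$. Unbounded set quantifiers range over v-sets, bounded quantifiers range over $EL(x)$, and $x\in y$ means $\exists y'\in EL(y)\,x\simeq y'$. A set-theoretic statement holds (resp. is false) in the v-set interpretation if its interpretation (resp. the interpretation of its negation) is provable in this system. *)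

theory Defs
  imports Main "HOL-Library.Nat_Bijection"
begin

section \<open>Primitive recursive functions\<close>

text \<open>
  Function symbols of Heyting arithmetic. They carry no fixed arity: a symbol together with
  the number \<open>n\<close> of arguments it is applied to denotes an \<open>n\<close>-ary primitive recursive
  function, missing arguments being read as \<open>0\<close>. Recursion is on the first argument.
\<close>

datatype prfun = PZero | PSuc | PProj nat | PComp prfun "prfun list" | PRec prfun prfun

definition arg :: "'a \<Rightarrow> nat \<Rightarrow> 'a list \<Rightarrow> 'a" where
  "arg z i xs = (if i < length xs then xs ! i else z)"

fun peval :: "prfun \<Rightarrow> nat list \<Rightarrow> nat" where
  "peval PZero xs = 0"
| "peval PSuc xs = Suc (arg 0 0 xs)"
| "peval (PProj i) xs = arg 0 i xs"
| "peval (PComp f gs) xs = peval f (map (\<lambda>g. peval g xs) gs)"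
| "peval (PRec f g) xs =
     rec_nat (peval f (tl xs)) (\<lambda>t r. peval g (t # r # tl xs)) (arg 0 0 xs)"

definition padd :: prfun where
  "padd = PRec (PProj 0) (PComp PSuc [PProj 1])"

definition ppred :: prfun where
  "ppred = PRec PZero (PProj 0)"

definition pmonus :: prfun where
  "pmonus = PComp (PRec (PProj 0) (PComp ppred [PProj 1])) [PProj 1, PProj 0]"

text \<open>\<open>pcond(c, a, b)\<close> is \<open>a\<close> if \<open>c = 0\<close> and \<open>b\<close> otherwise.\<close>

definition pcond :: prfun where
  "pcond = PRec (PProj 0) (PProj 3)"

definition ptri :: prfun where
  "ptri = PRec PZero (PComp padd [PProj 1, PComp PSuc [PProj 0]])"

text \<open>The largest \<open>w\<close> with \<open>triangle w \<le> z\<close>.\<close>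

definition proot :: prfun where
  "proot = PRec PZero
     (PComp pcond [PComp pmonus [PComp ptri [PComp PSuc [PProj 1]], PComp PSuc [PProj 0]],
                   PComp PSuc [PProj 1], PProj 1])"

definition ppair :: prfun where
  "ppair = PComp padd [PComp ptri [PComp padd [PProj 0, PProj 1]], PProj 0]"

definition pfst :: prfun where
  "pfst = PComp pmonus [PProj 0, PComp ptri [PComp proot [PProj 0]]]"

definition psnd :: prfun where
  "psnd = PComp pmonus [PComp proot [PProj 0], pfst]"

lemma arg_Cons [simp]: "arg z 0 (x # xs) = x" "arg z (Suc i) (x # xs) = arg z i xs"
  by (auto simp: arg_def)

lemma arg_Cons_numeral [simp]: "arg z (numeral k) (x # xs) = arg z (pred_numeral k) xs"
  by (simp add: numeral_eq_Suc)

lemma peval_padd [simp]: "peval padd [m, n] = m + n"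
  unfolding padd_def by (induction m) auto

lemma peval_ppred [simp]: "peval ppred [n] = n - 1"
  unfolding ppred_def by (cases n) auto

lemma peval_pmonus [simp]: "peval pmonus [m, n] = m - n"
  unfolding pmonus_def by (induction n) auto

lemma peval_pcond [simp]: "peval pcond [c, a, b] = (if c = 0 then a else b)"
  unfolding pcond_def by (cases c) auto

lemma peval_ptri [simp]: "peval ptri [n] = triangle n"
  unfolding ptri_def by (induction n) (auto simp: triangle_def)

lemma peval_ppair [simp]: "peval ppair [m, n] = prod_encode (m, n)"
  unfolding ppair_def by (simp add: prod_encode_def)

lemma proot_bounds:
  "triangle (peval proot [z]) \<le> z \<and> z < triangle (Suc (peval proot [z]))"
  unfolding proot_def by (induction z) (auto simp: not_le)

lemma triangle_mono: "m \<le> n \<Longrightarrow> triangle m \<le> triangle n"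
  by (induction n) (auto simp: le_Suc_eq)

lemma peval_proot_encode: "peval proot [prod_encode (m, n)] = m + n"
proof -
  let ?r = "peval proot [prod_encode (m, n)]"
  have lo: "triangle ?r \<le> triangle (m + n) + m" and hi: "triangle (m + n) + m < triangle (Suc ?r)"
    using proot_bounds[of "prod_encode (m, n)"] by (simp_all add: prod_encode_def)
  have "\<not> Suc (m + n) \<le> ?r"
    using triangle_mono[of "Suc (m + n)" ?r] lo by auto
  moreover have "\<not> Suc ?r \<le> m + n"
    using triangle_mono[of "Suc ?r" "m + n"] hi by auto
  ultimately show ?thesis by simp
qed

lemma peval_pfst [simp]: "peval pfst [prod_encode (m, n)] = m"
  unfolding pfst_def by (simp add: peval_proot_encode) (simp add: prod_encode_def)

lemma peval_psnd [simp]: "peval psnd [prod_encode (m, n)] = n"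
  unfolding psnd_def by (simp add: peval_proot_encode)


section \<open>Kleene application\<close>

text \<open>
  Indices code the schemata generating the unary partial recursive functions. An index is
  \<open>\<langle>tag, \<langle>f, g\<rangle>\<rangle>\<close> with tag \<open>0\<close> zero, \<open>1\<close> successor, \<open>2\<close> left projection, \<open>3\<close> right projection,
  \<open>4\<close> pairing, \<open>5\<close> composition, \<open>6\<close> primitive recursion, \<open>7\<close> minimization; an index with any
  other tag is nowhere defined. The predicate \<open>kleene\<close> is this big-step reading on the
  standard natural numbers; the formal system uses the primitive recursive machine \<open>pstep\<close>
  below, and \<open>pkleene_iff_kleene\<close> shows that the two agree.
\<close>

definition idx :: "nat \<Rightarrow> nat \<Rightarrow> nat \<Rightarrow> nat" where
  "idx t f g = prod_encode (t, prod_encode (f, g))"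

inductive kleene :: "nat \<Rightarrow> nat \<Rightarrow> nat \<Rightarrow> bool" where
  k_zero: "kleene (idx 0 f g) x 0"
| k_suc: "kleene (idx 1 f g) x (Suc x)"
| k_left: "kleene (idx 2 f g) (prod_encode (a, b)) a"
| k_right: "kleene (idx 3 f g) (prod_encode (a, b)) b"
| k_pair: "kleene f x u \<Longrightarrow> kleene g x v \<Longrightarrow> kleene (idx 4 f g) x (prod_encode (u, v))"
| k_comp: "kleene g x u \<Longrightarrow> kleene f u v \<Longrightarrow> kleene (idx 5 f g) x v"
| k_rec0: "kleene f a v \<Longrightarrow> kleene (idx 6 f g) (prod_encode (a, 0)) v"
| k_recS: "kleene (idx 6 f g) (prod_encode (a, n)) u
    \<Longrightarrow> kleene g (prod_encode (prod_encode (a, n), u)) v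
    \<Longrightarrow> kleene (idx 6 f g) (prod_encode (a, Suc n)) v"
| k_mu: "kleene f (prod_encode (x, n)) 0
    \<Longrightarrow> \<forall>i<n. \<exists>v. kleene f (prod_encode (x, i)) (Suc v)
    \<Longrightarrow> kleene (idx 7 f g) x n"

text \<open>
  A configuration is \<open>\<langle>q, \<langle>x, k\<rangle>\<rangle>\<close>: if \<open>q = 0\<close> the value \<open>x\<close> is returned to the stack \<open>k\<close>, and
  if \<open>q = e + 1\<close> the index \<open>e\<close> is to be evaluated at \<open>x\<close>. The stack is \<open>0\<close> if empty and
  otherwise \<open>\<langle>frame, k'\<rangle> + 1\<close>; frames have the shape \<open>\<langle>tag, \<langle>p, d\<rangle>\<rangle>\<close>.
\<close>

abbreviation cPair :: "prfun \<Rightarrow> prfun \<Rightarrow> prfun" where "cPair a b \<equiv> PComp ppair [a, b]"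
abbreviation cL :: "prfun \<Rightarrow> prfun" where "cL a \<equiv> PComp pfst [a]"
abbreviation cR :: "prfun \<Rightarrow> prfun" where "cR a \<equiv> PComp psnd [a]"
abbreviation cS :: "prfun \<Rightarrow> prfun" where "cS a \<equiv> PComp PSuc [a]"
abbreviation cPred :: "prfun \<Rightarrow> prfun" where "cPred a \<equiv> PComp ppred [a]"
abbreviation cIf0 :: "prfun \<Rightarrow> prfun \<Rightarrow> prfun \<Rightarrow> prfun" where "cIf0 c a b \<equiv> PComp pcond [c, a, b]"

fun cNum :: "nat \<Rightarrow> prfun" where
  "cNum 0 = PZero"
| "cNum (Suc n) = cS (cNum n)"

fun cCase :: "prfun \<Rightarrow> prfun list \<Rightarrow> prfun \<Rightarrow> prfun" where
  "cCase c [] d = d"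
| "cCase c (a # as) d = cIf0 c a (cCase (cPred c) as d)"

definition cConf :: "prfun \<Rightarrow> prfun \<Rightarrow> prfun \<Rightarrow> prfun" where
  "cConf q x k = cPair q (cPair x k)"

definition cPush :: "nat \<Rightarrow> prfun \<Rightarrow> prfun \<Rightarrow> prfun \<Rightarrow> prfun" where
  "cPush t p d k = cS (cPair (cPair (cNum t) (cPair p d)) k)"

definition pstep :: prfun where
  "pstep =
    (let c = PProj 0; q = cL c; x = cL (cR c); k = cR (cR c);
         fr = cL (cPred k); k' = cR (cPred k); p = cL (cR fr); d = cR (cR fr);
         e = cPred q; f = cL (cR e); g = cR (cR e);
         y = cPair (cL x) (cPred (cR x));
         z = cPair (cL d) (cS (cR d))
     in cIf0 q
          (cIf0 k c
            (cCase (cL fr)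
              [cConf (cS p) d (cPush 1 x PZero k'),
               cConf PZero (cPair p x) k',
               cConf (cS p) x k',
               cConf (cS p) (cPair d x) k',
               cIf0 x (cConf PZero (cR d) k') (cConf (cS p) z (cPush 4 p z k'))]
              c))
          (cCase (cL e)
            [cConf PZero PZero k,
             cConf PZero (cS x) k,
             cConf PZero (cL x) k,
             cConf PZero (cR x) k,
             cConf (cS f) x (cPush 0 g x k),
             cConf (cS g) x (cPush 2 f PZero k),
             cIf0 (cR x) (cConf (cS f) (cL x) k) (cConf q y (cPush 3 g y k)),
             cConf (cS f) (cPair x PZero) (cPush 4 f (cPair x PZero) k)]
            c))"

text \<open>The configuration after \<open>s\<close> steps of index \<open>e\<close> on input \<open>n\<close>, with arguments \<open>(s, e, n)\<close>.\<close>

definition prun :: prfun where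
  "prun = PRec (cConf (cS (PProj 0)) (PProj 1) PZero) (PComp pstep [PProj 1])"

text \<open>\<open>pkleene(s, e, n) = m + 1\<close> iff \<open>e\<close> on input \<open>n\<close> has halted with result \<open>m\<close> after \<open>s\<close> steps.\<close>

definition pkleene :: prfun where
  "pkleene = cIf0 (cL prun) (cIf0 (cR (cR prun)) (cS (cL (cR prun))) PZero) PZero"

lemma peval_cNum [simp]: "peval (cNum n) xs = n"
  by (induction n) auto

lemma peval_cCase [simp]:
  "peval (cCase c as d) xs =
     (if peval c xs < length as then peval (as ! peval c xs) xs else peval d xs)"
  by (induction as arbitrary: c) (auto simp: nth_Cons split: nat.split)

definition conf :: "nat \<Rightarrow> nat \<Rightarrow> nat \<Rightarrow> nat" where
  "conf q x k = prod_encode (q, prod_encode (x, k))"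

definition push :: "nat \<Rightarrow> nat \<Rightarrow> nat \<Rightarrow> nat \<Rightarrow> nat" where
  "push t p d k = Suc (prod_encode (prod_encode (t, prod_encode (p, d)), k))"

definition step :: "nat \<Rightarrow> nat" where
  "step c = peval pstep [c]"

lemmas step_unfold =
  step_def pstep_def Let_def cConf_def cPush_def conf_def push_def idx_def

lemma step_return [simp]:
  "step (conf 0 v 0) = conf 0 v 0"
  "step (conf 0 v (push 0 g x k)) = conf (Suc g) x (push 1 v 0 k)"
  "step (conf 0 v (push (Suc 0) u d k)) = conf 0 (prod_encode (u, v)) k"
  "step (conf 0 v (push 2 f d k)) = conf (Suc f) v k"
  "step (conf 0 v (push 3 g y k)) = conf (Suc g) (prod_encode (y, v)) k"
  "step (conf 0 0 (push 4 f (prod_encode (x, n)) k)) = conf 0 n k"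
  "step (conf 0 (Suc v) (push 4 f (prod_encode (x, n)) k)) =
     conf (Suc f) (prod_encode (x, Suc n)) (push 4 f (prod_encode (x, Suc n)) k)"
  by (simp_all add: step_unfold del: One_nat_def)

lemma step_eval [simp]:
  "step (conf (Suc (idx 0 f g)) x k) = conf 0 0 k"
  "step (conf (Suc (idx (Suc 0) f g)) x k) = conf 0 (Suc x) k"
  "step (conf (Suc (idx 2 f g)) (prod_encode (a, b)) k) = conf 0 a k"
  "step (conf (Suc (idx 3 f g)) (prod_encode (a, b)) k) = conf 0 b k"
  "step (conf (Suc (idx 4 f g)) x k) = conf (Suc f) x (push 0 g x k)"
  "step (conf (Suc (idx 5 f g)) x k) = conf (Suc g) x (push 2 f 0 k)"
  "step (conf (Suc (idx 6 f g)) (prod_encode (a, 0)) k) = conf (Suc f) a k"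
  "step (conf (Suc (idx 6 f g)) (prod_encode (a, Suc n)) k) =
     conf (Suc (idx 6 f g)) (prod_encode (a, n)) (push 3 g (prod_encode (a, n)) k)"
  "step (conf (Suc (idx 7 f g)) x k) =
     conf (Suc f) (prod_encode (x, 0)) (push 4 f (prod_encode (x, 0)) k)"
  by (simp_all add: step_unfold del: One_nat_def)

lemma step_other: "8 \<le> t \<Longrightarrow> step (conf (Suc (idx t f g)) x k) = conf (Suc (idx t f g)) x k"
  by (simp add: step_unfold)

lemma peval_prun: "peval prun [s, e, n] = (step ^^ s) (conf (Suc e) n 0)"
  by (induction s) (simp_all add: prun_def cConf_def conf_def step_def)

lemma conf_inject [simp]: "conf q x k = conf q' x' k' \<longleftrightarrow> q = q' \<and> x = x' \<and> k = k'"
  by (simp add: conf_def prod_encode_eq)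

lemma push_neq_0 [simp]: "push t p d k \<noteq> 0"
  by (simp add: push_def)

lemma steps_halted [simp]: "(step ^^ s) (conf 0 v 0) = conf 0 v 0"
  by (induction s) auto

lemma conf_exhaust: obtains q x k where "c = conf q x k"
  by (metis conf_def prod_decode_inverse surj_pair)

lemma idx_exhaust: obtains t f g where "e = idx t f g"
  by (metis idx_def prod_decode_inverse surj_pair)

definition reach :: "nat \<Rightarrow> nat \<Rightarrow> bool" where
  "reach c c' \<longleftrightarrow> (\<exists>s. (step ^^ s) c = c')"

lemma reach_refl: "reach c c"
  unfolding reach_def by (rule exI[of _ 0]) simp

lemma reach_step: "reach (step c) c' \<Longrightarrow> reach c c'"
  unfolding reach_def by (metis comp_apply funpow_Suc_right)

lemma reach_trans: "reach a b \<Longrightarrow> reach b c \<Longrightarrow> reach a c"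
  unfolding reach_def by (metis comp_apply funpow_add)

lemma kleene_reach: "kleene e x v \<Longrightarrow> reach (conf (Suc e) x k) (conf 0 v k)"
proof (induction arbitrary: k rule: kleene.induct)
  case (k_pair f x u g v)
  show ?case
    by (rule reach_step, simp, rule reach_trans[OF k_pair.IH(1)], rule reach_step, simp,
        rule reach_trans[OF k_pair.IH(2)], rule reach_step, simp add: reach_refl)
next
  case (k_comp g x u f v)
  show ?case
    by (rule reach_step, simp, rule reach_trans[OF k_comp.IH(1)], rule reach_step, simp,
        rule k_comp.IH(2))
next
  case (k_rec0 f a v g)
  show ?case
    by (rule reach_step, simp, rule k_rec0.IH)
next
  case (k_recS f g a n u v)
  show ?case
    by (rule reach_step, simp, rule reach_trans[OF k_recS.IH(1)], rule reach_step, simp,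
        rule k_recS.IH(2))
next
  case (k_mu f x n g)
  have "i \<le> n \<Longrightarrow> reach (conf (Suc f) (prod_encode (x, i)) (push 4 f (prod_encode (x, i)) k))
      (conf 0 n k)" for i
  proof (induction rule: inc_induct)
    case base
    show ?case
      by (rule reach_trans[OF k_mu.IH(1)], rule reach_step, simp add: reach_refl)
  next
    case (step i)
    then obtain v where "\<And>k. reach (conf (Suc f) (prod_encode (x, i)) k) (conf 0 (Suc v) k)"
      using k_mu.IH(2) by blast
    then show ?case
      by (rule reach_trans, intro reach_step[of "conf 0 (Suc v) _"]) (simp add: step.IH)
  qed
  then show ?case
    by (intro reach_step[of "conf (Suc (idx 7 f g)) x k"]) simp
qed (rule reach_step, simp add: reach_refl)+

lemma kleene_of_halt:
  "(step ^^ s) (conf (Suc e) x k) = conf 0 m 0 \<Longrightarrow>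
     \<exists>v s'. s' < s \<and> kleene e x v \<and> (step ^^ s') (conf 0 v k) = conf 0 m 0"
proof (induction s arbitrary: e x k rule: less_induct)
  case (less s)
  have nz: "\<exists>r'. r = Suc r' \<and> (step ^^ r') (step (conf q y l)) = conf 0 m 0"
    if "(step ^^ r) (conf q y l) = conf 0 m 0" and "q \<noteq> 0 \<or> l \<noteq> 0" for r q y l
    using that by (cases r) (auto simp: funpow_Suc_right simp del: funpow.simps)
  from nz[OF less.prems] obtain r where r: "s = Suc r"
    and step: "(step ^^ r) (step (conf (Suc e) x k)) = conf 0 m 0"
    by auto
  obtain t f g where e: "e = idx t f g" by (rule idx_exhaust)
  obtain a b where x: "x = prod_encode (a, b)" by (metis prod_decode_inverse surj_pair)
  have "t = 0 \<or> t = 1 \<or> t = 2 \<or> t = 3 \<or> t = 4 \<or> t = 5 \<or> t = 6 \<or> t = 7 \<or> 8 \<le> t"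
    by linarith
  then consider "t = 0" | "t = 1" | "t = 2" | "t = 3" | "t = 4" | "t = 5" | "t = 6" "b = 0"
    | n where "t = 6" "b = Suc n" | "t = 7" | "8 \<le> t"
    by (cases b) metis+
  then show ?case
  proof cases
    case 1
    then show ?thesis using step r e k_zero[of f g x] by (intro exI[of _ 0] exI[of _ r]) simp
  next
    case 2
    then show ?thesis using step r e k_suc[of f g x] by (intro exI[of _ "Suc x"] exI[of _ r]) simp
  next
    case 3
    then show ?thesis using step r e x k_left[of f g a b] by (intro exI[of _ a] exI[of _ r]) simp
  next
    case 4
    then show ?thesis using step r e x k_right[of f g a b] by (intro exI[of _ b] exI[of _ r]) simp
  next
    case 5
    with step e have "(step ^^ r) (conf (Suc f) x (push 0 g x k)) = conf 0 m 0" by simp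
    from less.IH[OF _ this] r obtain u s1 where u: "s1 < r" "kleene f x u"
      "(step ^^ s1) (conf 0 u (push 0 g x k)) = conf 0 m 0" by auto
    from nz[OF u(3)] obtain s2 where s2: "s1 = Suc s2"
      "(step ^^ s2) (conf (Suc g) x (push 1 u 0 k)) = conf 0 m 0" by auto
    from less.IH[OF _ s2(2)] r u s2 obtain v s3 where v: "s3 < s2" "kleene g x v"
      "(step ^^ s3) (conf 0 v (push 1 u 0 k)) = conf 0 m 0" by auto
    from nz[OF v(3)] obtain s4 where "s3 = Suc s4"
      "(step ^^ s4) (conf 0 (prod_encode (u, v)) k) = conf 0 m 0" by auto
    with u v s2 r e 5 show ?thesis
      by (intro exI[of _ "prod_encode (u, v)"] exI[of _ s4]) (auto intro: k_pair)
  next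
    case 6
    with step e have "(step ^^ r) (conf (Suc g) x (push 2 f 0 k)) = conf 0 m 0" by simp
    from less.IH[OF _ this] r obtain u s1 where u: "s1 < r" "kleene g x u"
      "(step ^^ s1) (conf 0 u (push 2 f 0 k)) = conf 0 m 0" by auto
    from nz[OF u(3)] obtain s2 where s2: "s1 = Suc s2"
      "(step ^^ s2) (conf (Suc f) u k) = conf 0 m 0" by auto
    from less.IH[OF _ s2(2)] r u s2 obtain v s3 where "s3 < s2" "kleene f u v"
      "(step ^^ s3) (conf 0 v k) = conf 0 m 0" by auto
    with u s2 r e 6 show ?thesis
      by (intro exI[of _ v] exI[of _ s3]) (auto intro: k_comp)
  next
    case 7
    with step e x have "(step ^^ r) (conf (Suc f) a k) = conf 0 m 0" by simp
    from less.IH[OF _ this] r obtain v s1 where "s1 < r" "kleene f a v"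
      "(step ^^ s1) (conf 0 v k) = conf 0 m 0" by auto
    with r e x 7 show ?thesis
      by (intro exI[of _ v] exI[of _ s1]) (auto intro: k_rec0)
  next
    case 8
    with step e x have "(step ^^ r) (conf (Suc (idx 6 f g)) (prod_encode (a, n))
      (push 3 g (prod_encode (a, n)) k)) = conf 0 m 0" by simp
    from less.IH[OF _ this] r obtain u s1 where u: "s1 < r"
      "kleene (idx 6 f g) (prod_encode (a, n)) u"
      "(step ^^ s1) (conf 0 u (push 3 g (prod_encode (a, n)) k)) = conf 0 m 0" by auto
    from nz[OF u(3)] obtain s2 where s2: "s1 = Suc s2"
      "(step ^^ s2) (conf (Suc g) (prod_encode (prod_encode (a, n), u)) k) = conf 0 m 0" by auto
    from less.IH[OF _ s2(2)] r u s2 obtain v s3 where "s3 < s2"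
      "kleene g (prod_encode (prod_encode (a, n), u)) v"
      "(step ^^ s3) (conf 0 v k) = conf 0 m 0" by auto
    with u s2 r e x 8 show ?thesis
      by (intro exI[of _ v] exI[of _ s3]) (auto intro: k_recS)
  next
    case 9
    have mu: "\<exists>n s'. s' < p \<and> kleene f (prod_encode (x, n)) 0 \<and>
        (\<forall>i<n. \<exists>v. kleene f (prod_encode (x, i)) (Suc v)) \<and> (step ^^ s') (conf 0 n k) = conf 0 m 0"
      if "p < s" and "\<forall>i<j. \<exists>v. kleene f (prod_encode (x, i)) (Suc v)"
        and "(step ^^ p) (conf (Suc f) (prod_encode (x, j)) (push 4 f (prod_encode (x, j)) k))
          = conf 0 m 0" for p j
      using that
    proof (induction p arbitrary: j rule: less_induct)
      case (less p j)
      from \<open>\<And>y e x k. y < s \<Longrightarrow> (step ^^ y) (conf (Suc e) x k) = conf 0 m 0 \<Longrightarrow>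
          \<exists>v s'. s' < y \<and> kleene e x v \<and> (step ^^ s') (conf 0 v k) = conf 0 m 0\<close>
        [OF less.prems(1,3)]
      obtain u s1 where u: "s1 < p" "kleene f (prod_encode (x, j)) u"
        "(step ^^ s1) (conf 0 u (push 4 f (prod_encode (x, j)) k)) = conf 0 m 0" by auto
      from nz[OF u(3)] obtain s2 where s2: "s1 = Suc s2"
        "(step ^^ s2) (step (conf 0 u (push 4 f (prod_encode (x, j)) k))) = conf 0 m 0" by auto
      show ?case
      proof (cases u)
        case 0
        with u s2 less.prems show ?thesis
          by (intro exI[of _ j] exI[of _ s2]) auto
      next
        case (Suc u')
        have "\<exists>n s'. s' < s2 \<and> kleene f (prod_encode (x, n)) 0 \<and>
            (\<forall>i<n. \<exists>v. kleene f (prod_encode (x, i)) (Suc v)) \<and>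
            (step ^^ s') (conf 0 n k) = conf 0 m 0"
        proof (rule less.IH[of s2 "Suc j"])
          show "\<forall>i<Suc j. \<exists>v. kleene f (prod_encode (x, i)) (Suc v)"
            using less.prems(2) u(2) Suc by (auto simp: less_Suc_eq)
        qed (use Suc u s2 less.prems(1) in auto)
        then show ?thesis using u(1) s2(1)
          by (meson Suc_lessD less_trans)
      qed
    qed
    from 9 step e have "(step ^^ r) (conf (Suc f) (prod_encode (x, 0))
      (push 4 f (prod_encode (x, 0)) k)) = conf 0 m 0" by simp
    from mu[OF _ _ this] r obtain n s' where "s' < r" "kleene f (prod_encode (x, n)) 0"
      "\<forall>i<n. \<exists>v. kleene f (prod_encode (x, i)) (Suc v)" "(step ^^ s') (conf 0 n k) = conf 0 m 0"
      by auto
    with 9 r e show ?thesis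
      by (intro exI[of _ n] exI[of _ s']) (auto intro: k_mu)
  next
    case 10
    have "(step ^^ i) (conf (Suc e) x k) = conf (Suc e) x k" for i
      by (induction i) (simp_all add: e step_other[OF 10])
    then show ?thesis using less.prems by simp
  qed
qed

lemma pkleene_iff_halt:
  "peval pkleene [s, e, n] = Suc m \<longleftrightarrow> (step ^^ s) (conf (Suc e) n 0) = conf 0 m 0"
proof -
  obtain q x k where c: "(step ^^ s) (conf (Suc e) n 0) = conf q x k" by (rule conf_exhaust)
  then have "peval prun [s, e, n] = prod_encode (q, prod_encode (x, k))"
    by (simp add: peval_prun conf_def)
  then show ?thesis by (simp add: pkleene_def c)
qed

theorem pkleene_iff_kleene: "(\<exists>s. peval pkleene [s, e, n] = Suc m) \<longleftrightarrow> kleene e n m"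
proof
  assume "\<exists>s. peval pkleene [s, e, n] = Suc m"
  then obtain s where "(step ^^ s) (conf (Suc e) n 0) = conf 0 m 0"
    by (auto simp: pkleene_iff_halt)
  from kleene_of_halt[OF this] show "kleene e n m" by auto
next
  assume "kleene e n m"
  from kleene_reach[OF this, of 0] show "\<exists>s. peval pkleene [s, e, n] = Suc m"
    by (auto simp: pkleene_iff_halt reach_def)
qed


section \<open>Heyting arithmetic with v-sets and conditions\<close>

text \<open>Variables are de Bruijn indices throughout.\<close>

datatype trm = Var nat | Zero | Succ trm | Fn prfun "trm list"

datatype fm =
    Eq trm trm  (infix \<open>\<^bold>=\<close> 50)
  | Vset trm
  | Meaningful trm
  | Tr trm
  | Bot
  | And fm fm  (infixr \<open>\<^bold>\<and>\<close> 35)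
  | Or fm fm  (infixr \<open>\<^bold>\<or>\<close> 30)
  | Imp fm fm  (infixr \<open>\<^bold>\<longrightarrow>\<close> 25)
  | All fm
  | Ex fm

abbreviation Iff :: "fm \<Rightarrow> fm \<Rightarrow> fm"  (infixr \<open>\<^bold>\<longleftrightarrow>\<close> 25) where
  "\<phi> \<^bold>\<longleftrightarrow> \<psi> \<equiv> (\<phi> \<^bold>\<longrightarrow> \<psi>) \<^bold>\<and> (\<psi> \<^bold>\<longrightarrow> \<phi>)"

primrec subt :: "(nat \<Rightarrow> trm) \<Rightarrow> trm \<Rightarrow> trm" where
  "subt \<sigma> (Var i) = \<sigma> i"
| "subt \<sigma> Zero = Zero"
| "subt \<sigma> (Succ t) = Succ (subt \<sigma> t)"
| "subt \<sigma> (Fn f ts) = Fn f (map (subt \<sigma>) ts)"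

definition lift :: "trm \<Rightarrow> trm" where
  "lift = subt (\<lambda>i. Var (Suc i))"

primrec sub :: "(nat \<Rightarrow> trm) \<Rightarrow> fm \<Rightarrow> fm" where
  "sub \<sigma> (s \<^bold>= t) = (subt \<sigma> s \<^bold>= subt \<sigma> t)"
| "sub \<sigma> (Vset t) = Vset (subt \<sigma> t)"
| "sub \<sigma> (Meaningful t) = Meaningful (subt \<sigma> t)"
| "sub \<sigma> (Tr t) = Tr (subt \<sigma> t)"
| "sub \<sigma> Bot = Bot"
| "sub \<sigma> (\<phi> \<^bold>\<and> \<psi>) = (sub \<sigma> \<phi> \<^bold>\<and> sub \<sigma> \<psi>)"
| "sub \<sigma> (\<phi> \<^bold>\<or> \<psi>) = (sub \<sigma> \<phi> \<^bold>\<or> sub \<sigma> \<psi>)"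
| "sub \<sigma> (\<phi> \<^bold>\<longrightarrow> \<psi>) = (sub \<sigma> \<phi> \<^bold>\<longrightarrow> sub \<sigma> \<psi>)"
| "sub \<sigma> (All \<phi>) = All (sub (case_nat (Var 0) (\<lambda>i. lift (\<sigma> i))) \<phi>)"
| "sub \<sigma> (Ex \<phi>) = Ex (sub (case_nat (Var 0) (\<lambda>i. lift (\<sigma> i))) \<phi>)"

definition lift_fm :: "fm \<Rightarrow> fm" where
  "lift_fm = sub (\<lambda>i. Var (Suc i))"

definition inst :: "fm \<Rightarrow> trm \<Rightarrow> fm" where
  "inst \<phi> t = sub (case_nat t Var) \<phi>"

definition eL :: "trm \<Rightarrow> trm" where "eL t = Fn pfst [t]"
definition eR :: "trm \<Rightarrow> trm" where "eR t = Fn psnd [t]"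

text \<open>\<open>app_eq e n m\<close> says that the Kleene application \<open>en\<close> is defined with value \<open>m\<close>.\<close>

definition app_eq :: "trm \<Rightarrow> trm \<Rightarrow> trm \<Rightarrow> fm" where
  "app_eq e n m = Ex (Fn pkleene [Var 0, lift e, lift n] \<^bold>= Succ (lift m))"

definition dfd :: "trm \<Rightarrow> trm \<Rightarrow> fm" where
  "dfd e n = Ex (app_eq (lift e) (lift n) (Var 0))"

text \<open>
  \<open>at_app e n \<phi>\<close> is \<open>\<phi>(en)\<close>, read as \<open>\<exists>m. en \<simeq> m \<and> \<phi>(m)\<close>; in \<open>\<phi>\<close> the variable \<open>0\<close> is the
  value \<open>en\<close> and all other indices are shifted by one.
\<close>

definition at_app :: "trm \<Rightarrow> trm \<Rightarrow> fm \<Rightarrow> fm" where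
  "at_app e n \<phi> = Ex (app_eq (lift e) (lift n) (Var 0) \<^bold>\<and> \<phi>)"

text \<open>
  The antecedent of the closure axiom for v-sets, for \<open>x\<close> the variable \<open>0\<close>, with the predicate
  for v-sets replaced by \<open>\<phi>\<close>; the variable \<open>0\<close> of \<open>\<phi>\<close> is its argument, the others are parameters.
  Inside, \<open>x\<close>, \<open>n\<close> and the value \<open>xn\<close> are bound, so the parameters move up by two.
\<close>

definition vcond :: "fm \<Rightarrow> fm" where
  "vcond \<phi> = All
     (dfd (Var 1) (Var 0) \<^bold>\<and>
      at_app (Var 1) (Var 0) (Meaningful (eR (Var 0))) \<^bold>\<and>
      (at_app (Var 1) (Var 0) (Tr (eR (Var 0))) \<^bold>\<longrightarrow>
       at_app (Var 1) (Var 0) (sub (case_nat (eL (Var 0)) (\<lambda>i. Var (i + 3))) \<phi>)))"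

definition less_fm :: "trm \<Rightarrow> trm \<Rightarrow> fm" where
  "less_fm s t = (Fn pmonus [Succ s, t] \<^bold>= Zero)"

inductive delta0 :: "fm \<Rightarrow> bool" where
  "delta0 (s \<^bold>= t)"
| "delta0 Bot"
| "delta0 \<phi> \<Longrightarrow> delta0 \<psi> \<Longrightarrow> delta0 (\<phi> \<^bold>\<and> \<psi>)"
| "delta0 \<phi> \<Longrightarrow> delta0 \<psi> \<Longrightarrow> delta0 (\<phi> \<^bold>\<or> \<psi>)"
| "delta0 \<phi> \<Longrightarrow> delta0 \<psi> \<Longrightarrow> delta0 (\<phi> \<^bold>\<longrightarrow> \<psi>)"
| "delta0 \<phi> \<Longrightarrow> delta0 (All (less_fm (Var 0) (lift t) \<^bold>\<longrightarrow> \<phi>))"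
| "delta0 \<phi> \<Longrightarrow> delta0 (Ex (less_fm (Var 0) (lift t) \<^bold>\<and> \<phi>))"

inductive sigma1 :: "fm \<Rightarrow> bool" where
  "delta0 \<phi> \<Longrightarrow> sigma1 \<phi>"
| "sigma1 \<phi> \<Longrightarrow> sigma1 (Ex \<phi>)"

inductive almost_negative :: "fm \<Rightarrow> bool" where
  "sigma1 \<phi> \<Longrightarrow> almost_negative \<phi>"
| "almost_negative (Vset t)"
| "almost_negative (Meaningful t)"
| "almost_negative (Tr t)"
| "almost_negative \<phi> \<Longrightarrow> almost_negative \<psi> \<Longrightarrow> almost_negative (\<phi> \<^bold>\<and> \<psi>)"
| "almost_negative \<phi> \<Longrightarrow> almost_negative \<psi> \<Longrightarrow> almost_negative (\<phi> \<^bold>\<longrightarrow> \<psi>)"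
| "almost_negative \<phi> \<Longrightarrow> almost_negative (All \<phi>)"

text \<open>
  Axioms may have free variables; since the rule \<open>AllI\<close> below applies to them, this amounts to
  taking their universal closures. In \<open>ECT\<close>, \<open>n\<close> is the variable \<open>0\<close> of \<open>\<phi>\<close>, and \<open>m\<close>, \<open>n\<close> are the
  variables \<open>0\<close>, \<open>1\<close> of \<open>\<psi>\<close>; the renamings make room for the quantifier over \<open>e\<close>.
\<close>

inductive_set axs :: "prfun \<Rightarrow> fm set" for Xi :: prfun where
  Succ_inject: "(Succ s \<^bold>= Succ t \<^bold>\<longrightarrow> s \<^bold>= t) \<in> axs Xi"
| Succ_not_Zero: "(Succ t \<^bold>= Zero \<^bold>\<longrightarrow> Bot) \<in> axs Xi"
| Induction:
    "(inst \<phi> Zero \<^bold>\<longrightarrow>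
      All (\<phi> \<^bold>\<longrightarrow> sub (case_nat (Succ (Var 0)) (\<lambda>i. Var (Suc i))) \<phi>) \<^bold>\<longrightarrow> All \<phi>) \<in> axs Xi"
| PZero_eq: "(Fn PZero ts \<^bold>= Zero) \<in> axs Xi"
| PSuc_eq: "(Fn PSuc ts \<^bold>= Succ (arg Zero 0 ts)) \<in> axs Xi"
| PProj_eq: "(Fn (PProj i) ts \<^bold>= arg Zero i ts) \<in> axs Xi"
| PComp_eq: "(Fn (PComp f gs) ts \<^bold>= Fn f (map (\<lambda>g. Fn g ts) gs)) \<in> axs Xi"
| PRec_Nil_eq: "(Fn (PRec f g) [] \<^bold>= Fn f []) \<in> axs Xi"
| PRec_Zero_eq: "(Fn (PRec f g) (Zero # ts) \<^bold>= Fn f ts) \<in> axs Xi"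
| PRec_Succ_eq:
    "(Fn (PRec f g) (Succ t # ts) \<^bold>= Fn g (t # Fn (PRec f g) (t # ts) # ts)) \<in> axs Xi"
| V1: "All (vcond (Vset (Var 0)) \<^bold>\<longrightarrow> Vset (Var 0)) \<in> axs Xi"
| V2: "(All (vcond \<phi> \<^bold>\<longrightarrow> \<phi>) \<^bold>\<longrightarrow> All (Vset (Var 0) \<^bold>\<longrightarrow> \<phi>)) \<in> axs Xi"
| X1:
    "All (All
      (Meaningful (Fn Xi [Var 1, Var 0]) \<^bold>\<longrightarrow>
       (Tr (Fn Xi [Var 1, Var 0]) \<^bold>\<longleftrightarrow>
        All (dfd (Var 2) (Var 0) \<^bold>\<and> at_app (Var 2) (Var 0) (Tr (Var 0)) \<^bold>\<longrightarrow>
             dfd (Var 1) (Var 0) \<^bold>\<and> at_app (Var 1) (Var 0) (Tr (Var 0)))))) \<in> axs Xi"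
| X2:
    "All (All
      (All (dfd (Var 2) (Var 0) \<^bold>\<longrightarrow> at_app (Var 2) (Var 0) (Meaningful (Var 0))) \<^bold>\<and>
       All (dfd (Var 2) (Var 0) \<^bold>\<and> dfd (Var 1) (Var 0) \<^bold>\<and> at_app (Var 2) (Var 0) (Tr (Var 0)) \<^bold>\<longrightarrow>
            at_app (Var 1) (Var 0) (Meaningful (Var 0))) \<^bold>\<longrightarrow>
       Meaningful (Fn Xi [Var 1, Var 0]))) \<in> axs Xi"
| ECT:
    "almost_negative \<phi> \<Longrightarrow>
     (All (\<phi> \<^bold>\<longrightarrow> Ex \<psi>) \<^bold>\<longrightarrow>
      Ex (All (sub (case_nat (Var 0) (\<lambda>i. Var (i + 2))) \<phi> \<^bold>\<longrightarrow>
               dfd (Var 1) (Var 0) \<^bold>\<and>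
               at_app (Var 1) (Var 0)
                 (sub (case_nat (Var 0) (case_nat (Var 1) (\<lambda>i. Var (i + 3)))) \<psi>)))) \<in> axs Xi"

text \<open>Natural deduction for intuitionistic first-order logic with equality.\<close>

inductive prov :: "fm set \<Rightarrow> fm list \<Rightarrow> fm \<Rightarrow> bool" for Ax :: "fm set" where
  Axiom: "\<phi> \<in> Ax \<Longrightarrow> prov Ax \<Gamma> \<phi>"
| Assm: "\<phi> \<in> set \<Gamma> \<Longrightarrow> prov Ax \<Gamma> \<phi>"
| BotE: "prov Ax \<Gamma> Bot \<Longrightarrow> prov Ax \<Gamma> \<phi>"
| AndI: "prov Ax \<Gamma> \<phi> \<Longrightarrow> prov Ax \<Gamma> \<psi> \<Longrightarrow> prov Ax \<Gamma> (\<phi> \<^bold>\<and> \<psi>)"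
| AndE1: "prov Ax \<Gamma> (\<phi> \<^bold>\<and> \<psi>) \<Longrightarrow> prov Ax \<Gamma> \<phi>"
| AndE2: "prov Ax \<Gamma> (\<phi> \<^bold>\<and> \<psi>) \<Longrightarrow> prov Ax \<Gamma> \<psi>"
| OrI1: "prov Ax \<Gamma> \<phi> \<Longrightarrow> prov Ax \<Gamma> (\<phi> \<^bold>\<or> \<psi>)"
| OrI2: "prov Ax \<Gamma> \<psi> \<Longrightarrow> prov Ax \<Gamma> (\<phi> \<^bold>\<or> \<psi>)"
| OrE: "prov Ax \<Gamma> (\<phi> \<^bold>\<or> \<psi>) \<Longrightarrow> prov Ax (\<phi> # \<Gamma>) \<chi> \<Longrightarrow> prov Ax (\<psi> # \<Gamma>) \<chi> \<Longrightarrow> prov Ax \<Gamma> \<chi>"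
| ImpI: "prov Ax (\<phi> # \<Gamma>) \<psi> \<Longrightarrow> prov Ax \<Gamma> (\<phi> \<^bold>\<longrightarrow> \<psi>)"
| ImpE: "prov Ax \<Gamma> (\<phi> \<^bold>\<longrightarrow> \<psi>) \<Longrightarrow> prov Ax \<Gamma> \<phi> \<Longrightarrow> prov Ax \<Gamma> \<psi>"
| AllI: "prov Ax (map lift_fm \<Gamma>) \<phi> \<Longrightarrow> prov Ax \<Gamma> (All \<phi>)"
| AllE: "prov Ax \<Gamma> (All \<phi>) \<Longrightarrow> prov Ax \<Gamma> (inst \<phi> t)"
| ExI: "prov Ax \<Gamma> (inst \<phi> t) \<Longrightarrow> prov Ax \<Gamma> (Ex \<phi>)"
| ExE: "prov Ax \<Gamma> (Ex \<phi>) \<Longrightarrow> prov Ax (\<phi> # map lift_fm \<Gamma>) (lift_fm \<chi>) \<Longrightarrow> prov Ax \<Gamma> \<chi>"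
| EqRefl: "prov Ax \<Gamma> (t \<^bold>= t)"
| EqSubst: "prov Ax \<Gamma> (s \<^bold>= t) \<Longrightarrow> prov Ax \<Gamma> (inst \<phi> s) \<Longrightarrow> prov Ax \<Gamma> (inst \<phi> t)"


section \<open>The v-set interpretation of set theory\<close>

text \<open>In the bounded quantifiers \<open>SBAll y \<phi>\<close> and \<open>SBEx y \<phi>\<close>, \<open>y\<close> lives outside the binder.\<close>

datatype sfm =
    SEq nat nat
  | SMem nat nat
  | SBot
  | SAnd sfm sfm
  | SOr sfm sfm
  | SImp sfm sfm
  | SAll sfm
  | SEx sfm
  | SBAll nat sfm
  | SBEx nat sfm

abbreviation SNot :: "sfm \<Rightarrow> sfm" where "SNot \<phi> \<equiv> SImp \<phi> SBot"
abbreviation SIff :: "sfm \<Rightarrow> sfm \<Rightarrow> sfm" where "SIff \<phi> \<psi> \<equiv> SAnd (SImp \<phi> \<psi>) (SImp \<psi> \<phi>)"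

text \<open>\<open>in_EL a x\<close> says that \<open>a = el\<^sub>x(n)\<close> for some \<open>n\<close> such that the condition \<open>cd\<^sub>x(n)\<close> is true.\<close>

definition in_EL :: "trm \<Rightarrow> trm \<Rightarrow> fm" where
  "in_EL a x = Ex
     (at_app (lift x) (Var 0) (Tr (eR (Var 0))) \<^bold>\<and>
      at_app (lift x) (Var 0) (lift (lift a) \<^bold>= eL (Var 0)))"

text \<open>
  A formula \<open>E\<close> is used as a binary relation: variable \<open>0\<close> is its first argument and every
  other free variable stands for the second one.
\<close>

definition rel :: "fm \<Rightarrow> trm \<Rightarrow> trm \<Rightarrow> fm" where
  "rel E s t = sub (case_nat s (\<lambda>_. t)) E"

primrec interp :: "fm \<Rightarrow> sfm \<Rightarrow> fm" where
  "interp E (SEq x y) = rel E (Var x) (Var y)"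
| "interp E (SMem x y) = Ex (in_EL (Var 0) (Var (Suc y)) \<^bold>\<and> rel E (Var (Suc x)) (Var 0))"
| "interp E SBot = Bot"
| "interp E (SAnd \<phi> \<psi>) = (interp E \<phi> \<^bold>\<and> interp E \<psi>)"
| "interp E (SOr \<phi> \<psi>) = (interp E \<phi> \<^bold>\<or> interp E \<psi>)"
| "interp E (SImp \<phi> \<psi>) = (interp E \<phi> \<^bold>\<longrightarrow> interp E \<psi>)"
| "interp E (SAll \<phi>) = All (Vset (Var 0) \<^bold>\<longrightarrow> interp E \<phi>)"
| "interp E (SEx \<phi>) = Ex (Vset (Var 0) \<^bold>\<and> interp E \<phi>)"
| "interp E (SBAll y \<phi>) = All (in_EL (Var 0) (Var (Suc y)) \<^bold>\<longrightarrow> interp E \<phi>)"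
| "interp E (SBEx y \<phi>) = Ex (in_EL (Var 0) (Var (Suc y)) \<^bold>\<and> interp E \<phi>)"

definition holds :: "prfun \<Rightarrow> fm \<Rightarrow> sfm \<Rightarrow> bool" where
  "holds Xi E \<phi> \<longleftrightarrow> prov (axs Xi) [] (interp E \<phi>)"

definition is_false :: "prfun \<Rightarrow> fm \<Rightarrow> sfm \<Rightarrow> bool" where
  "is_false Xi E \<phi> \<longleftrightarrow> holds Xi E (SNot \<phi>)"

text \<open>
  The characterization of extensional equality: for all v-sets \<open>x\<close>, \<open>y\<close>, the system proves
  \<open>x \<simeq> y \<longleftrightarrow> (\<forall>a\<in>EL(x). \<exists>b\<in>EL(y). a \<simeq> b) \<and> (\<forall>b\<in>EL(y). \<exists>a\<in>EL(x). b \<simeq> a)\<close>, where \<open>\<simeq>\<close> is \<open>E\<close>.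
  By the induction axiom for v-sets it determines \<open>E\<close> on v-sets up to provable equivalence.
\<close>

definition extensional_equality :: "prfun \<Rightarrow> fm \<Rightarrow> bool" where
  "extensional_equality Xi E \<longleftrightarrow>
     holds Xi E (SAll (SAll (SIff (SEq 1 0)
       (SAnd (SBAll 1 (SBEx 1 (SEq 1 0))) (SBAll 0 (SBEx 2 (SEq 1 0)))))))"

definition s_subset :: "nat \<Rightarrow> nat \<Rightarrow> sfm" where
  "s_subset x y = SBAll x (SMem 0 (Suc y))"

definition s_empty :: "nat \<Rightarrow> sfm" where
  "s_empty x = SBAll x SBot"

text \<open>\<open>y = x \<union> {x}\<close>\<close>

definition s_succ :: "nat \<Rightarrow> nat \<Rightarrow> sfm" where
  "s_succ x y =
     SAnd (SBAll y (SOr (SMem 0 (Suc x)) (SEq 0 (Suc x)))) (SAnd (s_subset x y) (SMem x y))"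

definition s_inductive :: "nat \<Rightarrow> sfm" where
  "s_inductive w = SAnd (SBEx w (s_empty 0)) (SBAll w (SBEx (Suc w) (s_succ 1 0)))"

text \<open>\<open>w = \<omega>\<close>: \<open>w\<close> is the least inductive set.\<close>

definition s_omega :: "nat \<Rightarrow> sfm" where
  "s_omega w = SAnd (s_inductive w) (SAll (SImp (s_inductive 0) (s_subset (Suc w) 0)))"

text \<open>There is a set whose members are exactly the subsets of \<open>a\<close>.\<close>

definition s_has_power :: "nat \<Rightarrow> sfm" where
  "s_has_power a = SEx (SAll (SIff (SMem 0 1) (s_subset 0 (a + 2))))"

definition Power_Set :: sfm where
  "Power_Set = SAll (s_has_power 0)"

end

theory Submission
  imports Defs
begin

text \<open>
  Every v-set \<open>P\<close> enumerates its elements: they are the \<open>el\<^sub>P(n)\<close> whose condition \<open>cd\<^sub>P(n)\<close> is true. If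
  the members of \<open>P\<close> are the subsets of \<open>\<omega>\<close>, Cantor's diagonal set
  \<open>{\<nu>(n) | \<T>(cd\<^sub>P(n)) \<rightarrow> \<nu>(n) \<notin> el\<^sub>P(n)}\<close>, with \<open>\<nu>(n)\<close> the \<open>n\<close>-th numeral, is a subset of \<open>\<omega>\<close> that is not
  among them. It is a v-set because its defining formula is a condition: \<open>\<Xi>\<close> represents bounded
  universal implications, an element of \<open>el\<^sub>P(n)\<close> equals some numeral \<open>\<nu>(i)\<close>, and \<open>i = n\<close> is decidable.
  All indices, and the recursion theorem that yields \<open>\<nu>\<close>, come from ECT, so that the only facts
  needed about the machine for Kleene application are that results are unique and that some index is
  nowhere defined.

  Derivability is treated semantically: a context \<open>w\<close> serves as a world, and \<open>frc w \<rho> \<phi>\<close> says that \<open>w\<close>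
  proves \<open>\<phi>\<close> under the substitution \<open>\<rho>\<close>; the connectives then have a Beth-style reading, in which
  existence and disjunction hold only locally (\<open>Loc\<close>): to derive a formula one may pass to any larger
  context in which a witness or a disjunct is available.
\<close>

section \<open>Substitution\<close>

text \<open>Two obstacles shape the argument. Extensional equality, and with it membership, is not a
  condition in general, so the diagonal formula needs a decision procedure behind it: numerals with
  extensionally equal values must have equal indices, and this rests on the absence of membership
  cycles of length two. Moreover \<open>el_P(n)\<close> is known to be a v-set only when
  \<open>cd_P(n)\<close> is true. This is why the truth of \<open>cd_P(n)\<close> is the premise of
  the diagonal formula; it fits (X2), which asks for meaningfulness of the conclusion only under a
  true premise. The logic is intuitionistic, so the contradiction is reached without a case
  distinction on membership: assuming that the diagonal set is the \<open>n\<close>-th element of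
  \<open>P\<close>, membership of \<open>\<nu>(n)\<close> is refuted outright, and this refutation
  is what puts \<open>\<nu>(n)\<close> into the set. The \<open>\<omega>\<close> of the theorem is
  any v-set that satisfies the defining formula. Its leastness identifies it with one set of
  numerals built explicitly, for which the enumeration \<open>\<nu>\<close> is at hand.\<close>

abbreviation scons :: "'a \<Rightarrow> (nat \<Rightarrow> 'a) \<Rightarrow> nat \<Rightarrow> 'a"  (infixr \<open>\<cdot>\<close> 65) where
  "t \<cdot> \<rho> \<equiv> case_nat t \<rho>"

abbreviation up :: "(nat \<Rightarrow> trm) \<Rightarrow> nat \<Rightarrow> trm" where
  "up \<sigma> \<equiv> Var 0 \<cdot> (\<lambda>i. lift (\<sigma> i))"

lemma subt_subt: "subt \<sigma> (subt \<tau> t) = subt (\<lambda>i. subt \<sigma> (\<tau> i)) t"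
  by (induction t) auto

lemma subt_Var [simp]: "subt Var t = t"
  by (induction t) (auto intro: map_idI)

lemma subt_lift [simp]: "subt \<sigma> (lift s) = subt (\<lambda>i. \<sigma> (Suc i)) s"
  by (simp add: lift_def subt_subt)

lemma lift_subt: "lift (subt \<sigma> s) = subt (\<lambda>i. lift (\<sigma> i)) s"
  by (simp add: lift_def subt_subt)

lemma lift_simps [simp]:
  "lift (Var i) = Var (Suc i)" "lift Zero = Zero" "lift (Succ t) = Succ (lift t)"
  "lift (Fn f ts) = Fn f (map lift ts)"
  by (auto simp: lift_def)

lemma subt_scons: "(\<lambda>i. subt \<sigma> ((t \<cdot> \<rho>) i)) = subt \<sigma> t \<cdot> (\<lambda>i. subt \<sigma> (\<rho> i))"
  by (auto simp: fun_eq_iff split: nat.split)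

lemma scons_Var: "Var 0 \<cdot> (\<lambda>i. Var (Suc i)) = Var"
  by (auto simp: fun_eq_iff split: nat.split)

lemma sub_sub: "sub \<sigma> (sub \<tau> \<phi>) = sub (\<lambda>i. subt \<sigma> (\<tau> i)) \<phi>"
  by (induction \<phi> arbitrary: \<sigma> \<tau>) (auto simp: subt_subt subt_scons lift_subt)

lemma sub_Var [simp]: "sub Var \<phi> = \<phi>"
  by (induction \<phi>) (auto simp: scons_Var)

lemma sub_lift_fm: "sub (up \<sigma>) (lift_fm \<phi>) = lift_fm (sub \<sigma> \<phi>)"
  by (simp add: lift_fm_def sub_sub) (simp add: lift_def)

lemma sub_inst: "sub \<sigma> (inst \<phi> t) = inst (sub (up \<sigma>) \<phi>) (subt \<sigma> t)"
  by (simp add: inst_def sub_sub subt_scons)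

lemma inst_up: "inst (sub (up \<rho>) \<phi>) t = sub (t \<cdot> \<rho>) \<phi>"
  by (simp add: inst_def sub_sub subt_scons)

lemma subt_eL [simp]: "subt \<sigma> (eL t) = eL (subt \<sigma> t)" "subt \<sigma> (eR t) = eR (subt \<sigma> t)"
  by (auto simp: eL_def eR_def)

lemma sub_app_eq [simp]: "sub \<sigma> (app_eq e n m) = app_eq (subt \<sigma> e) (subt \<sigma> n) (subt \<sigma> m)"
  by (simp add: app_eq_def lift_subt)

lemma sub_dfd [simp]: "sub \<sigma> (dfd e n) = dfd (subt \<sigma> e) (subt \<sigma> n)"
  by (simp add: dfd_def lift_subt)

lemma sub_at_app [simp]:
  "sub \<sigma> (at_app e n \<phi>) = at_app (subt \<sigma> e) (subt \<sigma> n) (sub (up \<sigma>) \<phi>)"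
  by (simp add: at_app_def lift_subt)

lemma sub_in_EL [simp]: "sub \<sigma> (in_EL a x) = in_EL (subt \<sigma> a) (subt \<sigma> x)"
  by (simp add: in_EL_def lift_subt)

lemma sub_rel [simp]: "sub \<sigma> (rel E s t) = rel E (subt \<sigma> s) (subt \<sigma> t)"
  by (simp add: rel_def sub_sub subt_scons)

lemma sub_vcond: "sub (up \<sigma>) (vcond \<phi>) = vcond (sub (up \<sigma>) \<phi>)"
  by (simp add: vcond_def sub_sub subt_scons lift_def subt_subt eval_nat_numeral)

lemma sub_less_fm [simp]: "sub \<sigma> (less_fm s t) = less_fm (subt \<sigma> s) (subt \<sigma> t)"
  by (simp add: less_fm_def)

section \<open>Closure of the axioms and of derivability under substitution and weakening\<close>

lemma delta0_sub: "delta0 \<phi> ==> delta0 (sub \<sigma> \<phi>)"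
proof (induction arbitrary: \<sigma> rule: delta0.induct)
  case (6 \<phi> t)
  then show ?case using delta0.intros(6)[of "sub (up \<sigma>) \<phi>" "subt \<sigma> t"] by (simp add: lift_subt)
next
  case (7 \<phi> t)
  then show ?case using delta0.intros(7)[of "sub (up \<sigma>) \<phi>" "subt \<sigma> t"] by (simp add: lift_subt)
qed (auto intro: delta0.intros)

lemma sigma1_sub: "sigma1 \<phi> ==> sigma1 (sub \<sigma> \<phi>)"
  by (induction arbitrary: \<sigma> rule: sigma1.induct) (auto intro: sigma1.intros delta0_sub)

lemma almost_negative_sub: "almost_negative \<phi> ==> almost_negative (sub \<sigma> \<phi>)"
  by (induction arbitrary: \<sigma> rule: almost_negative.induct)
    (auto intro: almost_negative.intros sigma1_sub)

lemma subt_arg: "subt \<sigma> (arg Zero i ts) = arg Zero i (map (subt \<sigma>) ts)"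
  by (auto simp: arg_def)

text \<open>Axioms may contain parameters. Substituting into an instance of a schema gives the
  instance for the substituted formula, with the substitution pushed under the binders of the
  schema; for \<open>ECT\<close> the premise must in addition stay almost negative.\<close>

lemma axs_sub: "\<phi> \<in> axs Xi ==> sub \<sigma> \<phi> \<in> axs Xi"
proof (induction rule: axs.induct)
  case (Induction \<phi>)
  show ?case using axs.Induction[of "sub (up \<sigma>) \<phi>" Xi]
    by (simp add: sub_inst sub_sub subt_scons lift_def subt_subt)
next
  case (V2 \<phi>)
  show ?case using axs.V2[of "sub (up \<sigma>) \<phi>" Xi] by (simp add: sub_vcond)
next
  case (ECT \<phi> \<psi>)
  show ?case using axs.ECT[OF almost_negative_sub[OF ECT(1), of "up \<sigma>"], of "sub (up (up \<sigma>)) \<psi>" Xi]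
    by (simp add: sub_sub subt_scons lift_def subt_subt eval_nat_numeral)
next
  case X1
  show ?case using axs.X1[of Xi] by (simp add: eval_nat_numeral)
next
  case X2
  show ?case using axs.X2[of Xi] by (simp add: eval_nat_numeral)
next
  case V1
  show ?case using axs.V1[of Xi] by (simp add: sub_vcond)
qed (auto simp: subt_arg comp_def intro: axs.intros)

text \<open>Needed to rename a fresh variable into the bound variable of \<open>AllI\<close> and
  \<open>ExE\<close>. The substitution is generalized because the quantifier rules continue with
  \<open>up \<sigma>\<close>.\<close>

lemma prov_sub: "prov (axs Xi) \<Gamma> \<phi> ==> prov (axs Xi) (map (sub \<sigma>) \<Gamma>) (sub \<sigma> \<phi>)"
proof (induction arbitrary: \<sigma> rule: prov.induct)
  case (Axiom \<phi> \<Gamma>)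
  then show ?case by (auto intro: prov.Axiom axs_sub)
next
  case (AllI \<Gamma> \<phi>)
  from AllI.IH[of "up \<sigma>"] show ?case by (auto intro!: prov.AllI simp: comp_def sub_lift_fm)
next
  case (AllE \<Gamma> \<phi> t)
  from AllE.IH[of \<sigma>] show ?case by (auto simp: sub_inst intro: prov.AllE)
next
  case (ExI \<Gamma> \<phi> t)
  from ExI.IH[of \<sigma>] show ?case by (auto simp: sub_inst intro: prov.ExI)
next
  case (ExE \<Gamma> \<phi> \<chi>)
  from ExE.IH(1)[of \<sigma>] ExE.IH(2)[of "up \<sigma>"] show ?case
    by (auto simp: comp_def sub_lift_fm intro: prov.ExE)
next
  case (EqSubst \<Gamma> s t \<phi>)
  from EqSubst.IH[of \<sigma>] show ?case by (auto simp: sub_inst intro: prov.EqSubst)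
qed (auto intro: prov.intros)

text \<open>Only the set of hypotheses matters, so inclusion of contexts can serve as the order on
  worlds.\<close>

lemma prov_mono: "prov Ax \<Gamma> \<phi> ==> set \<Gamma> \<subseteq> set \<Gamma>' ==> prov Ax \<Gamma>' \<phi>"
proof (induction arbitrary: \<Gamma>' rule: prov.induct)
  case (OrE \<Gamma> \<phi> \<psi> \<chi>)
  have "prov Ax (\<phi> # \<Gamma>') \<chi>" using OrE.prems by (intro OrE.IH(2)) auto
  moreover have "prov Ax (\<psi> # \<Gamma>') \<chi>" using OrE.prems by (intro OrE.IH(3)) auto
  ultimately show ?case using OrE.IH(1)[OF OrE.prems] by (blast intro: prov.OrE)
next
  case (ImpI \<phi> \<Gamma> \<psi>)
  then show ?case by (intro prov.ImpI ImpI.IH) auto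
next
  case (AllI \<Gamma> \<phi>)
  then show ?case by (metis image_mono list.set_map prov.AllI)
next
  case (ExE \<Gamma> \<phi> \<chi>)
  have "prov Ax (\<phi> # map lift_fm \<Gamma>') (lift_fm \<chi>)"
    using ExE.prems by (intro ExE.IH(2)) auto
  with ExE.IH(1)[OF ExE.prems] show ?case by (rule prov.ExE)
next
  case (EqSubst \<Gamma> s t \<phi>)
  then show ?case by (meson prov.EqSubst)
qed (auto intro: prov.intros)

text \<open>This finite dependence takes the place of a notion of free variable: any index from
  \<open>N\<close> on is fresh.\<close>

lemma subt_bounded: "\<exists>N. \<forall>\<sigma> \<tau>. (\<forall>i<N. \<sigma> i = \<tau> i) --> subt \<sigma> t = subt \<tau> t"
proof (induction t)
  case (Var i)
  show ?case by (rule exI[of _ "Suc i"]) simp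
next
  case (Fn f ts)
  then obtain B where B: "\<And>t. t \<in> set ts ==> \<forall>\<sigma> \<tau>. (\<forall>i<B t. \<sigma> i = \<tau> i) --> subt \<sigma> t = subt \<tau> t"
    by metis
  let ?N = "Max (insert 0 (B ` set ts))"
  have "subt \<sigma> t = subt \<tau> t" if "\<forall>i<?N. \<sigma> i = \<tau> i" "t \<in> set ts" for \<sigma> \<tau> t
  proof -
    have "B t \<le> ?N" using that(2) by simp
    with that(1) have "\<forall>i<B t. \<sigma> i = \<tau> i" by (meson less_le_trans)
    with B[OF that(2)] show ?thesis by blast
  qed
  then have "\<forall>\<sigma> \<tau>. (\<forall>i<?N. \<sigma> i = \<tau> i) --> subt \<sigma> (Fn f ts) = subt \<tau> (Fn f ts)"
    by (simp del: Max_insert Max_less_iff)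
  then show ?case by blast
qed auto

lemma sub_bounded: "\<exists>N. \<forall>\<sigma> \<tau>. (\<forall>i<N. \<sigma> i = \<tau> i) --> sub \<sigma> \<phi> = sub \<tau> \<phi>"
proof -
  have bin: "\<exists>N. \<forall>\<sigma> \<tau>. (\<forall>i<N. \<sigma> i = \<tau> i) --> F \<sigma> = F \<tau> \<and> G \<sigma> = G \<tau>"
    if "\<exists>N. \<forall>\<sigma> \<tau>. (\<forall>i<N. \<sigma> i = \<tau> i) --> F \<sigma> = F \<tau>" "\<exists>N. \<forall>\<sigma> \<tau>. (\<forall>i<N. \<sigma> i = \<tau> i) --> G \<sigma> = G \<tau>"
    for F :: "(nat \<Rightarrow> trm) \<Rightarrow> 'x" and G :: "(nat \<Rightarrow> trm) \<Rightarrow> 'y"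
  proof -
    from that obtain M N where "\<forall>\<sigma> \<tau>. (\<forall>i<M. \<sigma> i = \<tau> i) --> F \<sigma> = F \<tau>"
      "\<forall>\<sigma> \<tau>. (\<forall>i<N. \<sigma> i = \<tau> i) --> G \<sigma> = G \<tau>" by blast
    then show ?thesis by (intro exI[of _ "max M N"]) simp
  qed
  \<comment> \<open>The same bound serves under a binder: substitutions that agree below
    \<open>N\<close> still agree below \<open>N\<close> after \<open>up\<close>.\<close>
  have under: "\<exists>N. \<forall>\<sigma> \<tau>. (\<forall>i<N. \<sigma> i = \<tau> i) --> sub (up \<sigma>) \<phi> = sub (up \<tau>) \<phi>"
    if "\<exists>N. \<forall>\<sigma> \<tau>. (\<forall>i<N. \<sigma> i = \<tau> i) --> sub \<sigma> \<phi> = sub \<tau> \<phi>" for \<phi>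
  proof -
    from that obtain N where "\<forall>\<sigma> \<tau>. (\<forall>i<N. \<sigma> i = \<tau> i) --> sub \<sigma> \<phi> = sub \<tau> \<phi>" by blast
    then show ?thesis by (intro exI[of _ N] allI impI) (auto split: nat.split)
  qed
  show ?thesis
    by (induction \<phi>) (simp_all add: bin under subt_bounded)
qed

section \<open>Forcing over contexts\<close>

abbreviation ext :: "fm list \<Rightarrow> fm list \<Rightarrow> bool"  (infix \<open>\<sqsubseteq>\<close> 50) where
  "w \<sqsubseteq> w' \<equiv> set w \<subseteq> set w'"

locale vset_theory =
  fixes Xi :: prfun
begin

abbreviation proves :: "fm list \<Rightarrow> fm \<Rightarrow> bool"  (infix \<open>|-\<close> 45) where
  "w |- \<phi> \<equiv> prov (axs Xi) w \<phi>"

definition frc :: "fm list \<Rightarrow> (nat \<Rightarrow> trm) \<Rightarrow> fm \<Rightarrow> bool" where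
  "frc w \<rho> \<phi> \<longleftrightarrow> w |- sub \<rho> \<phi>"

text \<open>Local truth is encoded by its elimination rule, quantified over all conclusions, instead
  of by an explicit family of covering contexts. In this form it is a monad with unit
  \<open>LocI\<close> and bind \<open>Loc_bind\<close>, and it matches \<open>OrE\<close> and
  \<open>ExE\<close> exactly.\<close>

definition Loc :: "fm list \<Rightarrow> (fm list \<Rightarrow> bool) \<Rightarrow> bool" where
  "Loc w Q \<longleftrightarrow> (\<forall>\<chi>. (\<forall>w'. w \<sqsubseteq> w' --> Q w' --> w' |- \<chi>) --> w |- \<chi>)"

lemma mono: "w |- \<phi> ==> w \<sqsubseteq> w' ==> w' |- \<phi>"
  by (rule prov_mono)

lemma frc_mono: "frc w \<rho> \<phi> ==> w \<sqsubseteq> w' ==> frc w' \<rho> \<phi>"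
  unfolding frc_def by (rule prov_mono)

lemma LocI: "Q w ==> Loc w Q"
  unfolding Loc_def by blast

lemma LocE: "Loc w Q ==> (\<And>w'. w \<sqsubseteq> w' ==> Q w' ==> w' |- \<chi>) ==> w |- \<chi>"
  unfolding Loc_def by blast

lemma frc_LocE: "Loc w Q ==> (\<And>w'. w \<sqsubseteq> w' ==> Q w' ==> frc w' \<rho> \<chi>) ==> frc w \<rho> \<chi>"
  unfolding frc_def by (erule LocE)

lemma Loc_bind: "Loc w Q ==> (\<And>w'. w \<sqsubseteq> w' ==> Q w' ==> Loc w' R) ==> Loc w R"
  unfolding Loc_def by (meson order_trans)

lemma Loc_map: "Loc w Q ==> (\<And>w'. w \<sqsubseteq> w' ==> Q w' ==> R w') ==> Loc w R"
  by (blast intro: Loc_bind LocI)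

lemma Bot_Loc: "w |- Bot ==> Loc w Q"
  unfolding Loc_def by (blast intro: prov.BotE)

text \<open>
  A variable that is fresh for the context serves as a generic element; this is why universal
  quantifiers need no change of context.
\<close>

definition generic :: "nat \<Rightarrow> nat \<Rightarrow> trm" where
  "generic N i = (if i < N then Var (Suc i) else Var 0)"

text \<open>For \<open>N\<close> beyond every variable that matters, \<open>generic N\<close> shifts
  the variables of the context just as \<open>lift_fm\<close> does, and it sends the fresh
  \<open>Var N\<close> to the variable \<open>0\<close> that the quantifier rules bind.\<close>

lemma generic_sub:
  "\<exists>N. map (sub (generic N)) \<Delta> = map lift_fm \<Delta> \<and> sub (generic N) (inst \<psi> (Var N)) = \<psi>"
proof -
  obtain B where B: "\<And>\<phi> \<sigma> \<tau>. (\<forall>i<B \<phi>. \<sigma> i = \<tau> i) ==> sub \<sigma> \<phi> = sub \<tau> \<phi>"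
    using sub_bounded by metis
  define N where "N = Max (insert (B \<psi>) (B ` set \<Delta>))"
  have le: "B \<psi> \<le> N" "\<And>\<phi>. \<phi> \<in> set \<Delta> ==> B \<phi> \<le> N"
    unfolding N_def by (auto intro: Max_ge)
  have "sub (generic N) \<phi> = lift_fm \<phi>" if "\<phi> \<in> set \<Delta>" for \<phi>
    unfolding lift_fm_def using le(2)[OF that] by (intro B) (auto simp: generic_def)
  moreover have "sub (generic N) (inst \<psi> (Var N)) = sub Var \<psi>"
    unfolding inst_def sub_sub using le(1) by (intro B) (auto simp: generic_def split: nat.split)
  ultimately show ?thesis by (intro exI[of _ N]) auto
qed

text \<open>Among all instances is the one at a fresh variable; substituting the bound variable for
  it yields the premise of \<open>AllI\<close>.\<close>

lemma proves_All: "w |- All \<phi> \<longleftrightarrow> (\<forall>t. w |- inst \<phi> t)"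
proof
  assume all: "\<forall>t. w |- inst \<phi> t"
  obtain N where N: "map (sub (generic N)) w = map lift_fm w" "sub (generic N) (inst \<phi> (Var N)) = \<phi>"
    using generic_sub by blast
  from prov_sub[OF all[rule_format, of "Var N"], of "generic N"]
  show "w |- All \<phi>" unfolding N by (rule prov.AllI)
qed (metis prov.AllE)

lemma proves_Imp: "w |- (\<phi> \<^bold>\<longrightarrow> \<psi>) \<longleftrightarrow> (\<forall>w'. w \<sqsubseteq> w' --> w' |- \<phi> --> w' |- \<psi>)"
proof
  assume "\<forall>w'. w \<sqsubseteq> w' --> w' |- \<phi> --> w' |- \<psi>"
  from this[rule_format, of "\<phi> # w"] have "\<phi> # w |- \<psi>"
    by (simp add: prov.Assm subset_insertI)
  then show "w |- (\<phi> \<^bold>\<longrightarrow> \<psi>)" by (rule prov.ImpI)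
qed (metis prov.ImpE mono)

lemma proves_And: "w |- (\<phi> \<^bold>\<and> \<psi>) \<longleftrightarrow> w |- \<phi> \<and> w |- \<psi>"
  by (blast intro: prov.AndI prov.AndE1 prov.AndE2)

lemma proves_Or: "w |- (\<phi> \<^bold>\<or> \<psi>) \<longleftrightarrow> Loc w (\<lambda>w'. w' |- \<phi> \<or> w' |- \<psi>)"
proof
  assume or: "w |- (\<phi> \<^bold>\<or> \<psi>)"
  show "Loc w (\<lambda>w'. w' |- \<phi> \<or> w' |- \<psi>)"
    unfolding Loc_def
  proof (intro allI impI)
    fix \<chi> assume *: "\<forall>w'. w \<sqsubseteq> w' --> w' |- \<phi> \<or> w' |- \<psi> --> w' |- \<chi>"
    have "\<phi> # w |- \<chi>" "\<psi> # w |- \<chi>"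
      using *[rule_format, of "\<phi> # w"] *[rule_format, of "\<psi> # w"]
      by (simp_all add: prov.Assm subset_insertI)
    with or show "w |- \<chi>" by (blast intro: prov.OrE)
  qed
next
  assume "Loc w (\<lambda>w'. w' |- \<phi> \<or> w' |- \<psi>)"
  then show "w |- (\<phi> \<^bold>\<or> \<psi>)" by (rule LocE) (blast intro: prov.OrI1 prov.OrI2)
qed

lemma proves_Ex: "w |- Ex \<phi> \<longleftrightarrow> Loc w (\<lambda>w'. \<exists>t. w' |- inst \<phi> t)"
proof
  assume ex: "w |- Ex \<phi>"
  show "Loc w (\<lambda>w'. \<exists>t. w' |- inst \<phi> t)"
    unfolding Loc_def
  proof (intro allI impI)
    fix \<chi> assume *: "\<forall>w'. w \<sqsubseteq> w' --> (\<exists>t. w' |- inst \<phi> t) --> w' |- \<chi>"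
    \<comment> \<open>The variable has to be fresh for the conclusion as well, since
      \<open>ExE\<close> requires its lifted form.\<close>
    obtain N where N: "map (sub (generic N)) (\<chi> # w) = map lift_fm (\<chi> # w)"
      "sub (generic N) (inst \<phi> (Var N)) = \<phi>"
      using generic_sub by blast
    have "inst \<phi> (Var N) # w |- \<chi>"
      using *[rule_format, of "inst \<phi> (Var N) # w"] prov.Assm[of "inst \<phi> (Var N)" "inst \<phi> (Var N) # w"]
      by auto
    from prov_sub[OF this, of "generic N"] N
    have "\<phi> # map lift_fm w |- lift_fm \<chi>" by (simp del: map_eq_conv)
    with ex show "w |- \<chi>" by (rule prov.ExE)
  qed
next
  assume "Loc w (\<lambda>w'. \<exists>t. w' |- inst \<phi> t)"
  then show "w |- Ex \<phi>" by (rule LocE) (metis prov.ExI)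
qed

lemma proves_frc: "w |- \<phi> \<longleftrightarrow> frc w Var \<phi>"
  by (simp add: frc_def)

lemma frc_All [simp]: "frc w \<rho> (All \<phi>) \<longleftrightarrow> (\<forall>t. frc w (t \<cdot> \<rho>) \<phi>)"
  and frc_Ex [simp]: "frc w \<rho> (Ex \<phi>) \<longleftrightarrow> Loc w (\<lambda>w'. \<exists>t. frc w' (t \<cdot> \<rho>) \<phi>)"
  and frc_Imp: "frc w \<rho> (\<phi> \<^bold>\<longrightarrow> \<psi>) \<longleftrightarrow> (\<forall>w'. w \<sqsubseteq> w' --> frc w' \<rho> \<phi> --> frc w' \<rho> \<psi>)"
  and frc_And [simp]: "frc w \<rho> (\<phi> \<^bold>\<and> \<psi>) \<longleftrightarrow> frc w \<rho> \<phi> \<and> frc w \<rho> \<psi>"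
  and frc_Or [simp]: "frc w \<rho> (\<phi> \<^bold>\<or> \<psi>) \<longleftrightarrow> Loc w (\<lambda>w'. frc w' \<rho> \<phi> \<or> frc w' \<rho> \<psi>)"
  and frc_Bot [simp]: "frc w \<rho> Bot \<longleftrightarrow> w |- Bot"
  by (simp_all add: frc_def proves_All proves_Ex proves_Imp proves_And proves_Or inst_up)

lemma frc_impI: "(\<And>w'. w \<sqsubseteq> w' ==> frc w' \<rho> \<phi> ==> frc w' \<rho> \<psi>) ==> frc w \<rho> (\<phi> \<^bold>\<longrightarrow> \<psi>)"
  by (simp add: frc_Imp)

lemma frc_mp: "frc w \<rho> (\<phi> \<^bold>\<longrightarrow> \<psi>) ==> frc w \<rho> \<phi> ==> frc w \<rho> \<psi>"
  by (simp add: frc_Imp)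

lemma frc_atom [simp]:
  "frc w \<rho> (s \<^bold>= t) \<longleftrightarrow> w |- subt \<rho> s \<^bold>= subt \<rho> t"
  "frc w \<rho> (Vset t) \<longleftrightarrow> w |- Vset (subt \<rho> t)"
  "frc w \<rho> (Meaningful t) \<longleftrightarrow> w |- Meaningful (subt \<rho> t)"
  "frc w \<rho> (Tr t) \<longleftrightarrow> w |- Tr (subt \<rho> t)"
  "frc w \<rho> (app_eq e n m) \<longleftrightarrow> w |- app_eq (subt \<rho> e) (subt \<rho> n) (subt \<rho> m)"
  "frc w \<rho> (in_EL a x) \<longleftrightarrow> w |- in_EL (subt \<rho> a) (subt \<rho> x)"
  "frc w \<rho> (rel E x y) \<longleftrightarrow> w |- rel E (subt \<rho> x) (subt \<rho> y)"
  by (simp_all add: frc_def)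

lemma frc_sub [simp]: "frc w \<rho> (sub \<tau> \<phi>) \<longleftrightarrow> frc w (\<lambda>i. subt \<rho> (\<tau> i)) \<phi>"
  by (simp add: frc_def sub_sub)

lemma frc_dfd [simp]:
  "frc w \<rho> (dfd e n) \<longleftrightarrow> Loc w (\<lambda>w'. \<exists>m. w' |- app_eq (subt \<rho> e) (subt \<rho> n) m)"
  by (simp add: dfd_def)

lemma frc_at_app [simp]:
  "frc w \<rho> (at_app e n \<phi>) \<longleftrightarrow>
    Loc w (\<lambda>w'. \<exists>m. w' |- app_eq (subt \<rho> e) (subt \<rho> n) m \<and> frc w' (m \<cdot> \<rho>) \<phi>)"
  by (simp add: at_app_def)

subsection \<open>Equality\<close>

lemma eq_subst: "w |- s \<^bold>= t ==> frc w (s \<cdot> \<rho>) \<phi> ==> frc w (t \<cdot> \<rho>) \<phi>"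
  using prov.EqSubst[of "axs Xi" w s t "sub (up \<rho>) \<phi>"] by (simp add: frc_def inst_up)

lemma eq_sym: "w |- s \<^bold>= t ==> w |- t \<^bold>= s"
  using eq_subst[of w s t Var "Var 0 \<^bold>= lift s"] by (simp add: prov.EqRefl)

lemma eq_trans: "w |- s \<^bold>= t ==> w |- t \<^bold>= u ==> w |- s \<^bold>= u"
  using eq_subst[of w t u Var "lift s \<^bold>= Var 0"] by simp

text \<open>
  A canonical representative of the class of \<open>t\<close> modulo provable equality; it turns equations of
  the object language into equations that the simplifier can use.
\<close>

definition nf :: "fm list \<Rightarrow> trm \<Rightarrow> trm" where
  "nf w t = (SOME s. w |- t \<^bold>= s)"

lemma eq_nf: "w |- t \<^bold>= nf w t"
  unfolding nf_def by (rule someI[of _ t]) (rule prov.EqRefl)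

lemma eq_iff_nf: "w |- s \<^bold>= t \<longleftrightarrow> nf w s = nf w t"
proof
  assume "w |- s \<^bold>= t"
  then have "w |- s \<^bold>= u \<longleftrightarrow> w |- t \<^bold>= u" for u
    by (metis eq_sym eq_trans)
  then show "nf w s = nf w t" unfolding nf_def by simp
next
  assume "nf w s = nf w t"
  then show "w |- s \<^bold>= t" by (metis eq_nf eq_sym eq_trans)
qed

lemma nf_nf [simp]: "nf w (nf w t) = nf w t"
  using eq_nf[of w t] by (simp add: eq_iff_nf)

definition F :: "fm list \<Rightarrow> prfun \<Rightarrow> trm list \<Rightarrow> trm" where
  "F w f ts = nf w (Fn f ts)"

definition S :: "fm list \<Rightarrow> trm \<Rightarrow> trm" where
  "S w t = nf w (Succ t)"

definition Z :: "fm list \<Rightarrow> trm" where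
  "Z w = nf w Zero"

text \<open>Equality is substituted in one argument at a time; \<open>xs\<close> holds the arguments
  already replaced.\<close>

lemma Fn_cong: "map (nf w) ts = map (nf w) us ==> w |- Fn f (xs @ ts) \<^bold>= Fn f (xs @ us)"
proof (induction ts us arbitrary: xs rule: list_induct2')
  case (4 t ts u us)
  then have "w |- Fn f (xs @ t # ts) \<^bold>= Fn f (xs @ u # ts)"
    using eq_subst[of w t u Var "Fn f (map lift xs @ lift t # map lift ts) \<^bold>=
      Fn f (map lift xs @ Var 0 # map lift ts)"]
    by (simp add: eq_iff_nf comp_def)
  moreover have "w |- Fn f ((xs @ [u]) @ ts) \<^bold>= Fn f ((xs @ [u]) @ us)"
    using 4 by (intro "4.IH") auto
  ultimately show ?case using eq_trans by simp
qed (simp_all add: prov.EqRefl)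

lemma F_cong: "map (nf w) ts = map (nf w) us ==> F w f ts = F w f us"
  using Fn_cong[of w ts us f "[]"] by (simp add: F_def eq_iff_nf)

lemma S_cong: "nf w s = nf w t ==> S w s = S w t"
  using eq_subst[of w s t Var "Succ (lift s) \<^bold>= Succ (Var 0)"]
  by (simp add: S_def eq_iff_nf)

lemma nf_fold [simp]: "nf w (Fn f ts) = F w f ts" "nf w (Succ t) = S w t" "nf w Zero = Z w"
  by (simp_all add: F_def S_def Z_def)

lemma nf_F [simp]: "nf w (F w f ts) = F w f ts" "nf w (S w t) = S w t" "nf w (Z w) = Z w"
  by (simp_all add: F_def S_def Z_def del: nf_fold)

lemma S_strip [simp]:
  "S w (nf w t) = S w t" "S w (Fn f ts) = S w (F w f ts)" "S w (Succ t) = S w (S w t)"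
  "S w Zero = S w (Z w)"
  by (rule S_cong, simp)+

text \<open>One rule for each argument position, because a rewrite rule cannot address an arbitrary
  place of a list. Together they push normal forms through nested applications, so that the
  recursion equations apply everywhere.\<close>

lemma F_strip [simp]:
  "F w f (nf w t # ts) = F w f (t # ts)"
  "F w f (a # nf w t # ts) = F w f (a # t # ts)"
  "F w f (a # b # nf w t # ts) = F w f (a # b # t # ts)"
  "F w f (a # b # c # nf w t # ts) = F w f (a # b # c # t # ts)"
  "F w f (Fn g us # ts) = F w f (F w g us # ts)"
  "F w f (a # Fn g us # ts) = F w f (a # F w g us # ts)"
  "F w f (a # b # Fn g us # ts) = F w f (a # b # F w g us # ts)"
  "F w f (Succ t # ts) = F w f (S w t # ts)"
  "F w f (a # Succ t # ts) = F w f (a # S w t # ts)"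
  "F w f (a # b # Succ t # ts) = F w f (a # b # S w t # ts)"
  "F w f (Zero # ts) = F w f (Z w # ts)"
  "F w f (a # Zero # ts) = F w f (a # Z w # ts)"
  "F w f (a # b # Zero # ts) = F w f (a # b # Z w # ts)"
  by (rule F_cong, simp)+


section \<open>Arithmetic\<close>

lemma eq_ax: "(s \<^bold>= t) \<in> axs Xi ==> nf w s = nf w t"
  by (simp add: eq_iff_nf[symmetric] prov.Axiom del: nf_fold)

lemma F_PZero [simp]: "F w PZero ts = Z w"
  using eq_ax[OF axs.PZero_eq, of w ts] by simp

lemma F_PSuc [simp]: "F w PSuc ts = S w (arg Zero 0 ts)"
  using eq_ax[OF axs.PSuc_eq, of w ts] by simp

lemma F_PProj [simp]: "F w (PProj i) ts = nf w (arg Zero i ts)"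
  using eq_ax[OF axs.PProj_eq, of w i ts] by simp

lemma F_PComp [simp]: "F w (PComp f gs) ts = F w f (map (\<lambda>g. F w g ts) gs)"
  using eq_ax[OF axs.PComp_eq, of w f gs ts]
    F_cong[of w "map (\<lambda>g. Fn g ts) gs" "map (\<lambda>g. F w g ts) gs" f] by simp

lemma F_PRec_Z: "F w (PRec f g) (Z w # ts) = F w f ts"
  using eq_ax[OF axs.PRec_Zero_eq, of w f g ts] by simp

lemma F_PRec_S: "F w (PRec f g) (S w t # ts) = F w g (t # F w (PRec f g) (t # ts) # ts)"
  using eq_ax[OF axs.PRec_Succ_eq, of w f g t ts] by simp

lemma ax_frc: "\<phi> \<in> axs Xi ==> frc w \<rho> \<phi>"
  unfolding frc_def by (intro prov.Axiom axs_sub)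

text \<open>The successor case ranges over larger contexts because the induction step is an
  object-level implication. The property must be a formula, which is why later inductions first code
  their claim as one.\<close>

lemma HA_induct:
  assumes "frc w (Zero \<cdot> \<rho>) \<phi>"
    and "\<And>w' t. w \<sqsubseteq> w' ==> frc w' (t \<cdot> \<rho>) \<phi> ==> frc w' (Succ t \<cdot> \<rho>) \<phi>"
  shows "frc w (t \<cdot> \<rho>) \<phi>"
proof -
  have "frc w \<rho> (inst \<phi> Zero)"
    using assms(1) by (simp add: inst_def subt_scons)
  moreover have "frc w \<rho> (All (\<phi> \<^bold>\<longrightarrow> sub (Succ (Var 0) \<cdot> (\<lambda>i. Var (Suc i))) \<phi>))"
    unfolding frc_All by (intro allI frc_impI) (simp add: subt_scons assms(2))
  ultimately have "frc w \<rho> (All \<phi>)"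
    using ax_frc[OF axs.Induction] by (blast intro: frc_mp)
  then show ?thesis by simp
qed

lemma S_inject: "S w x = S w y ==> nf w x = nf w y"
proof -
  assume "S w x = S w y"
  then have "w |- Succ x \<^bold>= Succ y" by (simp add: eq_iff_nf)
  then have "w |- x \<^bold>= y" by (rule prov.ImpE[OF prov.Axiom[OF axs.Succ_inject]])
  then show ?thesis by (simp add: eq_iff_nf)
qed

lemma S_neq_Z: "S w x = Z w ==> w |- Bot"
proof -
  assume "S w x = Z w"
  then have "w |- Succ x \<^bold>= Zero" by (simp add: eq_iff_nf)
  then show ?thesis by (rule prov.ImpE[OF prov.Axiom[OF axs.Succ_not_Zero]])
qed

text \<open>A degenerate induction: neither case uses the hypothesis. The alternative holds only
  locally, since an open term need not be provably of either kind.\<close>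

lemma zero_or_Succ: "Loc w (\<lambda>w'. nf w' t = Z w' \<or> (\<exists>u. nf w' t = S w' u))"
proof -
  have "frc w (t \<cdot> Var) (Var 0 \<^bold>= Zero \<^bold>\<or> Ex (Var 1 \<^bold>= Succ (Var 0)))"
  proof (rule HA_induct)
    show "frc w (Zero \<cdot> Var) (Var 0 \<^bold>= Zero \<^bold>\<or> Ex (Var 1 \<^bold>= Succ (Var 0)))"
      by (simp add: LocI prov.EqRefl)
  next
    fix w' t
    have "Loc w' (\<lambda>v. \<exists>u. v |- Succ t \<^bold>= Succ u)" by (rule LocI) (blast intro: prov.EqRefl)
    then show "frc w' (Succ t \<cdot> Var) (Var 0 \<^bold>= Zero \<^bold>\<or> Ex (Var 1 \<^bold>= Succ (Var 0)))"
      by (simp add: LocI)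
  qed
  then have "Loc w (\<lambda>w'. nf w' t = Z w' \<or> Loc w' (\<lambda>v. \<exists>u. nf v t = S v u))"
    by (simp add: eq_iff_nf)
  then show ?thesis
  proof (rule Loc_bind)
    fix w' assume "nf w' t = Z w' \<or> Loc w' (\<lambda>v. \<exists>u. nf v t = S v u)"
    then show "Loc w' (\<lambda>w'. nf w' t = Z w' \<or> (\<exists>u. nf w' t = S w' u))"
      by (rule disjE) (simp add: LocI, erule Loc_map, blast)
  qed
qed

section \<open>Addition, truncated subtraction and Cantor pairing inside Heyting arithmetic\<close>

lemma F_padd [simp]:
  "F w padd [Z w, y] = nf w y" "F w padd [S w x, y] = S w (F w padd [x, y])"
  unfolding padd_def by (simp_all add: F_PRec_Z F_PRec_S)

lemma F_padd_right [simp]: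
  "F w padd [x, Z w] = nf w x" "F w padd [x, S w y] = S w (F w padd [x, y])"
proof -
  have "frc w (x \<cdot> Var) (Fn padd [Var 0, Zero] \<^bold>= Var 0)"
    by (rule HA_induct) (simp_all add: eq_iff_nf)
  then show "F w padd [x, Z w] = nf w x"
    by (simp add: eq_iff_nf)
  have "frc w (x \<cdot> y \<cdot> Var) (Fn padd [Var 0, Succ (Var 1)] \<^bold>= Succ (Fn padd [Var 0, Var 1]))"
    by (rule HA_induct) (simp_all add: eq_iff_nf)
  then show "F w padd [x, S w y] = S w (F w padd [x, y])"
    by (simp add: eq_iff_nf)
qed

lemma F_padd_commute: "F w padd [x, y] = F w padd [y, x]"
proof -
  have "frc w (x \<cdot> y \<cdot> Var) (Fn padd [Var 0, Var 1] \<^bold>= Fn padd [Var 1, Var 0])"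
    by (rule HA_induct) (simp_all add: eq_iff_nf)
  then show ?thesis
    by (simp add: eq_iff_nf)
qed

lemma F_pcond [simp]: "F w pcond [Z w, x, y] = nf w x" "F w pcond [S w z, x, y] = nf w y"
  unfolding pcond_def by (simp_all add: F_PRec_Z F_PRec_S)

lemma F_ppred [simp]: "F w ppred [Z w] = Z w" "F w ppred [S w x] = nf w x"
  unfolding ppred_def by (simp_all add: F_PRec_Z F_PRec_S)

lemma F_pmonus: "F w pmonus [x, Z w] = nf w x"
  "F w pmonus [x, S w y] = F w ppred [F w pmonus [x, y]]"
  unfolding pmonus_def by (simp_all add: F_PRec_Z F_PRec_S)

lemma F_pmonus_S: "F w pmonus [S w x, S w y] = F w pmonus [x, y]"
proof -
  have "frc w (y \<cdot> x \<cdot> Var) (Fn pmonus [Succ (Var 1), Succ (Var 0)] \<^bold>= Fn pmonus [Var 1, Var 0])"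
    by (rule HA_induct) (simp_all add: eq_iff_nf F_pmonus)
  then show ?thesis
    by (simp add: eq_iff_nf)
qed

text \<open>The order is present only through truncated subtraction; this cancellation law replaces
  reasoning with inequalities in the analysis of \<open>proot\<close>.\<close>

lemma F_pmonus_add_add: "F w pmonus [F w padd [x, y], F w padd [x, z]] = F w pmonus [y, z]"
proof -
  have "frc w (x \<cdot> y \<cdot> z \<cdot> Var)
      (Fn pmonus [Fn padd [Var 0, Var 1], Fn padd [Var 0, Var 2]] \<^bold>= Fn pmonus [Var 1, Var 2])"
    by (rule HA_induct) (simp_all add: eq_iff_nf F_pmonus_S)
  then show ?thesis
    by (simp add: eq_iff_nf)
qed

lemma F_pmonus_add: "F w pmonus [F w padd [x, y], x] = nf w y"
  using F_pmonus_add_add[of w x y "Z w"] by (simp add: F_pmonus)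

lemma F_pmonus_self: "F w pmonus [x, x] = Z w"
  using F_pmonus_add[of w x "Z w"] by simp

lemma F_ptri [simp]: "F w ptri [Z w] = Z w" "F w ptri [S w x] = F w padd [F w ptri [x], S w x]"
  unfolding ptri_def by (simp_all add: F_PRec_Z F_PRec_S)

lemma F_proot [simp]: "F w proot [Z w] = Z w"
  "F w proot [S w x] = F w pcond [F w pmonus [F w ptri [S w (F w proot [x])], S w x],
     S w (F w proot [x]), F w proot [x]]"
  unfolding proot_def by (simp_all add: F_PRec_Z F_PRec_S)

text \<open>The term \<open>c\<close> witnesses \<open>a \<le> r\<close>. From
  \<open>triangle r\<close> up to \<open>triangle r + r\<close> the search in \<open>proot\<close>
  does not advance, because its test against the next triangle number fails. Induction on
  \<open>a\<close> has to quantify over \<open>c\<close>, which shrinks as \<open>a\<close>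
  grows.\<close>

lemma F_proot_step:
  assumes "F w proot [F w ptri [r]] = nf w r" and "F w padd [a, c] = nf w r"
  shows "F w proot [F w padd [F w ptri [r], a]] = nf w r"
proof -
  have "frc w (a \<cdot> r \<cdot> Var) (All (Fn padd [Var 1, Var 0] \<^bold>= Var 2 \<^bold>\<longrightarrow>
      Fn proot [Fn padd [Fn ptri [Var 2], Var 1]] \<^bold>= Var 2))"
  proof (rule HA_induct)
    have "w |- Fn proot [Fn ptri [r]] \<^bold>= r"
      using assms(1) by (simp add: eq_iff_nf)
    from mono[OF this]
    show "frc w (Zero \<cdot> r \<cdot> Var) (All (Fn padd [Var 1, Var 0] \<^bold>= Var 2 \<^bold>\<longrightarrow>
        Fn proot [Fn padd [Fn ptri [Var 2], Var 1]] \<^bold>= Var 2))"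
      unfolding frc_All by (intro allI frc_impI) (simp add: eq_iff_nf)
  next
    fix w' a
    assume *: "frc w' (a \<cdot> r \<cdot> Var) (All (Fn padd [Var 1, Var 0] \<^bold>= Var 2 \<^bold>\<longrightarrow>
        Fn proot [Fn padd [Fn ptri [Var 2], Var 1]] \<^bold>= Var 2))"
    show "frc w' (Succ a \<cdot> r \<cdot> Var) (All (Fn padd [Var 1, Var 0] \<^bold>= Var 2 \<^bold>\<longrightarrow>
        Fn proot [Fn padd [Fn ptri [Var 2], Var 1]] \<^bold>= Var 2))"
      unfolding frc_All
    proof (intro allI frc_impI)
      fix v c assume v: "w' \<sqsubseteq> v"
        and "frc v (c \<cdot> Succ a \<cdot> r \<cdot> Var) (Fn padd [Var 1, Var 0] \<^bold>= Var 2)"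
      then have c: "S v (F v padd [a, c]) = nf v r"
        by (simp add: eq_iff_nf)
      have IH: "F v proot [F v padd [F v ptri [r], a]] = nf v r"
        using frc_mp[OF frc_mono[OF * v, unfolded frc_All, THEN spec, of "S v c"]] c
        by (simp add: eq_iff_nf)
      \<comment> \<open>The test of \<open>proot\<close>: the next triangle number minus the new
        argument is \<open>r - a\<close>, which is the successor of \<open>c\<close>, so
        \<open>pcond\<close> keeps the old root.\<close>
      have "F v pmonus [F v ptri [S v r], S v (F v padd [F v ptri [r], a])]
          = F v pmonus [F v padd [F v ptri [r], S v r], F v padd [F v ptri [r], S v a]]"
        by simp
      also have "\<dots> = F v pmonus [r, a]"
        by (simp only: F_pmonus_add_add F_pmonus_S)
      also have "\<dots> = F v pmonus [F v padd [a, S v c], a]"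
        using c by simp
      also have "\<dots> = S v c"
        by (simp only: F_pmonus_add nf_F)
      finally have "F v proot [S v (F v padd [F v ptri [r], a])] = nf v r"
        using IH by simp
      then show "frc v (c \<cdot> Succ a \<cdot> r \<cdot> Var) (Fn proot [Fn padd [Fn ptri [Var 2], Var 1]] \<^bold>= Var 2)"
        by (simp add: eq_iff_nf del: F_proot)
    qed
  qed
  then have "frc w (c \<cdot> a \<cdot> r \<cdot> Var) (Fn padd [Var 1, Var 0] \<^bold>= Var 2 \<^bold>\<longrightarrow>
      Fn proot [Fn padd [Fn ptri [Var 2], Var 1]] \<^bold>= Var 2)"
    unfolding frc_All by blast
  from frc_mp[OF this] show ?thesis
    using assms(2) by (simp add: eq_iff_nf)
qed

text \<open>The last argument before \<open>triangle (r + 1)\<close> is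
  \<open>triangle r + r\<close>, where the root is still \<open>r\<close> by the previous lemma with
  \<open>c = 0\<close>; there the difference tested is zero, so the root advances.\<close>

lemma F_proot_tri: "F w proot [F w ptri [r]] = nf w r"
proof -
  have "frc w (r \<cdot> Var) (Fn proot [Fn ptri [Var 0]] \<^bold>= Var 0)"
  proof (rule HA_induct)
    fix w' r assume "frc w' (r \<cdot> Var) (Fn proot [Fn ptri [Var 0]] \<^bold>= Var 0)"
    then have "F w' proot [F w' ptri [r]] = nf w' r"
      by (simp add: eq_iff_nf)
    from F_proot_step[OF this, of r "Z w'"]
    have "F w' proot [F w' padd [F w' ptri [r], r]] = nf w' r" by simp
    then have "F w' proot [F w' ptri [S w' r]] = S w' r"
      by (simp add: F_pmonus_self)
    then show "frc w' (Succ r \<cdot> Var) (Fn proot [Fn ptri [Var 0]] \<^bold>= Var 0)"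
      by (simp add: eq_iff_nf del: F_ptri)
  qed (simp add: eq_iff_nf)
  then show ?thesis by (simp add: eq_iff_nf)
qed

lemma F_proot_pair: "F w proot [F w ppair [a, c]] = F w padd [a, c]"
  using F_proot_step[of w "F w padd [a, c]" a c] by (simp add: ppair_def F_proot_tri)

lemma F_pfst [simp]: "F w pfst [F w ppair [a, c]] = nf w a"
  using F_pmonus_add[of w "F w ptri [F w padd [a, c]]" a]
  by (simp add: pfst_def F_proot_pair) (simp add: ppair_def)

lemma F_psnd [simp]: "F w psnd [F w ppair [a, c]] = nf w c"
  using F_pmonus_add[of w a c] by (simp add: psnd_def F_proot_pair)


section \<open>Kleene application\<close>

lemma subst_rules:
  assumes "w |- s \<^bold>= t"
  shows Vset_subst: "w |- Vset s ==> w |- Vset t"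
    and Meaningful_subst: "w |- Meaningful s ==> w |- Meaningful t"
    and Tr_subst: "w |- Tr s ==> w |- Tr t"
    and app_subst1: "w |- app_eq s a b ==> w |- app_eq t a b"
    and app_subst2: "w |- app_eq a s b ==> w |- app_eq a t b"
    and app_subst3: "w |- app_eq a b s ==> w |- app_eq a b t"
    and in_EL_subst1: "w |- in_EL s a ==> w |- in_EL t a"
    and in_EL_subst2: "w |- in_EL a s ==> w |- in_EL a t"
    and rel_subst1: "w |- rel E s a ==> w |- rel E t a"
    and rel_subst2: "w |- rel E a s ==> w |- rel E a t"
    and eL_cong: "w |- eL s \<^bold>= eL t"
    and eR_cong: "w |- eR s \<^bold>= eR t"
  using eq_subst[OF assms, of Var "Vset (Var 0)"] eq_subst[OF assms, of Var "Meaningful (Var 0)"]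
    eq_subst[OF assms, of Var "Tr (Var 0)"]
    eq_subst[OF assms, of Var "app_eq (Var 0) (lift a) (lift b)"]
    eq_subst[OF assms, of Var "app_eq (lift a) (Var 0) (lift b)"]
    eq_subst[OF assms, of Var "app_eq (lift a) (lift b) (Var 0)"]
    eq_subst[OF assms, of Var "in_EL (Var 0) (lift a)"]
    eq_subst[OF assms, of Var "in_EL (lift a) (Var 0)"]
    eq_subst[OF assms, of Var "rel E (Var 0) (lift a)"]
    eq_subst[OF assms, of Var "rel E (lift a) (Var 0)"]
    eq_subst[OF assms, of Var "eL (lift s) \<^bold>= eL (Var 0)"]
    eq_subst[OF assms, of Var "eR (lift s) \<^bold>= eR (Var 0)"]
  by (simp_all add: prov.EqRefl)

lemma eL_pair: "w |- eL (Fn ppair [a, c]) \<^bold>= a" and eR_pair: "w |- eR (Fn ppair [a, c]) \<^bold>= c"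
  by (simp_all add: eq_iff_nf eL_def eR_def)

section \<open>Uniqueness of the result of Kleene application\<close>

lemma app_eq_iff: "w |- app_eq e n m \<longleftrightarrow> Loc w (\<lambda>v. \<exists>s. F v pkleene [s, e, n] = S v m)"
proof -
  have "frc w Var (app_eq e n m) \<longleftrightarrow> Loc w (\<lambda>v. \<exists>s. F v pkleene [s, e, n] = S v m)"
    unfolding app_eq_def by (simp add: eq_iff_nf)
  then show ?thesis by simp
qed

lemma F_prun: "F w prun [Z w, e, n] = F w ppair [S w e, F w ppair [n, Z w]]"
  "F w prun [S w s, e, n] = F w pstep [F w prun [s, e, n]]"
  unfolding prun_def cConf_def by (simp_all add: F_PRec_Z F_PRec_S)

lemma F_pkleene: "F w pkleene [s, e, n] =
  F w pcond [F w pfst [F w prun [s, e, n]],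
    F w pcond [F w psnd [F w psnd [F w prun [s, e, n]]], S w (F w pfst [F w psnd [F w prun [s, e, n]]]), Z w],
    Z w]"
  unfolding pkleene_def by simp

lemma pstep_halted:
  assumes "F w pfst [c] = Z w" "F w psnd [F w psnd [c]] = Z w"
  shows "F w pstep [c] = nf w c"
proof -
  \<comment> \<open>Only the two outer tests decide what happens to a halted configuration; keeping
    the remaining branches opaque spares their evaluation.\<close>
  obtain A B where "pstep = cIf0 (cL (PProj 0)) (cIf0 (cR (cR (PProj 0))) (PProj 0) A) B"
    unfolding pstep_def Let_def by blast
  then have "F w pstep [c] = F w (cIf0 (cL (PProj 0)) (cIf0 (cR (cR (PProj 0))) (PProj 0) A) B) [c]"
    by (rule arg_cong)
  also have "\<dots> = nf w c" using assms by simp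
  finally show ?thesis .
qed

text \<open>In its two other branches \<open>pkleene\<close> returns zero, which cannot equal
  \<open>S w m\<close>. Both tests are decided locally by \<open>zero_or_Succ\<close>.\<close>

lemma pkleene_halted:
  assumes "F w pkleene [s, e, n] = S w m"
  shows "Loc w (\<lambda>v. F v pfst [F v prun [s, e, n]] = Z v \<and>
    F v psnd [F v psnd [F v prun [s, e, n]]] = Z v)"
proof -
  let ?c = "Fn prun [s, e, n]"
  have up: "F v pkleene [s, e, n] = S v m" if "w \<sqsubseteq> v" for v
    using mono[of w "Fn pkleene [s, e, n] \<^bold>= Succ m" v] that assms by (simp add: eq_iff_nf)
  have absurd: "Z v = S v m ==> Loc v Q" for v Q
    by (metis Bot_Loc S_neq_Z)
  show ?thesis
  proof (rule Loc_bind[OF zero_or_Succ[of w "Fn pfst [?c]"]])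
    fix v assume v: "w \<sqsubseteq> v" and "nf v (Fn pfst [?c]) = Z v \<or> (\<exists>u. nf v (Fn pfst [?c]) = S v u)"
    then consider "F v pfst [F v prun [s, e, n]] = Z v" | u where "F v pfst [F v prun [s, e, n]] = S v u"
      by auto
    then show "Loc v (\<lambda>v. F v pfst [F v prun [s, e, n]] = Z v \<and>
        F v psnd [F v psnd [F v prun [s, e, n]]] = Z v)"
    proof cases
      case 1
      show ?thesis
      proof (rule Loc_bind[OF zero_or_Succ[of v "Fn psnd [Fn psnd [?c]]"]])
        fix v' assume v': "v \<sqsubseteq> v'" and "nf v' (Fn psnd [Fn psnd [?c]]) = Z v' \<or>
          (\<exists>u. nf v' (Fn psnd [Fn psnd [?c]]) = S v' u)"
        moreover have 1: "F v' pfst [F v' prun [s, e, n]] = Z v'"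
          using mono[of v "Fn pfst [?c] \<^bold>= Zero" v'] v' 1 by (simp add: eq_iff_nf)
        moreover have "F v' pkleene [s, e, n] = S v' m" using up v v' by blast
        ultimately show "Loc v' (\<lambda>v. F v pfst [F v prun [s, e, n]] = Z v \<and>
            F v psnd [F v psnd [F v prun [s, e, n]]] = Z v)"
          using absurd by (auto simp: F_pkleene intro: LocI)
      qed
    next
      case 2
      with up[OF v] show ?thesis using absurd by (auto simp: F_pkleene)
    qed
  qed
qed

text \<open>A halted configuration is fixed by \<open>pstep\<close>, so induction on the number
  \<open>d\<close> of extra steps leaves \<open>prun\<close> unchanged. Halting is known only
  locally, hence the claim is first proved as an equation of the object language, to which
  \<open>LocE\<close> applies.\<close>

lemma pkleene_stable:
  assumes "F w pkleene [s, e, n] = S w m"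
  shows "F w pkleene [F w padd [d, s], e, n] = S w m"
proof -
  have "w |- Fn prun [Fn padd [d, s], e, n] \<^bold>= Fn prun [s, e, n]"
  proof (rule LocE[OF pkleene_halted[OF assms]])
    fix v assume "F v pfst [F v prun [s, e, n]] = Z v \<and> F v psnd [F v psnd [F v prun [s, e, n]]] = Z v"
    then have c: "v |- Fn pfst [Fn prun [s, e, n]] \<^bold>= Zero"
      "v |- Fn psnd [Fn psnd [Fn prun [s, e, n]]] \<^bold>= Zero"
      by (simp_all add: eq_iff_nf)
    have "frc v (d \<cdot> s \<cdot> e \<cdot> n \<cdot> Var)
      (Fn prun [Fn padd [Var 0, Var 1], Var 2, Var 3] \<^bold>= Fn prun [Var 1, Var 2, Var 3])"
    proof (rule HA_induct)
      fix v' d assume v': "v \<sqsubseteq> v'" and "frc v' (d \<cdot> s \<cdot> e \<cdot> n \<cdot> Var)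
        (Fn prun [Fn padd [Var 0, Var 1], Var 2, Var 3] \<^bold>= Fn prun [Var 1, Var 2, Var 3])"
      then have "F v' prun [F v' padd [d, s], e, n] = F v' prun [s, e, n]"
        by (simp add: eq_iff_nf eval_nat_numeral)
      moreover have "F v' pstep [F v' prun [s, e, n]] = F v' prun [s, e, n]"
        using mono[OF c(1) v'] mono[OF c(2) v']
        by (subst pstep_halted) (simp_all add: eq_iff_nf)
      ultimately show "frc v' (Succ d \<cdot> s \<cdot> e \<cdot> n \<cdot> Var)
        (Fn prun [Fn padd [Var 0, Var 1], Var 2, Var 3] \<^bold>= Fn prun [Var 1, Var 2, Var 3])"
        by (simp add: eq_iff_nf F_prun eval_nat_numeral)
    qed (simp add: eq_iff_nf eval_nat_numeral)
    then show "v |- Fn prun [Fn padd [d, s], e, n] \<^bold>= Fn prun [s, e, n]"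
      by (simp add: eval_nat_numeral)
  qed
  then have "F w prun [F w padd [d, s], e, n] = F w prun [s, e, n]"
    by (simp add: eq_iff_nf)
  then show ?thesis using assms by (simp add: F_pkleene)
qed

text \<open>Both runs are prolonged to the same length, the sum of their lengths, where stability
  makes both results visible in one configuration. This is used throughout to pass from one value of
  an application to another.\<close>

lemma app_fun:
  assumes "w |- app_eq e n m" "w |- app_eq e n m'"
  shows "w |- m \<^bold>= m'"
proof (rule LocE[OF assms(1)[unfolded app_eq_iff]])
  fix v assume v: "w \<sqsubseteq> v" and "\<exists>s. F v pkleene [s, e, n] = S v m"
  then obtain s where s: "F v pkleene [s, e, n] = S v m" by blast
  show "v |- m \<^bold>= m'"
  proof (rule LocE[OF mono[OF assms(2) v, unfolded app_eq_iff]])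
    fix u assume u: "v \<sqsubseteq> u" and "\<exists>s. F u pkleene [s, e, n] = S u m'"
    then obtain s' where s': "F u pkleene [s', e, n] = S u m'" by blast
    have s: "F u pkleene [s, e, n] = S u m"
      using mono[of v "Fn pkleene [s, e, n] \<^bold>= Succ m" u] s u by (simp add: eq_iff_nf)
    have "S u m = S u m'"
      using pkleene_stable[OF s, of s'] pkleene_stable[OF s', of s] by (simp add: F_padd_commute[of u s s'])
    from S_inject[OF this] show "u |- m \<^bold>= m'" by (simp add: eq_iff_nf)
  qed
qed

subsection \<open>A nowhere defined index\<close>

text \<open>Tag \<open>8\<close> is not the tag of any schema, so the machine never leaves its initial configuration.\<close>

definition und :: trm where
  "und = Fn ppair [(Succ ^^ 8) Zero, Zero]"

text \<open>Each entry passed takes one predecessor off the selector; a selector that is a numeral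
  no smaller than the number of entries runs through to the default.\<close>

lemma F_cCase_default:
  "F w c xs = (S w ^^ k) (Z w) ==> length as \<le> k ==> F w (cCase c as d) xs = F w d xs"
proof (induction as arbitrary: c k)
  case (Cons a as)
  then obtain k' where k: "k = Suc k'" by (cases k) auto
  have "nf w ((S w ^^ k') (Z w)) = (S w ^^ k') (Z w)" by (cases k') auto
  then have "F w (cCase (cPred c) as d) xs = F w d xs"
    using Cons k by (intro Cons.IH[of _ k']) auto
  then show ?case using Cons.prems k by simp
qed simp

lemma pstep_und:
  assumes "F w pfst [c] = S w und"
  shows "F w pstep [c] = nf w c"
proof -
  have "\<exists>A as. pstep = cIf0 (cL (PProj 0)) A (cCase (cL (cPred (cL (PProj 0)))) as (PProj 0)) \<and> length as = 8"
    unfolding pstep_def Let_def by (intro exI conjI, rule refl, simp)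
  then obtain A as where as: "pstep = cIf0 (cL (PProj 0)) A (cCase (cL (cPred (cL (PProj 0)))) as (PProj 0))"
    "length as = 8" by blast
  have "F w (cL (cPred (cL (PProj 0)))) [c] = (S w ^^ 8) (Z w)"
    using assms by (simp add: und_def eval_nat_numeral)
  from F_cCase_default[OF this, of as "PProj 0"] as(2)
  have "F w (cIf0 (cL (PProj 0)) A (cCase (cL (cPred (cL (PProj 0)))) as (PProj 0))) [c] = nf w c"
    using assms by simp
  then show ?thesis by (simp only: as(1))
qed

lemma und_undefined: "w |- app_eq und n m ==> w |- Bot"
proof -
  let ?c = "Fn ppair [Succ und, Fn ppair [n, Zero]]"
  assume "w |- app_eq und n m"
  then have "Loc w (\<lambda>v. \<exists>s. F v pkleene [s, und, n] = S v m)" by (simp add: app_eq_iff)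
  then show ?thesis
  proof (rule LocE)
    fix v assume "\<exists>s. F v pkleene [s, und, n] = S v m"
    then obtain s where s: "F v pkleene [s, und, n] = S v m" by blast
    have "frc v (s \<cdot> und \<cdot> n \<cdot> Var) (Fn prun [Var 0, Var 1, Var 2] \<^bold>= Fn ppair [Succ (Var 1), Fn ppair [Var 2, Zero]])"
      by (rule HA_induct) (simp_all add: eq_iff_nf F_prun pstep_und)
    then have "F v pfst [F v prun [s, und, n]] = S v und"
      by (simp add: eq_iff_nf)
    with s have "S v m = Z v" by (simp add: F_pkleene)
    then show "v |- Bot" by (rule S_neq_Z)
  qed
qed


section \<open>The axioms as forcing rules\<close>

lemma frc_spec: "frc w \<rho> (All \<phi>) ==> frc w (t \<cdot> \<rho>) \<phi>"
  by simp

lemma frc_Iff: "frc w \<rho> (\<phi> \<^bold>\<longleftrightarrow> \<psi>) \<longleftrightarrow> (\<forall>w'. w \<sqsubseteq> w' --> (frc w' \<rho> \<phi> \<longleftrightarrow> frc w' \<rho> \<psi>))"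
  unfolding frc_And frc_Imp by blast

text \<open>The three conjuncts of \<open>vcond\<close> each speak of a value of \<open>xn\<close>
  of their own; \<open>app_fun\<close> merges these values into a single \<open>p\<close>.\<close>

lemma frc_vcond:
  "frc w (x \<cdot> \<rho>) (vcond \<phi>) \<longleftrightarrow> (\<forall>n w'. w \<sqsubseteq> w' --> Loc w' (\<lambda>v. \<exists>p. v |- app_eq x n p \<and>
    v |- Meaningful (eR p) \<and> (\<forall>u. v \<sqsubseteq> u --> u |- Tr (eR p) --> frc u (eL p \<cdot> \<rho>) \<phi>)))"
  (is "_ \<longleftrightarrow> ?R")
proof -
  have iff: "frc w (x \<cdot> \<rho>) (vcond \<phi>) \<longleftrightarrow>
    (\<forall>n. Loc w (\<lambda>v. \<exists>p. v |- app_eq x n p) \<and>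
      Loc w (\<lambda>v. \<exists>p. v |- app_eq x n p \<and> v |- Meaningful (eR p)) \<and>
      (\<forall>w'. w \<sqsubseteq> w' --> Loc w' (\<lambda>v. \<exists>p. v |- app_eq x n p \<and> v |- Tr (eR p)) -->
        Loc w' (\<lambda>v. \<exists>p. v |- app_eq x n p \<and> frc v (eL p \<cdot> \<rho>) \<phi>)))" for w
    unfolding vcond_def by (simp add: frc_Imp subt_scons eval_nat_numeral cong del: imp_cong)
  show ?thesis
  proof
    assume vc: "frc w (x \<cdot> \<rho>) (vcond \<phi>)"
    show ?R
    proof (intro allI impI)
      fix n w' assume "w \<sqsubseteq> w'"
      from frc_mono[OF vc this, unfolded iff] have
        M: "Loc w' (\<lambda>v. \<exists>p. v |- app_eq x n p \<and> v |- Meaningful (eR p))" and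
        T: "\<And>v. w' \<sqsubseteq> v ==> Loc v (\<lambda>v. \<exists>p. v |- app_eq x n p \<and> v |- Tr (eR p)) ==>
          Loc v (\<lambda>v. \<exists>p. v |- app_eq x n p \<and> frc v (eL p \<cdot> \<rho>) \<phi>)"
        by blast+
      show "Loc w' (\<lambda>v. \<exists>p. v |- app_eq x n p \<and> v |- Meaningful (eR p) \<and>
        (\<forall>u. v \<sqsubseteq> u --> u |- Tr (eR p) --> frc u (eL p \<cdot> \<rho>) \<phi>))"
      proof (rule Loc_map[OF M], elim exE conjE, intro exI conjI allI impI)
        fix v p u assume v: "w' \<sqsubseteq> v" "v \<sqsubseteq> u" and p: "v |- app_eq x n p" and tr: "u |- Tr (eR p)"
        have "Loc u (\<lambda>v. \<exists>p. v |- app_eq x n p \<and> frc v (eL p \<cdot> \<rho>) \<phi>)"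
          by (rule T[OF order_trans[OF v] LocI]) (use mono[OF p v(2)] tr in blast)
        then show "frc u (eL p \<cdot> \<rho>) \<phi>"
        proof (rule frc_LocE, elim exE conjE)
          fix t q assume "u \<sqsubseteq> t" and q: "t |- app_eq x n q" "frc t (eL q \<cdot> \<rho>) \<phi>"
          with p v have "t |- app_eq x n p" by (meson mono)
          from eL_cong[OF app_fun[OF q(1) this]] q(2) show "frc t (eL p \<cdot> \<rho>) \<phi>" by (rule eq_subst)
        qed
      qed
    qed
  next
    assume R: ?R
    show "frc w (x \<cdot> \<rho>) (vcond \<phi>)"
      unfolding iff
    proof (intro allI conjI impI)
      fix n
      show "Loc w (\<lambda>v. \<exists>p. v |- app_eq x n p)"
        "Loc w (\<lambda>v. \<exists>p. v |- app_eq x n p \<and> v |- Meaningful (eR p))"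
        by (rule Loc_map[OF R[rule_format, OF order_refl]]; blast)+
    next
      fix n w' assume w': "w \<sqsubseteq> w'"
        and T: "Loc w' (\<lambda>v. \<exists>p. v |- app_eq x n p \<and> v |- Tr (eR p))"
      show "Loc w' (\<lambda>v. \<exists>p. v |- app_eq x n p \<and> frc v (eL p \<cdot> \<rho>) \<phi>)"
      proof (rule Loc_bind[OF T], elim exE conjE)
        fix v p assume v: "w' \<sqsubseteq> v" and p: "v |- app_eq x n p" "v |- Tr (eR p)"
        show "Loc v (\<lambda>v. \<exists>p. v |- app_eq x n p \<and> frc v (eL p \<cdot> \<rho>) \<phi>)"
        proof (rule Loc_map[OF R[rule_format, OF order_trans[OF w' v], of n]], elim exE conjE)
          fix u q assume u: "v \<sqsubseteq> u" and q: "u |- app_eq x n q"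
            and *: "\<forall>t. u \<sqsubseteq> t --> t |- Tr (eR q) --> frc t (eL q \<cdot> \<rho>) \<phi>"
          have "u |- Tr (eR q)"
            using eR_cong[OF app_fun[OF mono[OF p(1) u] q]] mono[OF p(2) u] by (rule Tr_subst)
          with * q show "\<exists>p. u |- app_eq x n p \<and> frc u (eL p \<cdot> \<rho>) \<phi>" by blast
        qed
      qed
    qed
  qed
qed

lemma Vset_intro:
  assumes "\<And>n w'. w \<sqsubseteq> w' ==> Loc w' (\<lambda>v. \<exists>p. v |- app_eq x n p \<and> v |- Meaningful (eR p) \<and>
    (\<forall>u. v \<sqsubseteq> u --> u |- Tr (eR p) --> u |- Vset (eL p)))"
  shows "w |- Vset x"
proof -
  have "frc w (x \<cdot> Var) (vcond (Vset (Var 0)))"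
    unfolding frc_vcond using assms by simp
  with ax_frc[OF axs.V1, of w Var, unfolded frc_All, THEN spec, of x]
  have "frc w (x \<cdot> Var) (Vset (Var 0))" by (rule frc_mp)
  then show ?thesis by simp
qed

lemma Vset_induct_vcond:
  assumes "\<And>x w'. w \<sqsubseteq> w' ==> frc w' (x \<cdot> \<rho>) (vcond \<phi>) ==> frc w' (x \<cdot> \<rho>) \<phi>"
    and "w |- Vset x"
  shows "frc w (x \<cdot> \<rho>) \<phi>"
proof -
  have "frc w \<rho> (All (vcond \<phi> \<^bold>\<longrightarrow> \<phi>))"
    unfolding frc_All by (intro allI frc_impI assms(1))
  with ax_frc[OF axs.V2] have "frc w \<rho> (All (Vset (Var 0) \<^bold>\<longrightarrow> \<phi>))" by (rule frc_mp)
  then have "frc w (x \<cdot> \<rho>) (Vset (Var 0) \<^bold>\<longrightarrow> \<phi>)" unfolding frc_All by blast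
  then show ?thesis by (rule frc_mp) (simp add: assms(2))
qed

text \<open>The converse of (V1), obtained by applying (V2) to the closure condition itself: if the
  elements satisfy it they are v-sets by (V1), and so it holds of \<open>x\<close>.\<close>

lemma Vset_elim:
  assumes "w |- Vset x"
  shows "Loc w (\<lambda>v. \<exists>p. v |- app_eq x n p \<and> v |- Meaningful (eR p) \<and>
    (\<forall>u. v \<sqsubseteq> u --> u |- Tr (eR p) --> u |- Vset (eL p)))"
proof -
  have "frc w (x \<cdot> Var) (vcond (Vset (Var 0)))"
  proof (rule Vset_induct_vcond[OF _ assms])
    fix x w' assume *: "frc w' (x \<cdot> Var) (vcond (vcond (Vset (Var 0))))"
    have V: "u |- Vset y" if "frc u (y \<cdot> Var) (vcond (Vset (Var 0)))" for u y
      by (rule Vset_intro) (use that in \<open>simp add: frc_vcond\<close>)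
    show "frc w' (x \<cdot> Var) (vcond (Vset (Var 0)))"
      unfolding frc_vcond
    proof (intro allI impI)
      fix n v assume v: "w' \<sqsubseteq> v"
      show "Loc v (\<lambda>v. \<exists>p. v |- app_eq x n p \<and> v |- Meaningful (eR p) \<and>
          (\<forall>u. v \<sqsubseteq> u --> u |- Tr (eR p) --> frc u (eL p \<cdot> Var) (Vset (Var 0))))"
        by (rule Loc_map[OF *[unfolded frc_vcond[where \<phi> = "vcond _"], rule_format, OF v, of n]])
          (use V in \<open>fastforce\<close>)
    qed
  qed
  then show ?thesis unfolding frc_vcond by simp
qed

text \<open>The truth of the condition and the equation for the element are separate existential
  statements in \<open>in_EL\<close>; uniqueness of the value lets one \<open>p\<close> serve for
  both.\<close>

lemma in_EL_iff:
  "w |- in_EL a x \<longleftrightarrow> Loc w (\<lambda>v. \<exists>n p. v |- app_eq x n p \<and> v |- Tr (eR p) \<and> v |- a \<^bold>= eL p)"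
proof -
  have iff: "frc w Var (in_EL a x) \<longleftrightarrow> Loc w (\<lambda>v. \<exists>n. Loc v (\<lambda>u. \<exists>p. u |- app_eq x n p \<and> u |- Tr (eR p)) \<and>
      Loc v (\<lambda>u. \<exists>p. u |- app_eq x n p \<and> u |- a \<^bold>= eL p))"
    unfolding in_EL_def by simp
  show ?thesis
    unfolding proves_frc[of w "in_EL a x"] iff
  proof
    assume "Loc w (\<lambda>v. \<exists>n p. v |- app_eq x n p \<and> v |- Tr (eR p) \<and> v |- a \<^bold>= eL p)"
    then show "Loc w (\<lambda>v. \<exists>n. Loc v (\<lambda>u. \<exists>p. u |- app_eq x n p \<and> u |- Tr (eR p)) \<and>
      Loc v (\<lambda>u. \<exists>p. u |- app_eq x n p \<and> u |- a \<^bold>= eL p))"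
      by (rule Loc_map) (blast intro: LocI)
  next
    assume "Loc w (\<lambda>v. \<exists>n. Loc v (\<lambda>u. \<exists>p. u |- app_eq x n p \<and> u |- Tr (eR p)) \<and>
      Loc v (\<lambda>u. \<exists>p. u |- app_eq x n p \<and> u |- a \<^bold>= eL p))"
    then show "Loc w (\<lambda>v. \<exists>n p. v |- app_eq x n p \<and> v |- Tr (eR p) \<and> v |- a \<^bold>= eL p)"
    proof (rule Loc_bind, elim exE conjE)
      fix v n assume v: "w \<sqsubseteq> v"
        and A: "Loc v (\<lambda>u. \<exists>p. u |- app_eq x n p \<and> u |- Tr (eR p))"
        and B: "Loc v (\<lambda>u. \<exists>p. u |- app_eq x n p \<and> u |- a \<^bold>= eL p)"
      \<comment> \<open>Weakening is available for formulas, so the local statement is packed into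
        one before moving to a larger context.\<close>
      have B: "v |- Ex (app_eq (lift x) (lift n) (Var 0) \<^bold>\<and> lift a \<^bold>= eL (Var 0))"
        unfolding proves_frc using B by simp
      show "Loc v (\<lambda>v. \<exists>n p. v |- app_eq x n p \<and> v |- Tr (eR p) \<and> v |- a \<^bold>= eL p)"
      proof (rule Loc_bind[OF A], elim exE conjE)
        fix u p assume u: "v \<sqsubseteq> u" and p: "u |- app_eq x n p" "u |- Tr (eR p)"
        have B: "Loc u (\<lambda>u. \<exists>p. u |- app_eq x n p \<and> u |- a \<^bold>= eL p)"
          using mono[OF B u] unfolding proves_frc by simp
        show "Loc u (\<lambda>v. \<exists>n p. v |- app_eq x n p \<and> v |- Tr (eR p) \<and> v |- a \<^bold>= eL p)"
        proof (rule Loc_map[OF B], elim exE conjE)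
          fix t q assume t: "u \<sqsubseteq> t" and q: "t |- app_eq x n q" "t |- a \<^bold>= eL q"
          have "t |- eL q \<^bold>= eL p" by (rule eL_cong[OF app_fun[OF q(1) mono[OF p(1) t]]])
          with q(2) have "t |- a \<^bold>= eL p" by (rule eq_trans)
          with p t show "\<exists>n p. t |- app_eq x n p \<and> t |- Tr (eR p) \<and> t |- a \<^bold>= eL p"
            by (meson mono)
        qed
      qed
    qed
  qed
qed

lemma in_EL_I:
  "w |- app_eq x n p ==> w |- Tr (eR p) ==> w |- a \<^bold>= eL p ==> w |- in_EL a x"
  unfolding in_EL_iff by (blast intro: LocI)

lemma in_EL_Vset:
  assumes "w |- Vset x" "w |- in_EL a x"
  shows "w |- Vset a"
proof (rule LocE[OF assms(2)[unfolded in_EL_iff]], elim exE conjE)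
  fix v n p assume v: "w \<sqsubseteq> v" and p: "v |- app_eq x n p" "v |- Tr (eR p)" "v |- a \<^bold>= eL p"
  show "v |- Vset a"
  proof (rule LocE[OF Vset_elim[OF mono[OF assms(1) v], of n]], elim exE conjE)
    fix u q assume u: "v \<sqsubseteq> u" and q: "u |- app_eq x n q"
      and *: "\<forall>t. u \<sqsubseteq> t --> t |- Tr (eR q) --> t |- Vset (eL q)"
    have eq: "u |- p \<^bold>= q" by (rule app_fun[OF mono[OF p(1) u] q])
    have "u |- Vset (eL q)" using * Tr_subst[OF eR_cong[OF eq] mono[OF p(2) u]] by blast
    moreover have "u |- eL q \<^bold>= a"
      using eq_trans[OF mono[OF p(3) u] eL_cong[OF eq]] by (rule eq_sym)
    ultimately show "u |- Vset a" by (blast intro: Vset_subst)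
  qed
qed

text \<open>Set induction along \<open>in_EL\<close>: the hypothesis ranges over the elements, in
  every larger context, instead of over positions of the enumeration.\<close>

lemma Vset_induct:
  assumes "w |- Vset x"
    and "\<And>w' x. w \<sqsubseteq> w' ==> w' |- Vset x ==>
      (\<And>v a. w' \<sqsubseteq> v ==> v |- in_EL a x ==> frc v (a \<cdot> \<rho>) \<phi>) ==> frc w' (x \<cdot> \<rho>) \<phi>"
  shows "frc w (x \<cdot> \<rho>) \<phi>"
proof -
  \<comment> \<open>With \<open>Vset\<close> carried along in the induction formula, the case for
    \<open>x\<close> may use that \<open>x\<close> is a v-set.\<close>
  have "frc w (x \<cdot> \<rho>) (Vset (Var 0) \<^bold>\<and> \<phi>)"
  proof (rule Vset_induct_vcond[OF _ assms(1)])
    fix x w' assume w': "w \<sqsubseteq> w'" and "frc w' (x \<cdot> \<rho>) (vcond (Vset (Var 0) \<^bold>\<and> \<phi>))"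
    then have *: "Loc v (\<lambda>v. \<exists>p. v |- app_eq x n p \<and> v |- Meaningful (eR p) \<and>
        (\<forall>u. v \<sqsubseteq> u --> u |- Tr (eR p) --> u |- Vset (eL p) \<and> frc u (eL p \<cdot> \<rho>) \<phi>))"
      if "w' \<sqsubseteq> v" for n v
      using that unfolding frc_vcond by simp
    have V: "w' |- Vset x"
      by (rule Vset_intro, rule Loc_map[OF *]) blast+
    moreover have "frc w' (x \<cdot> \<rho>) \<phi>"
    proof (rule assms(2)[OF w' V])
      fix v a assume v: "w' \<sqsubseteq> v" and "v |- in_EL a x"
      from this(2)[unfolded in_EL_iff] show "frc v (a \<cdot> \<rho>) \<phi>"
      proof (rule frc_LocE, elim exE conjE)
        fix u n p assume u: "v \<sqsubseteq> u" and p: "u |- app_eq x n p" "u |- Tr (eR p)" "u |- a \<^bold>= eL p"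
        show "frc u (a \<cdot> \<rho>) \<phi>"
        proof (rule frc_LocE[OF *[OF order_trans[OF v u], of n]], elim exE conjE)
          fix t q assume t: "u \<sqsubseteq> t" and q: "t |- app_eq x n q"
            and **: "\<forall>u. t \<sqsubseteq> u --> u |- Tr (eR q) --> u |- Vset (eL q) \<and> frc u (eL q \<cdot> \<rho>) \<phi>"
          have eq: "t |- p \<^bold>= q" by (rule app_fun[OF mono[OF p(1) t] q])
          have "frc t (eL q \<cdot> \<rho>) \<phi>" using ** Tr_subst[OF eR_cong[OF eq] mono[OF p(2) t]] by blast
          moreover have "t |- eL q \<^bold>= a"
            using eq_trans[OF mono[OF p(3) t] eL_cong[OF eq]] by (rule eq_sym)
          ultimately show "frc t (a \<cdot> \<rho>) \<phi>" by (blast intro: eq_subst)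
        qed
      qed
    qed
    ultimately show "frc w' (x \<cdot> \<rho>) (Vset (Var 0) \<^bold>\<and> \<phi>)" by simp
  qed
  then show ?thesis by simp
qed

text \<open>The index exists only locally, but once it is given it serves all larger contexts and
  all arguments there. This is the only source of indices for new functions.\<close>

lemma ECT:
  assumes "almost_negative \<phi>"
    and "\<And>w' n. w \<sqsubseteq> w' ==> frc w' (n \<cdot> \<rho>) \<phi> ==> Loc w' (\<lambda>v. \<exists>m. frc v (m \<cdot> n \<cdot> \<rho>) \<psi>)"
  shows "Loc w (\<lambda>w'. \<exists>e. \<forall>v n. w' \<sqsubseteq> v --> frc v (n \<cdot> \<rho>) \<phi> -->
    Loc v (\<lambda>u. \<exists>m. u |- app_eq e n m \<and> frc u (m \<cdot> n \<cdot> \<rho>) \<psi>))"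
proof -
  have "frc w \<rho> (All (\<phi> \<^bold>\<longrightarrow> Ex \<psi>))"
    unfolding frc_All by (intro allI frc_impI) (simp add: assms(2))
  from frc_mp[OF ax_frc[OF axs.ECT[OF assms(1)]] this] show ?thesis
    unfolding frc_Ex
  proof (rule Loc_map, elim exE, intro exI allI impI)
    fix w' e v n
    assume *: "frc w' (e \<cdot> \<rho>) (All (sub (Var 0 \<cdot> (\<lambda>i. Var (i + 2))) \<phi> \<^bold>\<longrightarrow> dfd (Var 1) (Var 0) \<^bold>\<and>
        at_app (Var 1) (Var 0) (sub (Var 0 \<cdot> Var 1 \<cdot> (\<lambda>i. Var (i + 3))) \<psi>)))"
      and v: "w' \<sqsubseteq> v" and \<phi>: "frc v (n \<cdot> \<rho>) \<phi>"
    have "frc v (n \<cdot> e \<cdot> \<rho>) (dfd (Var 1) (Var 0) \<^bold>\<and>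
        at_app (Var 1) (Var 0) (sub (Var 0 \<cdot> Var 1 \<cdot> (\<lambda>i. Var (i + 3))) \<psi>))"
      by (rule frc_mp[OF frc_mono[OF * v, unfolded frc_All, THEN spec]])
        (simp add: subt_scons \<phi> eval_nat_numeral)
    then show "Loc v (\<lambda>u. \<exists>m. u |- app_eq e n m \<and> frc u (m \<cdot> n \<cdot> \<rho>) \<psi>)"
      by (simp add: subt_scons eval_nat_numeral)
  qed
qed

text \<open>Church's thesis for total relations: the almost negative premise is taken to be a true
  equation.\<close>

lemma CT:
  assumes "\<And>w' n. w \<sqsubseteq> w' ==> Loc w' (\<lambda>v. \<exists>m. frc v (m \<cdot> n \<cdot> \<rho>) \<psi>)"
  shows "Loc w (\<lambda>w'. \<exists>e. \<forall>v n. w' \<sqsubseteq> v -->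
    Loc v (\<lambda>u. \<exists>m. u |- app_eq e n m \<and> frc u (m \<cdot> n \<cdot> \<rho>) \<psi>))"
proof -
  have "almost_negative (Zero \<^bold>= Zero)" by (intro almost_negative.intros sigma1.intros delta0.intros)
  from ECT[OF this assms] show ?thesis by (simp add: prov.EqRefl)
qed

lemma Meaningful_Xi:
  assumes "\<And>w' n m. w \<sqsubseteq> w' ==> w' |- app_eq f n m ==> w' |- Meaningful m"
    and "\<And>w' n m k. w \<sqsubseteq> w' ==> w' |- app_eq f n m ==> w' |- Tr m ==> w' |- app_eq g n k ==>
      w' |- Meaningful k"
  shows "w |- Meaningful (Fn Xi [f, g])"
proof -
  have 1: "frc w (g \<cdot> f \<cdot> Var)
    (All (dfd (Var 2) (Var 0) \<^bold>\<longrightarrow> at_app (Var 2) (Var 0) (Meaningful (Var 0))))"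
    unfolding frc_All
  proof (intro allI frc_impI)
    fix n w' assume w': "w \<sqsubseteq> w'" and "frc w' (n \<cdot> g \<cdot> f \<cdot> Var) (dfd (Var 2) (Var 0))"
    then have "Loc w' (\<lambda>v. \<exists>m. v |- app_eq f n m)" by (simp add: eval_nat_numeral)
    then have "Loc w' (\<lambda>v. \<exists>m. v |- app_eq f n m \<and> v |- Meaningful m)"
      by (rule Loc_map) (use assms(1) w' in blast)
    then show "frc w' (n \<cdot> g \<cdot> f \<cdot> Var) (at_app (Var 2) (Var 0) (Meaningful (Var 0)))"
      by (simp add: eval_nat_numeral)
  qed
  have 2: "frc w (g \<cdot> f \<cdot> Var)
    (All (dfd (Var 2) (Var 0) \<^bold>\<and> dfd (Var 1) (Var 0) \<^bold>\<and> at_app (Var 2) (Var 0) (Tr (Var 0)) \<^bold>\<longrightarrow>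
      at_app (Var 1) (Var 0) (Meaningful (Var 0))))"
    unfolding frc_All
  proof (intro allI frc_impI)
    fix n w' assume w': "w \<sqsubseteq> w'" and "frc w' (n \<cdot> g \<cdot> f \<cdot> Var)
      (dfd (Var 2) (Var 0) \<^bold>\<and> dfd (Var 1) (Var 0) \<^bold>\<and> at_app (Var 2) (Var 0) (Tr (Var 0)))"
    \<comment> \<open>Definedness of \<open>g\<close> at \<open>n\<close> is kept as a formula, so
      that it can be carried to the context in which a value of \<open>f\<close> is
      available.\<close>
    then have g: "w' |- dfd g n" and f: "Loc w' (\<lambda>v. \<exists>m. v |- app_eq f n m \<and> v |- Tr m)"
      unfolding proves_frc[of _ "dfd g n"] by (simp_all add: eval_nat_numeral)
    from f have "Loc w' (\<lambda>v. \<exists>m. v |- app_eq g n m \<and> v |- Meaningful m)"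
    proof (rule Loc_bind, elim exE conjE)
      fix v m assume v: "w' \<sqsubseteq> v" and m: "v |- app_eq f n m" "v |- Tr m"
      have "Loc v (\<lambda>v. \<exists>m. v |- app_eq g n m)"
        using mono[OF g v] unfolding proves_frc[of _ "dfd g n"] by simp
      then show "Loc v (\<lambda>v. \<exists>m. v |- app_eq g n m \<and> v |- Meaningful m)"
        by (rule Loc_map) (use assms(2) w' v mono[OF m(1)] mono[OF m(2)] in blast)
    qed
    then show "frc w' (n \<cdot> g \<cdot> f \<cdot> Var) (at_app (Var 1) (Var 0) (Meaningful (Var 0)))"
      by (simp add: eval_nat_numeral)
  qed
  have "frc w (g \<cdot> f \<cdot> Var)
     (All (dfd (Var 2) (Var 0) \<^bold>\<longrightarrow> at_app (Var 2) (Var 0) (Meaningful (Var 0))) \<^bold>\<and>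
       All (dfd (Var 2) (Var 0) \<^bold>\<and> dfd (Var 1) (Var 0) \<^bold>\<and> at_app (Var 2) (Var 0) (Tr (Var 0)) \<^bold>\<longrightarrow>
            at_app (Var 1) (Var 0) (Meaningful (Var 0))) \<^bold>\<longrightarrow>
       Meaningful (Fn Xi [Var 1, Var 0]))"
    by (rule frc_spec[OF frc_spec[OF ax_frc[OF axs.X2]]])
  from frc_mp[OF this, unfolded frc_And, OF conjI[OF 1 2]] show ?thesis by simp
qed

lemma Tr_Xi:
  assumes "w |- Meaningful (Fn Xi [f, g])"
  shows "w |- Tr (Fn Xi [f, g]) \<longleftrightarrow> (\<forall>w' n m. w \<sqsubseteq> w' --> w' |- app_eq f n m --> w' |- Tr m -->
    Loc w' (\<lambda>v. \<exists>k. v |- app_eq g n k \<and> v |- Tr k))"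
proof -
  let ?\<phi> = "All (dfd (Var 2) (Var 0) \<^bold>\<and> at_app (Var 2) (Var 0) (Tr (Var 0)) \<^bold>\<longrightarrow>
             dfd (Var 1) (Var 0) \<^bold>\<and> at_app (Var 1) (Var 0) (Tr (Var 0)))"
  have *: "frc w (g \<cdot> f \<cdot> Var)
     (Meaningful (Fn Xi [Var 1, Var 0]) \<^bold>\<longrightarrow> (Tr (Fn Xi [Var 1, Var 0]) \<^bold>\<longleftrightarrow> ?\<phi>))"
    by (rule frc_spec[OF frc_spec[OF ax_frc[OF axs.X1]]])
  have "frc w (g \<cdot> f \<cdot> Var) (Tr (Fn Xi [Var 1, Var 0]) \<^bold>\<longleftrightarrow> ?\<phi>)"
    by (rule frc_mp[OF *]) (simp add: assms)
  then have "frc w (g \<cdot> f \<cdot> Var) (Tr (Fn Xi [Var 1, Var 0])) \<longleftrightarrow> frc w (g \<cdot> f \<cdot> Var) ?\<phi>"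
    unfolding frc_Iff by blast
  moreover have "frc w (g \<cdot> f \<cdot> Var) (Tr (Fn Xi [Var 1, Var 0])) \<longleftrightarrow> w |- Tr (Fn Xi [f, g])"
    by simp
  ultimately have "w |- Tr (Fn Xi [f, g]) \<longleftrightarrow> frc w (g \<cdot> f \<cdot> Var) ?\<phi>"
    by (simp only:)
  also have "\<dots> \<longleftrightarrow> (\<forall>n w'. w \<sqsubseteq> w' -->
      Loc w' (\<lambda>v. \<exists>m. v |- app_eq f n m) \<and> Loc w' (\<lambda>v. \<exists>m. v |- app_eq f n m \<and> v |- Tr m) -->
      Loc w' (\<lambda>v. \<exists>m. v |- app_eq g n m) \<and> Loc w' (\<lambda>v. \<exists>m. v |- app_eq g n m \<and> v |- Tr m))"
    by (simp add: frc_Imp eval_nat_numeral cong del: imp_cong)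
  also have "\<dots> \<longleftrightarrow> (\<forall>w' n m. w \<sqsubseteq> w' --> w' |- app_eq f n m --> w' |- Tr m -->
    Loc w' (\<lambda>v. \<exists>k. v |- app_eq g n k \<and> v |- Tr k))" (is "?L \<longleftrightarrow> ?R")
  proof
    assume ?L
    then show ?R by (blast intro: LocI)
  next
    assume R: ?R
    show ?L
    proof (intro allI impI)
      fix n w' assume w': "w \<sqsubseteq> w'" and
        "Loc w' (\<lambda>v. \<exists>m. v |- app_eq f n m) \<and> Loc w' (\<lambda>v. \<exists>m. v |- app_eq f n m \<and> v |- Tr m)"
      then have "Loc w' (\<lambda>v. \<exists>m. v |- app_eq f n m \<and> v |- Tr m)" by blast
      then have "Loc w' (\<lambda>v. \<exists>m. v |- app_eq g n m \<and> v |- Tr m)"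
        by (rule Loc_bind) (use R w' in blast)
      then show "Loc w' (\<lambda>v. \<exists>m. v |- app_eq g n m) \<and> Loc w' (\<lambda>v. \<exists>m. v |- app_eq g n m \<and> v |- Tr m)"
        by (blast intro: Loc_map)
    qed
  qed
  finally show ?thesis .
qed


section \<open>Conditions\<close>

text \<open>The condition \<open>c\<close> expresses \<open>P\<close>. Allowing any predicate of
  contexts covers forcing statements as well as ones like derivability of \<open>Bot\<close>;
  \<open>repr_fm\<close> below is the variant as a formula, to which ECT can be applied.\<close>

definition repr :: "fm list \<Rightarrow> trm \<Rightarrow> (fm list \<Rightarrow> bool) \<Rightarrow> bool" where
  "repr w c P \<longleftrightarrow> w |- Meaningful c \<and> (\<forall>v. w \<sqsubseteq> v --> (v |- Tr c \<longleftrightarrow> P v))"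

definition repr_fm :: "fm \<Rightarrow> fm" where
  "repr_fm \<alpha> = (Meaningful (Var 0) \<^bold>\<and> (Tr (Var 0) \<^bold>\<longleftrightarrow> lift_fm \<alpha>))"

lemma frc_lift_fm [simp]: "frc w (c \<cdot> \<rho>) (lift_fm \<alpha>) \<longleftrightarrow> frc w \<rho> \<alpha>"
  by (simp add: lift_fm_def)

lemma frc_repr_fm: "frc w (c \<cdot> \<rho>) (repr_fm \<alpha>) \<longleftrightarrow> repr w c (\<lambda>v. frc v \<rho> \<alpha>)"
proof -
  have "frc w (c \<cdot> \<rho>) (Tr (Var 0) \<^bold>\<longleftrightarrow> lift_fm \<alpha>) \<longleftrightarrow> (\<forall>v. w \<sqsubseteq> v --> (v |- Tr c \<longleftrightarrow> frc v \<rho> \<alpha>))"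
    unfolding frc_Iff by simp
  then show ?thesis
    unfolding repr_fm_def repr_def by (subst frc_And) simp
qed

lemma repr_mono: "repr w c P ==> w \<sqsubseteq> v ==> repr v c P"
  unfolding repr_def by (meson mono order_trans)

lemma repr_cong: "repr w c P ==> (\<And>v. w \<sqsubseteq> v ==> P v \<longleftrightarrow> Q v) ==> repr w c Q"
  unfolding repr_def by blast

text \<open>A bounded universal over the empty domain: as \<open>und\<close> has no values, the
  premises of (X2) and the universal statement of (X1) hold vacuously.\<close>

lemma repr_True: "repr w (Fn Xi [und, und]) (\<lambda>_. True)"
proof -
  have "w |- Meaningful (Fn Xi [und, und])"
    by (rule Meaningful_Xi) (blast intro: und_undefined prov.BotE)+
  moreover have "v |- Tr (Fn Xi [und, und])" if "w \<sqsubseteq> v" for v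
    unfolding Tr_Xi[OF mono[OF calculation that]] by (blast intro: und_undefined Bot_Loc)
  ultimately show ?thesis unfolding repr_def by blast
qed

text \<open>Here \<open>e\<close> is an index all of whose values are true conditions. Truth of
  \<open>\<Xi>(e, und)\<close> would force \<open>und\<close> to be defined, at \<open>Zero\<close>
  for instance. The index exists only locally, and so does the false condition.\<close>

lemma repr_False: "Loc w (\<lambda>v. \<exists>c. repr v c (\<lambda>u. u |- Bot))"
proof -
  have "Loc w (\<lambda>w'. \<exists>e. \<forall>v n. w' \<sqsubseteq> v -->
      Loc v (\<lambda>u. \<exists>m. u |- app_eq e n m \<and> frc u (m \<cdot> n \<cdot> Var) (repr_fm (Zero \<^bold>= Zero))))"
    by (rule CT) (use repr_True in \<open>auto simp: frc_repr_fm prov.EqRefl intro!: LocI\<close>)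
  then show ?thesis
  proof (rule Loc_map, elim exE)
    fix w' e assume "\<forall>v n. w' \<sqsubseteq> v -->
      Loc v (\<lambda>u. \<exists>m. u |- app_eq e n m \<and> frc u (m \<cdot> n \<cdot> Var) (repr_fm (Zero \<^bold>= Zero)))"
    then have e: "Loc v (\<lambda>u. \<exists>m. u |- app_eq e n m \<and> repr u m (\<lambda>_. True))" if "w' \<sqsubseteq> v" for v n
      using that by (simp add: frc_repr_fm prov.EqRefl)
    have M: "w' |- Meaningful (Fn Xi [e, und])"
    proof (rule Meaningful_Xi)
      fix v n m assume v: "w' \<sqsubseteq> v" and m: "v |- app_eq e n m"
      show "v |- Meaningful m"
      proof (rule LocE[OF e[OF v, of n]], elim exE conjE)
        fix u k assume u: "v \<sqsubseteq> u" and k: "u |- app_eq e n k" "repr u k (\<lambda>_. True)"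
        from app_fun[OF k(1) mono[OF m u]] show "u |- Meaningful m"
          by (rule Meaningful_subst) (use k(2) in \<open>simp add: repr_def\<close>)
      qed
    qed (blast intro: und_undefined prov.BotE)
    have "v |- Bot" if v: "w' \<sqsubseteq> v" and tr: "v |- Tr (Fn Xi [e, und])" for v
    proof (rule LocE[OF e[OF v, of Zero]], elim exE conjE)
      fix u k assume u: "v \<sqsubseteq> u" and k: "u |- app_eq e Zero k" "repr u k (\<lambda>_. True)"
      then have "u |- Tr k" unfolding repr_def by blast
      with tr[unfolded Tr_Xi[OF mono[OF M v]]] u k(1)
      have "Loc u (\<lambda>v. \<exists>k. v |- app_eq und Zero k \<and> v |- Tr k)" by blast
      then show "u |- Bot" by (rule LocE) (blast intro: und_undefined)
    qed
    then have "repr w' (Fn Xi [e, und]) (\<lambda>u. u |- Bot)"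
      unfolding repr_def using M by (blast intro: prov.BotE)
    then show "\<exists>c. repr w' c (\<lambda>u. u |- Bot)" by blast
  qed
qed

text \<open>The representing condition is \<open>cd_x(n)\<close> itself, meaningful because
  \<open>x\<close> is a v-set. The represented statement does not mention the value
  \<open>p\<close>, so that it makes sense before one is chosen.\<close>

lemma repr_cd:
  assumes "w |- Vset x"
  shows "Loc w (\<lambda>v. \<exists>c. repr v c (\<lambda>u. Loc u (\<lambda>t. \<exists>p. t |- app_eq x n p \<and> t |- Tr (eR p))))"
proof (rule Loc_map[OF Vset_elim[OF assms, of n]], elim exE conjE)
  fix v p assume p: "v |- app_eq x n p" "v |- Meaningful (eR p)"
  have "u |- Tr (eR p) \<longleftrightarrow> Loc u (\<lambda>t. \<exists>p. t |- app_eq x n p \<and> t |- Tr (eR p))" if u: "v \<sqsubseteq> u" for u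
  proof
    assume "u |- Tr (eR p)"
    with mono[OF p(1) u] show "Loc u (\<lambda>t. \<exists>p. t |- app_eq x n p \<and> t |- Tr (eR p))"
      by (blast intro: LocI)
  next
    assume "Loc u (\<lambda>t. \<exists>p. t |- app_eq x n p \<and> t |- Tr (eR p))"
    then show "u |- Tr (eR p)"
    proof (rule LocE, elim exE conjE)
      fix s q assume s: "u \<sqsubseteq> s" and q: "s |- app_eq x n q" "s |- Tr (eR q)"
      have "s |- app_eq x n p" by (rule mono[OF p(1)]) (use u s in blast)
      from eR_cong[OF app_fun[OF q(1) this]] q(2) show "s |- Tr (eR p)" by (rule Tr_subst)
    qed
  qed
  then show "\<exists>c. repr v c (\<lambda>u. Loc u (\<lambda>t. \<exists>p. t |- app_eq x n p \<and> t |- Tr (eR p)))"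
    using p(2) unfolding repr_def by blast
qed

lemma almost_negative_app: "almost_negative (app_eq e n m)" "almost_negative (dfd e n)"
  unfolding app_eq_def dfd_def by (intro almost_negative.intros(1) sigma1.intros delta0.intros)+

text \<open>
  The premise of ECT has to be almost negative while \<open>\<alpha>\<close> is arbitrary; it is replaced by the truth
  of the condition that represents it.
\<close>

lemma repr_All:
  assumes \<alpha>: "\<And>w' n. w \<sqsubseteq> w' ==> Loc w' (\<lambda>v. \<exists>c. repr v c (\<lambda>u. frc u (n \<cdot> \<rho>) \<alpha>))"
    and \<beta>: "\<And>w' n. w \<sqsubseteq> w' ==> frc w' (n \<cdot> \<rho>) \<alpha> ==> Loc w' (\<lambda>v. \<exists>c. repr v c (\<lambda>u. frc u (n \<cdot> \<rho>) \<beta>))"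
  shows "Loc w (\<lambda>v. \<exists>c. repr v c (\<lambda>u. frc u \<rho> (All (\<alpha> \<^bold>\<longrightarrow> \<beta>))))"
proof -
  have "Loc w (\<lambda>w'. \<exists>f. \<forall>v n. w' \<sqsubseteq> v -->
      Loc v (\<lambda>u. \<exists>m. u |- app_eq f n m \<and> frc u (m \<cdot> n \<cdot> \<rho>) (repr_fm \<alpha>)))"
    by (rule CT) (unfold frc_repr_fm, rule \<alpha>)
  then show ?thesis
  proof (rule Loc_bind, elim exE)
    fix w1 f assume w1: "w \<sqsubseteq> w1" and "\<forall>v n. w1 \<sqsubseteq> v -->
      Loc v (\<lambda>u. \<exists>m. u |- app_eq f n m \<and> frc u (m \<cdot> n \<cdot> \<rho>) (repr_fm \<alpha>))"
    then have f: "Loc v (\<lambda>u. \<exists>m. u |- app_eq f n m \<and> frc u (m \<cdot> n \<cdot> \<rho>) (repr_fm \<alpha>))"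
      if "w1 \<sqsubseteq> v" for v n using that by blast
    have f_repr: "repr v m (\<lambda>u. frc u (n \<cdot> \<rho>) \<alpha>)" if v: "w1 \<sqsubseteq> v" and m: "v |- app_eq f n m" for v n m
      unfolding frc_repr_fm[symmetric]
    proof (rule frc_LocE[OF f[OF v, of n]], elim exE conjE)
      fix u k assume u: "v \<sqsubseteq> u" and k: "u |- app_eq f n k" "frc u (k \<cdot> n \<cdot> \<rho>) (repr_fm \<alpha>)"
      from app_fun[OF k(1) mono[OF m u]] k(2) show "frc u (m \<cdot> n \<cdot> \<rho>) (repr_fm \<alpha>)" by (rule eq_subst)
    qed
    \<comment> \<open>The value of \<open>f\<close> at \<open>n\<close> is bound universally,
      because an existential quantifier in front of \<open>Tr\<close> would not be almost negative;
      totality of \<open>f\<close> makes the two readings agree.\<close>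
    define \<phi> where "\<phi> = All (app_eq (Var 2) (Var 1) (Var 0) \<^bold>\<longrightarrow> Tr (Var 0))"
    have an: "almost_negative \<phi>"
      unfolding \<phi>_def by (intro almost_negative.intros(4,6,7) almost_negative_app)
    have \<phi>_iff: "frc v (n \<cdot> f \<cdot> \<rho>) \<phi> \<longleftrightarrow> frc v (n \<cdot> \<rho>) \<alpha>" if v: "w1 \<sqsubseteq> v" for v n
    proof
      assume \<phi>: "frc v (n \<cdot> f \<cdot> \<rho>) \<phi>"
      show "frc v (n \<cdot> \<rho>) \<alpha>"
      proof (rule frc_LocE[OF f[OF v, of n]], elim exE conjE)
        fix u m assume u: "v \<sqsubseteq> u" and m: "u |- app_eq f n m" "frc u (m \<cdot> n \<cdot> \<rho>) (repr_fm \<alpha>)"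
        have "frc u (m \<cdot> n \<cdot> f \<cdot> \<rho>) (Tr (Var 0))"
          by (rule frc_mp[OF frc_spec[OF frc_mono[OF \<phi> u, unfolded \<phi>_def]]])
            (simp add: m eval_nat_numeral)
        then show "frc u (n \<cdot> \<rho>) \<alpha>" using m(2) unfolding frc_repr_fm repr_def by simp
      qed
    next
      assume a: "frc v (n \<cdot> \<rho>) \<alpha>"
      show "frc v (n \<cdot> f \<cdot> \<rho>) \<phi>"
        unfolding \<phi>_def frc_All
      proof (intro allI frc_impI)
        fix m u assume u: "v \<sqsubseteq> u" and "frc u (m \<cdot> n \<cdot> f \<cdot> \<rho>) (app_eq (Var 2) (Var 1) (Var 0))"
        then have "u |- app_eq f n m" by (simp add: eval_nat_numeral)
        from f_repr[OF order_trans[OF v u] this] frc_mono[OF a u] have "u |- Tr m"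
          unfolding repr_def by blast
        then show "frc u (m \<cdot> n \<cdot> f \<cdot> \<rho>) (Tr (Var 0))" by simp
      qed
    qed
    define \<psi> where "\<psi> = sub (Var 0 \<cdot> Var 1 \<cdot> (\<lambda>i. Var (i + 3))) (repr_fm \<beta>)"
    have \<psi>_iff: "frc v (m \<cdot> n \<cdot> f \<cdot> \<rho>) \<psi> \<longleftrightarrow> repr v m (\<lambda>u. frc u (n \<cdot> \<rho>) \<beta>)" for v m n
      unfolding \<psi>_def frc_repr_fm[symmetric] by (simp add: subt_scons eval_nat_numeral)
    \<comment> \<open>A representation of \<open>\<beta>\<close> is available only where
      \<open>\<alpha>\<close> holds, so \<open>g\<close> is controlled only there. (X2) asks for no
      more: \<open>gn\<close> has to be meaningful only when \<open>fn\<close> is true.\<close>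
    have "Loc w1 (\<lambda>w'. \<exists>g. \<forall>v n. w' \<sqsubseteq> v --> frc v (n \<cdot> f \<cdot> \<rho>) \<phi> -->
      Loc v (\<lambda>u. \<exists>m. u |- app_eq g n m \<and> frc u (m \<cdot> n \<cdot> f \<cdot> \<rho>) \<psi>))"
    proof (rule ECT[OF an])
      fix w' n assume w': "w1 \<sqsubseteq> w'" "frc w' (n \<cdot> f \<cdot> \<rho>) \<phi>"
      then show "Loc w' (\<lambda>v. \<exists>m. frc v (m \<cdot> n \<cdot> f \<cdot> \<rho>) \<psi>)"
        unfolding \<psi>_iff \<phi>_iff[OF w'(1)] using \<beta> w1 by blast
    qed
    then show "Loc w1 (\<lambda>v. \<exists>c. repr v c (\<lambda>u. frc u \<rho> (All (\<alpha> \<^bold>\<longrightarrow> \<beta>))))"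
    proof (rule Loc_map, elim exE)
      fix w2 g assume w2: "w1 \<sqsubseteq> w2" and *: "\<forall>v n. w2 \<sqsubseteq> v --> frc v (n \<cdot> f \<cdot> \<rho>) \<phi> -->
        Loc v (\<lambda>u. \<exists>m. u |- app_eq g n m \<and> frc u (m \<cdot> n \<cdot> f \<cdot> \<rho>) \<psi>)"
      have g: "Loc v (\<lambda>u. \<exists>m. u |- app_eq g n m \<and> repr u m (\<lambda>u. frc u (n \<cdot> \<rho>) \<beta>))"
        if v: "w2 \<sqsubseteq> v" and a: "frc v (n \<cdot> \<rho>) \<alpha>" for v n
      proof -
        from a have "frc v (n \<cdot> f \<cdot> \<rho>) \<phi>" unfolding \<phi>_iff[OF order_trans[OF w2 v]] .
        with * v have "Loc v (\<lambda>u. \<exists>m. u |- app_eq g n m \<and> frc u (m \<cdot> n \<cdot> f \<cdot> \<rho>) \<psi>)" by blast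
        then show ?thesis unfolding \<psi>_iff .
      qed
      have Tr_f: "v |- Tr m \<longleftrightarrow> frc v (n \<cdot> \<rho>) \<alpha>" if "w2 \<sqsubseteq> v" "v |- app_eq f n m" for v n m
        using f_repr[OF order_trans[OF w2 that(1)] that(2)] unfolding repr_def by blast
      have M: "w2 |- Meaningful (Fn Xi [f, g])"
      proof (rule Meaningful_Xi)
        fix v n m assume "w2 \<sqsubseteq> v" "v |- app_eq f n m"
        then show "v |- Meaningful m"
          using f_repr[OF order_trans[OF w2]] unfolding repr_def by blast
      next
        fix v n m k assume v: "w2 \<sqsubseteq> v" and m: "v |- app_eq f n m" "v |- Tr m" and k: "v |- app_eq g n k"
        from m Tr_f[OF v] have "frc v (n \<cdot> \<rho>) \<alpha>" by blast
        from g[OF v this] show "v |- Meaningful k"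
        proof (rule LocE, elim exE conjE)
          fix u l assume u: "v \<sqsubseteq> u" and l: "u |- app_eq g n l" "repr u l (\<lambda>u. frc u (n \<cdot> \<rho>) \<beta>)"
          from app_fun[OF l(1) mono[OF k u]] show "u |- Meaningful k"
            by (rule Meaningful_subst) (use l(2) in \<open>simp add: repr_def\<close>)
        qed
      qed
      have "v |- Tr (Fn Xi [f, g]) \<longleftrightarrow> frc v \<rho> (All (\<alpha> \<^bold>\<longrightarrow> \<beta>))" if v: "w2 \<sqsubseteq> v" for v
        unfolding Tr_Xi[OF mono[OF M v]]
      proof
        assume T: "\<forall>w' n m. v \<sqsubseteq> w' --> w' |- app_eq f n m --> w' |- Tr m -->
          Loc w' (\<lambda>v. \<exists>k. v |- app_eq g n k \<and> v |- Tr k)"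
        show "frc v \<rho> (All (\<alpha> \<^bold>\<longrightarrow> \<beta>))"
          unfolding frc_All
        proof (intro allI frc_impI)
          fix n u assume u: "v \<sqsubseteq> u" and a: "frc u (n \<cdot> \<rho>) \<alpha>"
          have vu: "w2 \<sqsubseteq> u" using v u by blast
          show "frc u (n \<cdot> \<rho>) \<beta>"
          proof (rule frc_LocE[OF f[OF order_trans[OF w2 vu], of n]], elim exE conjE)
            fix t m assume t: "u \<sqsubseteq> t" and m: "t |- app_eq f n m"
            have vt: "w2 \<sqsubseteq> t" using vu t by blast
            have a: "frc t (n \<cdot> \<rho>) \<alpha>" by (rule frc_mono[OF a t])
            with Tr_f[OF vt m] have "t |- Tr m" by blast
            with T m u t have "Loc t (\<lambda>v. \<exists>k. v |- app_eq g n k \<and> v |- Tr k)" by blast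
            then show "frc t (n \<cdot> \<rho>) \<beta>"
            proof (rule frc_LocE, elim exE conjE)
              fix s k assume s: "t \<sqsubseteq> s" and k: "s |- app_eq g n k" "s |- Tr k"
              have vs: "w2 \<sqsubseteq> s" using vt s by blast
              show "frc s (n \<cdot> \<rho>) \<beta>"
              proof (rule frc_LocE[OF g[OF vs frc_mono[OF a s]]], elim exE conjE)
                fix r l assume r: "s \<sqsubseteq> r" and l: "r |- app_eq g n l" "repr r l (\<lambda>u. frc u (n \<cdot> \<rho>) \<beta>)"
                have "r |- Tr l"
                  using app_fun[OF mono[OF k(1) r] l(1)] mono[OF k(2) r] by (rule Tr_subst)
                with l(2) show "frc r (n \<cdot> \<rho>) \<beta>" unfolding repr_def by blast
              qed
            qed
          qed
        qed
      next
        assume all: "frc v \<rho> (All (\<alpha> \<^bold>\<longrightarrow> \<beta>))"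
        show "\<forall>w' n m. v \<sqsubseteq> w' --> w' |- app_eq f n m --> w' |- Tr m -->
          Loc w' (\<lambda>v. \<exists>k. v |- app_eq g n k \<and> v |- Tr k)"
        proof (intro allI impI)
          fix u n m assume u: "v \<sqsubseteq> u" and m: "u |- app_eq f n m" "u |- Tr m"
          have vu: "w2 \<sqsubseteq> u" using v u by blast
          have a: "frc u (n \<cdot> \<rho>) \<alpha>" using Tr_f[OF vu m(1)] m(2) by blast
          have b: "frc u (n \<cdot> \<rho>) \<beta>" by (rule frc_mp[OF frc_spec[OF frc_mono[OF all u]] a])
          show "Loc u (\<lambda>v. \<exists>k. v |- app_eq g n k \<and> v |- Tr k)"
            by (rule Loc_map[OF g[OF vu a]]) (use b in \<open>auto simp: repr_def dest: frc_mono\<close>)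
        qed
      qed
      with M have "repr w2 (Fn Xi [f, g]) (\<lambda>u. frc u \<rho> (All (\<alpha> \<^bold>\<longrightarrow> \<beta>)))"
        unfolding repr_def by blast
      then show "\<exists>c. repr w2 c (\<lambda>u. frc u \<rho> (All (\<alpha> \<^bold>\<longrightarrow> \<beta>)))" by blast
    qed
  qed
qed

section \<open>Existence of v-sets and the recursion theorem\<close>

text \<open>Substitution of equals acts on variable \<open>0\<close>; exchanging the first two
  variables brings position \<open>1\<close> there.\<close>

lemma eq_subst2: "w |- s \<^bold>= t ==> frc w (a \<cdot> s \<cdot> \<rho>) \<phi> ==> frc w (a \<cdot> t \<cdot> \<rho>) \<phi>"
  using eq_subst[of w s t "a \<cdot> \<rho>" "sub (Var 1 \<cdot> Var 0 \<cdot> (\<lambda>i. Var (i + 2))) \<phi>"]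
  by (simp add: subt_scons)

text \<open>The general construction of v-sets: if for each \<open>n\<close> an element and a
  condition satisfying \<open>\<theta>\<close> exist, CT turns the choice into an index
  \<open>y\<close> of pairs, and (V1) makes \<open>y\<close> a v-set. The pairs chosen are known
  only through \<open>\<theta>\<close>, so each application puts into \<open>\<theta>\<close> all
  that it will need.\<close>

lemma Vset_exists:
  assumes "\<And>w' n. w \<sqsubseteq> w' ==> Loc w' (\<lambda>v. \<exists>a c. v |- Meaningful c \<and>
    (\<forall>u. v \<sqsubseteq> u --> u |- Tr c --> u |- Vset a) \<and> frc v (a \<cdot> c \<cdot> n \<cdot> \<rho>) \<theta>)"
  shows "Loc w (\<lambda>v. \<exists>y. v |- Vset y \<and> (\<forall>u n p. v \<sqsubseteq> u --> u |- app_eq y n p -->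
    frc u (eL p \<cdot> eR p \<cdot> n \<cdot> \<rho>) \<theta>))"
proof -
  define \<psi> where "\<psi> = (Meaningful (eR (Var 0)) \<^bold>\<and> (Tr (eR (Var 0)) \<^bold>\<longrightarrow> Vset (eL (Var 0))) \<^bold>\<and>
    sub (eL (Var 0) \<cdot> eR (Var 0) \<cdot> Var 1 \<cdot> (\<lambda>i. Var (i + 2))) \<theta>)"
  have \<psi>_iff: "frc v (p \<cdot> n \<cdot> \<rho>) \<psi> \<longleftrightarrow> v |- Meaningful (eR p) \<and>
    (\<forall>u. v \<sqsubseteq> u --> u |- Tr (eR p) --> u |- Vset (eL p)) \<and> frc v (eL p \<cdot> eR p \<cdot> n \<cdot> \<rho>) \<theta>" for v p n
    unfolding \<psi>_def by (simp add: frc_Imp subt_scons cong del: imp_cong)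
  have "Loc w (\<lambda>w'. \<exists>y. \<forall>v n. w' \<sqsubseteq> v -->
    Loc v (\<lambda>u. \<exists>p. u |- app_eq y n p \<and> frc u (p \<cdot> n \<cdot> \<rho>) \<psi>))"
  proof (rule CT)
    fix w' n assume w': "w \<sqsubseteq> w'"
    show "Loc w' (\<lambda>v. \<exists>p. frc v (p \<cdot> n \<cdot> \<rho>) \<psi>)"
    proof (rule Loc_map[OF assms[OF w', of n]], elim exE conjE)
      fix v a c assume c: "v |- Meaningful c" "\<forall>u. v \<sqsubseteq> u --> u |- Tr c --> u |- Vset a"
        and \<theta>: "frc v (a \<cdot> c \<cdot> n \<cdot> \<rho>) \<theta>"
      have "frc v (Fn ppair [a, c] \<cdot> n \<cdot> \<rho>) \<psi>"
        unfolding \<psi>_iff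
      proof (intro conjI allI impI)
        show "v |- Meaningful (eR (Fn ppair [a, c]))"
          using eq_sym[OF eR_pair] c(1) by (rule Meaningful_subst)
        show "frc v (eL (Fn ppair [a, c]) \<cdot> eR (Fn ppair [a, c]) \<cdot> n \<cdot> \<rho>) \<theta>"
          using eq_subst[OF eq_sym[OF eL_pair] eq_subst2[OF eq_sym[OF eR_pair] \<theta>]] .
        fix u assume u: "v \<sqsubseteq> u" and "u |- Tr (eR (Fn ppair [a, c]))"
        with Tr_subst[OF eR_pair] c(2) have "u |- Vset a" by blast
        with eq_sym[OF eL_pair] show "u |- Vset (eL (Fn ppair [a, c]))" by (rule Vset_subst)
      qed
      then show "\<exists>p. frc v (p \<cdot> n \<cdot> \<rho>) \<psi>" by blast
    qed
  qed
  then show ?thesis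
  proof (rule Loc_map, elim exE)
    fix w' y assume y: "\<forall>v n. w' \<sqsubseteq> v --> Loc v (\<lambda>u. \<exists>p. u |- app_eq y n p \<and> frc u (p \<cdot> n \<cdot> \<rho>) \<psi>)"
    have "w' |- Vset y"
    proof (rule Vset_intro)
      fix n v assume "w' \<sqsubseteq> v"
      with y have "Loc v (\<lambda>u. \<exists>p. u |- app_eq y n p \<and> frc u (p \<cdot> n \<cdot> \<rho>) \<psi>)" by blast
      then show "Loc v (\<lambda>v. \<exists>p. v |- app_eq y n p \<and> v |- Meaningful (eR p) \<and>
        (\<forall>u. v \<sqsubseteq> u --> u |- Tr (eR p) --> u |- Vset (eL p)))"
        by (rule Loc_map) (unfold \<psi>_iff, blast)
    qed
    moreover have "frc u (eL p \<cdot> eR p \<cdot> n \<cdot> \<rho>) \<theta>" if u: "w' \<sqsubseteq> u" and p: "u |- app_eq y n p" for u n p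
    proof -
      have "frc u (p \<cdot> n \<cdot> \<rho>) \<psi>"
      proof (rule frc_LocE[OF y[rule_format, OF u, of n]], elim exE conjE)
        fix t q assume t: "u \<sqsubseteq> t" and q: "t |- app_eq y n q" "frc t (q \<cdot> n \<cdot> \<rho>) \<psi>"
        from app_fun[OF q(1) mono[OF p t]] q(2) show "frc t (p \<cdot> n \<cdot> \<rho>) \<psi>" by (rule eq_subst)
      qed
      then show ?thesis unfolding \<psi>_iff by blast
    qed
    ultimately show "\<exists>y. w' |- Vset y \<and> (\<forall>u n p. w' \<sqsubseteq> u --> u |- app_eq y n p -->
        frc u (eL p \<cdot> eR p \<cdot> n \<cdot> \<rho>) \<theta>)" by blast
  qed
qed

text \<open>
  Kleene's argument, with ECT in place of the s-m-n theorem: \<open>\<delta>\<close> maps \<open>u\<close> to an index for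
  \<open>k \<mapsto> \<psi>(uu, k)\<close>, and the fixed point is \<open>\<delta>\<delta>\<close>.
\<close>

lemma recursion_theorem:
  assumes an: "almost_negative A"
    and ex: "\<And>w' k e. w \<sqsubseteq> w' ==> frc w' (k \<cdot> e \<cdot> \<rho>) A ==> Loc w' (\<lambda>v. \<exists>m. frc v (m \<cdot> k \<cdot> e \<cdot> \<rho>) \<psi>)"
  shows "Loc w (\<lambda>v. \<exists>e. \<forall>u k. v \<sqsubseteq> u --> frc u (k \<cdot> e \<cdot> \<rho>) A -->
    Loc u (\<lambda>t. \<exists>m. t |- app_eq e k m \<and> frc t (m \<cdot> k \<cdot> e \<cdot> \<rho>) \<psi>))"
proof -
  \<comment> \<open>\<open>\<phi>1(k, u)\<close> is the domain \<open>A(k, uu)\<close> together with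
    definedness of \<open>uu\<close>. Binding the value of \<open>uu\<close> universally keeps the
    formula almost negative.\<close>
  define \<phi>1 where "\<phi>1 = (All (app_eq (Var 2) (Var 2) (Var 0) \<^bold>\<longrightarrow> sub (Var 1 \<cdot> Var 0 \<cdot> (\<lambda>i. Var (i + 3))) A) \<^bold>\<and>
    dfd (Var 1) (Var 1))"
  define \<psi>1 where "\<psi>1 = All (app_eq (Var 3) (Var 3) (Var 0) \<^bold>\<longrightarrow> sub (Var 1 \<cdot> Var 2 \<cdot> Var 0 \<cdot> (\<lambda>i. Var (i + 4))) \<psi>)"
  define \<psi>2 where "\<psi>2 = All (sub (Var 0 \<cdot> Var 2 \<cdot> (\<lambda>i. Var (i + 3))) \<phi>1 \<^bold>\<longrightarrow>
    Ex (app_eq (Var 2) (Var 1) (Var 0) \<^bold>\<and> sub (Var 0 \<cdot> Var 1 \<cdot> Var 3 \<cdot> (\<lambda>i. Var (i + 4))) \<psi>1))"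
  have an1: "almost_negative \<phi>1"
    unfolding \<phi>1_def by (intro almost_negative.intros(5,6,7) almost_negative_app almost_negative_sub an)
  have \<phi>1_iff: "frc v (k \<cdot> u \<cdot> \<rho>) \<phi>1 \<longleftrightarrow>
    (\<forall>e v'. v \<sqsubseteq> v' --> v' |- app_eq u u e --> frc v' (k \<cdot> e \<cdot> \<rho>) A) \<and> Loc v (\<lambda>v'. \<exists>e. v' |- app_eq u u e)" for v k u
    unfolding \<phi>1_def by (simp add: frc_Imp subt_scons eval_nat_numeral cong del: imp_cong)
  have \<psi>1_iff: "frc v (m \<cdot> k \<cdot> u \<cdot> \<rho>) \<psi>1 \<longleftrightarrow>
    (\<forall>e v'. v \<sqsubseteq> v' --> v' |- app_eq u u e --> frc v' (m \<cdot> k \<cdot> e \<cdot> \<rho>) \<psi>)" for v m k u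
    unfolding \<psi>1_def by (simp add: frc_Imp subt_scons eval_nat_numeral cong del: imp_cong)
  have \<psi>2_iff: "frc v (d \<cdot> u \<cdot> \<rho>) \<psi>2 \<longleftrightarrow> (\<forall>k v'. v \<sqsubseteq> v' --> frc v' (k \<cdot> u \<cdot> \<rho>) \<phi>1 -->
    Loc v' (\<lambda>t. \<exists>m. t |- app_eq d k m \<and> frc t (m \<cdot> k \<cdot> u \<cdot> \<rho>) \<psi>1))" for v d u
    unfolding \<psi>2_def by (simp add: frc_Imp subt_scons eval_nat_numeral cong del: imp_cong)
  have "Loc w (\<lambda>w'. \<exists>\<delta>. \<forall>v u. w' \<sqsubseteq> v --> Loc v (\<lambda>t. \<exists>d. t |- app_eq \<delta> u d \<and> frc t (d \<cdot> u \<cdot> \<rho>) \<psi>2))"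
  proof (rule CT)
    fix w' u assume w': "w \<sqsubseteq> w'"
    \<comment> \<open>For fixed \<open>u\<close>, ECT on the domain \<open>\<phi>1\<close> gives an
      index \<open>d\<close>; the enclosing application of CT then makes \<open>d\<close> a
      recursive function of \<open>u\<close>.\<close>
    have "Loc w' (\<lambda>v. \<exists>d. \<forall>v' k. v \<sqsubseteq> v' --> frc v' (k \<cdot> u \<cdot> \<rho>) \<phi>1 -->
      Loc v' (\<lambda>t. \<exists>m. t |- app_eq d k m \<and> frc t (m \<cdot> k \<cdot> u \<cdot> \<rho>) \<psi>1))"
    proof (rule ECT[OF an1])
      fix v k assume v: "w' \<sqsubseteq> v" and \<phi>: "frc v (k \<cdot> u \<cdot> \<rho>) \<phi>1"
      then have "Loc v (\<lambda>v'. \<exists>e. v' |- app_eq u u e)" unfolding \<phi>1_iff by blast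
      then show "Loc v (\<lambda>t. \<exists>m. frc t (m \<cdot> k \<cdot> u \<cdot> \<rho>) \<psi>1)"
      proof (rule Loc_bind, elim exE)
        fix v1 e assume v1: "v \<sqsubseteq> v1" and e: "v1 |- app_eq u u e"
        with \<phi> have A: "frc v1 (k \<cdot> e \<cdot> \<rho>) A" unfolding \<phi>1_iff by blast
        have "w \<sqsubseteq> v1" using w' v v1 by blast
        from ex[OF this A] show "Loc v1 (\<lambda>t. \<exists>m. frc t (m \<cdot> k \<cdot> u \<cdot> \<rho>) \<psi>1)"
        proof (rule Loc_map, elim exE)
          fix v2 m assume v2: "v1 \<sqsubseteq> v2" and m: "frc v2 (m \<cdot> k \<cdot> e \<cdot> \<rho>) \<psi>"
          have "frc v2 (m \<cdot> k \<cdot> u \<cdot> \<rho>) \<psi>1"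
            unfolding \<psi>1_iff
          proof (intro allI impI)
            fix e' v3 assume v3: "v2 \<sqsubseteq> v3" and e': "v3 |- app_eq u u e'"
            have "v3 |- e \<^bold>= e'" by (rule app_fun[OF mono[OF e] e']) (use v2 v3 in blast)
            then have "frc v3 (e' \<cdot> m \<cdot> k \<cdot> \<rho>) (sub (Var 1 \<cdot> Var 2 \<cdot> Var 0 \<cdot> (\<lambda>i. Var (i + 3))) \<psi>)"
              by (rule eq_subst) (simp add: subt_scons eval_nat_numeral frc_mono[OF m v3])
            then show "frc v3 (m \<cdot> k \<cdot> e' \<cdot> \<rho>) \<psi>" by (simp add: subt_scons eval_nat_numeral)
          qed
          then show "\<exists>m. frc v2 (m \<cdot> k \<cdot> u \<cdot> \<rho>) \<psi>1" by blast
        qed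
      qed
    qed
    then show "Loc w' (\<lambda>v. \<exists>d. frc v (d \<cdot> u \<cdot> \<rho>) \<psi>2)"
      by (rule Loc_map) (unfold \<psi>2_iff, blast)
  qed
  then show ?thesis
  proof (rule Loc_bind, elim exE)
    fix w' \<delta> assume "\<forall>v u. w' \<sqsubseteq> v --> Loc v (\<lambda>t. \<exists>d. t |- app_eq \<delta> u d \<and> frc t (d \<cdot> u \<cdot> \<rho>) \<psi>2)"
    then have "Loc w' (\<lambda>t. \<exists>d. t |- app_eq \<delta> \<delta> d \<and> frc t (d \<cdot> \<delta> \<cdot> \<rho>) \<psi>2)" by blast
    then show "Loc w' (\<lambda>v. \<exists>e. \<forall>u k. v \<sqsubseteq> u --> frc u (k \<cdot> e \<cdot> \<rho>) A -->
      Loc u (\<lambda>t. \<exists>m. t |- app_eq e k m \<and> frc t (m \<cdot> k \<cdot> e \<cdot> \<rho>) \<psi>))"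
    proof (rule Loc_map, elim exE conjE, intro exI allI impI)
      fix v d u k assume d: "v |- app_eq \<delta> \<delta> d" and \<psi>2: "frc v (d \<cdot> \<delta> \<cdot> \<rho>) \<psi>2"
        and u: "v \<sqsubseteq> u" and A: "frc u (k \<cdot> d \<cdot> \<rho>) A"
      \<comment> \<open>Since \<open>d\<close> is the only value of \<open>\<delta>\<delta>\<close>,
        the domain at \<open>u = \<delta>\<close> is exactly \<open>A\<close> at the fixed point
        \<open>d\<close>.\<close>
      have "frc u (k \<cdot> \<delta> \<cdot> \<rho>) \<phi>1"
        unfolding \<phi>1_iff
      proof (intro conjI allI impI)
        fix e v' assume v': "u \<sqsubseteq> v'" and e: "v' |- app_eq \<delta> \<delta> e"
        have "v' |- d \<^bold>= e" by (rule app_fun[OF mono[OF d] e]) (use u v' in blast)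
        then show "frc v' (k \<cdot> e \<cdot> \<rho>) A" using frc_mono[OF A v'] by (rule eq_subst2)
      next
        show "Loc u (\<lambda>v'. \<exists>e. v' |- app_eq \<delta> \<delta> e)" using mono[OF d u] by (blast intro: LocI)
      qed
      with \<psi>2 u have "Loc u (\<lambda>t. \<exists>m. t |- app_eq d k m \<and> frc t (m \<cdot> k \<cdot> \<delta> \<cdot> \<rho>) \<psi>1)"
        unfolding \<psi>2_iff by blast
      then show "Loc u (\<lambda>t. \<exists>m. t |- app_eq d k m \<and> frc t (m \<cdot> k \<cdot> d \<cdot> \<rho>) \<psi>)"
      proof (rule Loc_map, elim exE conjE)
        fix t m assume t: "u \<sqsubseteq> t" and m: "t |- app_eq d k m" and \<psi>1: "frc t (m \<cdot> k \<cdot> \<delta> \<cdot> \<rho>) \<psi>1"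
        have "t |- app_eq \<delta> \<delta> d" by (rule mono[OF d]) (use u t in blast)
        with \<psi>1 have "frc t (m \<cdot> k \<cdot> d \<cdot> \<rho>) \<psi>" unfolding \<psi>1_iff by blast
        with m show "\<exists>m. t |- app_eq d k m \<and> frc t (m \<cdot> k \<cdot> d \<cdot> \<rho>) \<psi>" by blast
      qed
    qed
  qed
qed

end

section \<open>Extensional equality\<close>

locale vset_extensional = vset_theory +
  fixes E :: fm
  assumes ext: "extensional_equality Xi E"
begin

abbreviation ext_eq :: "trm \<Rightarrow> trm \<Rightarrow> fm"  (infix \<open>\<simeq>\<close> 50) where
  "x \<simeq> y \<equiv> rel E x y"

definition mem :: "trm \<Rightarrow> trm \<Rightarrow> fm" where
  "mem a y = Ex (in_EL (Var 0) (lift y) \<^bold>\<and> lift a \<simeq> Var 0)"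

lemma sub_mem [simp]: "sub \<sigma> (mem a y) = mem (subt \<sigma> a) (subt \<sigma> y)"
  by (simp add: mem_def lift_subt)

lemma frc_mem [simp]: "frc w \<rho> (mem a y) \<longleftrightarrow> w |- mem (subt \<rho> a) (subt \<rho> y)"
  by (simp add: frc_def)

lemma mem_iff: "w |- mem a y \<longleftrightarrow> Loc w (\<lambda>v. \<exists>b. v |- in_EL b y \<and> v |- a \<simeq> b)"
proof -
  have "frc w Var (mem a y) \<longleftrightarrow> Loc w (\<lambda>v. \<exists>b. v |- in_EL b y \<and> v |- a \<simeq> b)"
    unfolding mem_def by (simp del: frc_mem)
  then show ?thesis by simp
qed

lemma memI: "w |- in_EL b y ==> w |- a \<simeq> b ==> w |- mem a y"
  unfolding mem_iff by (blast intro: LocI)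

lemma mem_subst:
  assumes "w |- s \<^bold>= t"
  shows "w |- mem s a ==> w |- mem t a" "w |- mem a s ==> w |- mem a t"
  using eq_subst[OF assms, of Var "mem (Var 0) (lift a)"] eq_subst[OF assms, of Var "mem (lift a) (Var 0)"]
  by simp_all

definition sub_at :: "fm list \<Rightarrow> trm \<Rightarrow> trm \<Rightarrow> bool" where
  "sub_at w x y \<longleftrightarrow> (\<forall>a v. w \<sqsubseteq> v --> v |- in_EL a x --> v |- mem a y)"

lemma sub_at_mono: "sub_at w x y ==> w \<sqsubseteq> v ==> sub_at v x y"
  unfolding sub_at_def by (meson order_trans)

text \<open>The assumption on \<open>E\<close> in its working form, mutual inclusion. That
  \<open>E\<close> is an equivalence on v-sets is derived from this by set induction.\<close>

lemma ext_eq_iff: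
  assumes "w |- Vset x" "w |- Vset y"
  shows "w |- x \<simeq> y \<longleftrightarrow> sub_at w x y \<and> sub_at w y x"
proof -
  let ?\<phi> = "All (in_EL (Var 0) (Var 2) \<^bold>\<longrightarrow> Ex (in_EL (Var 0) (Var 2) \<^bold>\<and> Var 1 \<simeq> Var 0)) \<^bold>\<and>
    All (in_EL (Var 0) (Var 1) \<^bold>\<longrightarrow> Ex (in_EL (Var 0) (Var 3) \<^bold>\<and> Var 1 \<simeq> Var 0))"
  have "[] |- All (Vset (Var 0) \<^bold>\<longrightarrow> All (Vset (Var 0) \<^bold>\<longrightarrow> (Var 1 \<simeq> Var 0 \<^bold>\<longleftrightarrow> ?\<phi>)))"
    using ext unfolding extensional_equality_def holds_def by (simp add: eval_nat_numeral)
  then have "w |- All (Vset (Var 0) \<^bold>\<longrightarrow> All (Vset (Var 0) \<^bold>\<longrightarrow> (Var 1 \<simeq> Var 0 \<^bold>\<longleftrightarrow> ?\<phi>)))"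
    by (rule mono) simp
  then have *: "frc w Var (All (Vset (Var 0) \<^bold>\<longrightarrow> All (Vset (Var 0) \<^bold>\<longrightarrow> (Var 1 \<simeq> Var 0 \<^bold>\<longleftrightarrow> ?\<phi>))))"
    unfolding proves_frc .
  have "frc w (x \<cdot> Var) (All (Vset (Var 0) \<^bold>\<longrightarrow> (Var 1 \<simeq> Var 0 \<^bold>\<longleftrightarrow> ?\<phi>)))"
    by (rule frc_mp[OF frc_spec[OF *]]) (simp add: assms)
  from frc_mp[OF frc_spec[OF this, of y]] have "frc w (y \<cdot> x \<cdot> Var) (Var 1 \<simeq> Var 0 \<^bold>\<longleftrightarrow> ?\<phi>)"
    by (simp only: frc_atom subt.simps nat.case assms)
  then have "frc w (y \<cdot> x \<cdot> Var) (Var 1 \<simeq> Var 0) \<longleftrightarrow> frc w (y \<cdot> x \<cdot> Var) ?\<phi>"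
    unfolding frc_Iff by blast
  moreover have "frc w (y \<cdot> x \<cdot> Var) (Var 1 \<simeq> Var 0) \<longleftrightarrow> w |- x \<simeq> y" by simp
  moreover have "frc w (y \<cdot> x \<cdot> Var) ?\<phi> \<longleftrightarrow> sub_at w x y \<and> sub_at w y x"
    unfolding sub_at_def mem_iff by (simp add: frc_Imp eval_nat_numeral cong del: imp_cong)
  ultimately show ?thesis by (simp only:)
qed

lemma ext_refl: "w |- Vset x ==> w |- x \<simeq> x"
proof -
  assume "w |- Vset x"
  then have "frc w (x \<cdot> Var) (Var 0 \<simeq> Var 0)"
  proof (rule Vset_induct)
    fix w' x assume V: "w' |- Vset x" and IH: "\<And>v a. w' \<sqsubseteq> v ==> v |- in_EL a x ==> frc v (a \<cdot> Var) (Var 0 \<simeq> Var 0)"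
    have "sub_at w' x x" unfolding sub_at_def using IH by (auto intro: memI)
    then show "frc w' (x \<cdot> Var) (Var 0 \<simeq> Var 0)" using ext_eq_iff[OF V V] by simp
  qed
  then show ?thesis by simp
qed

lemma ext_sym: "w |- Vset x ==> w |- Vset y ==> w |- x \<simeq> y ==> w |- y \<simeq> x"
  using ext_eq_iff by blast

lemma ext_trans:
  assumes "w |- Vset x" "w |- Vset y" "w |- Vset z" "w |- x \<simeq> y" "w |- y \<simeq> z"
  shows "w |- x \<simeq> z"
proof -
  \<comment> \<open>The formula is a property of \<open>x\<close> with \<open>y\<close> and
    \<open>z\<close> quantified, relativized to v-sets because only there is \<open>E\<close>
    characterized.\<close>
  define \<phi> where "\<phi> = All (All (Vset (Var 1) \<^bold>\<longrightarrow> Vset (Var 0) \<^bold>\<longrightarrow> Var 2 \<simeq> Var 1 \<^bold>\<longrightarrow> Var 1 \<simeq> Var 0 \<^bold>\<longrightarrow> Var 2 \<simeq> Var 0))"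
  have \<phi>D: "v |- x \<simeq> z" if "frc v (x \<cdot> Var) \<phi>" "v |- Vset y" "v |- Vset z" "v |- x \<simeq> y" "v |- y \<simeq> z" for v x y z
  proof -
    have "frc v (z \<cdot> y \<cdot> x \<cdot> Var) (Vset (Var 1) \<^bold>\<longrightarrow> Vset (Var 0) \<^bold>\<longrightarrow> Var 2 \<simeq> Var 1 \<^bold>\<longrightarrow> Var 1 \<simeq> Var 0 \<^bold>\<longrightarrow> Var 2 \<simeq> Var 0)"
      using that(1) unfolding \<phi>_def by (blast intro: frc_spec)
    from frc_mp[OF frc_mp[OF frc_mp[OF frc_mp[OF this]]]] show ?thesis
      using that(2-) by (simp add: eval_nat_numeral)
  qed
  have "frc w (x \<cdot> Var) \<phi>"
  proof (rule Vset_induct[OF assms(1)])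
    fix w' x assume V: "w' |- Vset x" and IH: "\<And>v a. w' \<sqsubseteq> v ==> v |- in_EL a x ==> frc v (a \<cdot> Var) \<phi>"
    show "frc w' (x \<cdot> Var) \<phi>"
      unfolding \<phi>_def frc_All
    proof (intro allI frc_impI)
      fix y z w1 w2 w3 w4
      assume w: "w' \<sqsubseteq> w1" "w1 \<sqsubseteq> w2" "w2 \<sqsubseteq> w3" "w3 \<sqsubseteq> w4"
        and "frc w1 (z \<cdot> y \<cdot> x \<cdot> Var) (Vset (Var 1))" "frc w2 (z \<cdot> y \<cdot> x \<cdot> Var) (Vset (Var 0))"
          "frc w3 (z \<cdot> y \<cdot> x \<cdot> Var) (Var 2 \<simeq> Var 1)" "frc w4 (z \<cdot> y \<cdot> x \<cdot> Var) (Var 1 \<simeq> Var 0)"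
      then have "w1 |- Vset y" "w2 |- Vset z" "w3 |- x \<simeq> y" "w4 |- y \<simeq> z"
        by (simp_all add: eval_nat_numeral)
      with w V have V: "w4 |- Vset x" "w4 |- Vset y" "w4 |- Vset z" and eq: "w4 |- x \<simeq> y" "w4 |- y \<simeq> z"
        by (meson mono)+
      have w4: "w' \<sqsubseteq> w4" using w by blast
      note xy = eq(1)[unfolded ext_eq_iff[OF V(1,2)]] and yz = eq(2)[unfolded ext_eq_iff[OF V(2,3)]]
      have "sub_at w4 x z"
        unfolding sub_at_def
      proof (intro allI impI)
        fix a v assume v: "w4 \<sqsubseteq> v" and a: "v |- in_EL a x"
        with xy have "v |- mem a y" unfolding sub_at_def by blast
        from this[unfolded mem_iff] show "v |- mem a z"
        proof (rule LocE, elim exE conjE)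
          fix v1 b assume v1: "v \<sqsubseteq> v1" and b: "v1 |- in_EL b y" "v1 |- a \<simeq> b"
          have wv1: "w4 \<sqsubseteq> v1" using v v1 by blast
          with b yz have "v1 |- mem b z" unfolding sub_at_def by blast
          from this[unfolded mem_iff] show "v1 |- mem a z"
          proof (rule LocE, elim exE conjE)
            fix u c assume u: "v1 \<sqsubseteq> u" and c: "u |- in_EL c z" "u |- b \<simeq> c"
            have wu: "w4 \<sqsubseteq> u" using wv1 u by blast
            have "frc u (a \<cdot> Var) \<phi>"
              by (rule frc_mono[OF IH[OF _ a]]) (use w4 v v1 u in blast)+
            moreover have "u |- Vset b" by (rule in_EL_Vset[OF mono[OF V(2) wu] mono[OF b(1) u]])
            moreover have "u |- Vset c" by (rule in_EL_Vset[OF mono[OF V(3) wu] c(1)])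
            ultimately have "u |- a \<simeq> c" using mono[OF b(2) u] c(2) by (rule \<phi>D)
            with c(1) show "u |- mem a z" by (rule memI)
          qed
        qed
      qed
      \<comment> \<open>The induction hypothesis speaks of elements of \<open>x\<close> on the left.
        For \<open>c\<close> in \<open>z\<close> one therefore first finds \<open>a\<close> in
        \<open>x\<close>, derives \<open>a \<simeq> b \<simeq> c\<close> from the reversed
        equalities, and turns the result around.\<close>
      moreover have "sub_at w4 z x"
        unfolding sub_at_def
      proof (intro allI impI)
        fix c v assume v: "w4 \<sqsubseteq> v" and c: "v |- in_EL c z"
        with yz have "v |- mem c y" unfolding sub_at_def by blast
        from this[unfolded mem_iff] show "v |- mem c x"
        proof (rule LocE, elim exE conjE)
          fix v1 b assume v1: "v \<sqsubseteq> v1" and b: "v1 |- in_EL b y" "v1 |- c \<simeq> b"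
          have wv1: "w4 \<sqsubseteq> v1" using v v1 by blast
          with b xy have "v1 |- mem b x" unfolding sub_at_def by blast
          from this[unfolded mem_iff] show "v1 |- mem c x"
          proof (rule LocE, elim exE conjE)
            fix u a assume u: "v1 \<sqsubseteq> u" and a: "u |- in_EL a x" "u |- b \<simeq> a"
            have wu: "w4 \<sqsubseteq> u" using wv1 u by blast
            have \<phi>: "frc u (a \<cdot> Var) \<phi>" by (rule IH[OF _ a(1)]) (use w4 wu in blast)
            have Va: "u |- Vset a" by (rule in_EL_Vset[OF mono[OF V(1) wu] a(1)])
            have Vb: "u |- Vset b" by (rule in_EL_Vset[OF mono[OF V(2) wu] mono[OF b(1) u]])
            have Vc: "u |- Vset c" by (rule in_EL_Vset[OF mono[OF V(3) wu] mono[OF c]]) (use v1 u in blast)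
            from \<phi> Vb Vc ext_sym[OF Vb Va a(2)] ext_sym[OF Vc Vb mono[OF b(2) u]]
            have "u |- a \<simeq> c" by (rule \<phi>D)
            with a(1) ext_sym[OF Va Vc] show "u |- mem c x" by (blast intro: memI)
          qed
        qed
      qed
      ultimately have "w4 |- x \<simeq> z" using ext_eq_iff[OF V(1,3)] by blast
      then show "frc w4 (z \<cdot> y \<cdot> x \<cdot> Var) (Var 2 \<simeq> Var 0)" by (simp add: eval_nat_numeral)
    qed
  qed
  from \<phi>D[OF this assms(2-)] show ?thesis .
qed

section \<open>Congruence of membership and exclusion of membership cycles\<close>

lemma mem_cong_left:
  assumes "w |- Vset a" "w |- Vset a'" "w |- Vset y" "w |- a' \<simeq> a" "w |- mem a y"
  shows "w |- mem a' y"
proof (rule LocE[OF assms(5)[unfolded mem_iff]], elim exE conjE)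
  fix v b assume v: "w \<sqsubseteq> v" and b: "v |- in_EL b y" "v |- a \<simeq> b"
  note up = mono[OF _ v]
  have "v |- a' \<simeq> b"
    by (rule ext_trans[OF assms(2)[THEN up] assms(1)[THEN up] _ assms(4)[THEN up] b(2)])
      (rule in_EL_Vset[OF assms(3)[THEN up] b(1)])
  with b(1) show "v |- mem a' y" by (rule memI)
qed

lemma mem_sub:
  assumes "w |- Vset a" "w |- Vset y" "w |- Vset y'" "sub_at w y y'" "w |- mem a y"
  shows "w |- mem a y'"
proof (rule LocE[OF assms(5)[unfolded mem_iff]], elim exE conjE)
  fix v b assume v: "w \<sqsubseteq> v" and b: "v |- in_EL b y" "v |- a \<simeq> b"
  note up = mono[OF _ v]
  have "v |- mem b y'" using assms(4) b(1) v unfolding sub_at_def by blast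
  moreover have "v |- Vset b" by (rule in_EL_Vset[OF assms(2)[THEN up] b(1)])
  ultimately show "v |- mem a y'"
    using b(2) assms(1,3)[THEN up] by (blast intro: mem_cong_left)
qed

lemma mem_cong_right:
  assumes "w |- Vset a" "w |- Vset y" "w |- Vset y'" "w |- y \<simeq> y'" "w |- mem a y"
  shows "w |- mem a y'"
  using mem_sub[OF assms(1-3) _ assms(5)] assms(4) ext_eq_iff[OF assms(2,3)] by blast

lemma in_EL_mem: "w |- Vset y ==> w |- in_EL a y ==> w |- mem a y"
  by (blast intro: memI ext_refl in_EL_Vset)

text \<open>If \<open>y\<close> is a member of \<open>x\<close>, it equals some element
  \<open>a\<close> of \<open>x\<close>. Then \<open>x\<close> and \<open>a\<close> are members of
  each other, a cycle excluded by the induction hypothesis at \<open>a\<close> with \<open>x\<close>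
  in the role of \<open>y\<close>.\<close>

lemma no_two_cycle:
  assumes "w |- Vset x" "w |- Vset y" "w |- mem x y" "w |- mem y x"
  shows "w |- Bot"
proof -
  define \<phi> where "\<phi> = All (Vset (Var 0) \<^bold>\<longrightarrow> mem (Var 1) (Var 0) \<^bold>\<longrightarrow> mem (Var 0) (Var 1) \<^bold>\<longrightarrow> Bot)"
  have \<phi>D: "v |- Bot" if "frc v (x \<cdot> Var) \<phi>" "v |- Vset y" "v |- mem x y" "v |- mem y x" for v x y
  proof -
    have "frc v (y \<cdot> x \<cdot> Var) (Vset (Var 0) \<^bold>\<longrightarrow> mem (Var 1) (Var 0) \<^bold>\<longrightarrow> mem (Var 0) (Var 1) \<^bold>\<longrightarrow> Bot)"
      using that(1) unfolding \<phi>_def by (rule frc_spec)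
    from frc_mp[OF frc_mp[OF frc_mp[OF this]]] show ?thesis using that(2-) by simp
  qed
  have "frc w (x \<cdot> Var) \<phi>"
  proof (rule Vset_induct[OF assms(1)])
    fix w' x assume V: "w' |- Vset x" and IH: "\<And>v a. w' \<sqsubseteq> v ==> v |- in_EL a x ==> frc v (a \<cdot> Var) \<phi>"
    show "frc w' (x \<cdot> Var) \<phi>"
      unfolding \<phi>_def frc_All
    proof (intro allI frc_impI)
      fix y w1 w2 w3 assume w: "w' \<sqsubseteq> w1" "w1 \<sqsubseteq> w2" "w2 \<sqsubseteq> w3"
        and "frc w1 (y \<cdot> x \<cdot> Var) (Vset (Var 0))" "frc w2 (y \<cdot> x \<cdot> Var) (mem (Var 1) (Var 0))"
          "frc w3 (y \<cdot> x \<cdot> Var) (mem (Var 0) (Var 1))"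
      then have "w1 |- Vset y" "w2 |- mem x y" "w3 |- mem y x" by simp_all
      with w V have V: "w3 |- Vset x" "w3 |- Vset y" and m: "w3 |- mem x y" "w3 |- mem y x"
        by (meson mono)+
      have "w3 |- Bot"
      proof (rule LocE[OF m(2)[unfolded mem_iff]], elim exE conjE)
        fix v a assume v: "w3 \<sqsubseteq> v" and a: "v |- in_EL a x" "v |- y \<simeq> a"
        note up = mono[OF _ v]
        note Va = in_EL_Vset[OF V(1)[THEN up] a(1)]
        have "v |- mem x a" by (rule mem_cong_right[OF V(1)[THEN up] V(2)[THEN up] Va a(2) m(1)[THEN up]])
        moreover have "v |- mem a x" by (rule in_EL_mem[OF V(1)[THEN up] a(1)])
        moreover have "frc v (a \<cdot> Var) \<phi>" by (rule IH[OF _ a(1)]) (use w v in blast)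
        ultimately show "v |- Bot" using V(1)[THEN up] by (blast intro: \<phi>D)
      qed
      then show "frc w3 (y \<cdot> x \<cdot> Var) Bot" by simp
    qed
  qed
  from \<phi>D[OF this assms(2-)] show ?thesis .
qed

section \<open>Numerals\<close>

lemma in_EL_cases:
  assumes "\<And>v n p. w \<sqsubseteq> v ==> v |- app_eq y n p ==> v |- Tr (eR p) ==> v |- b \<^bold>= eL p ==> v |- \<chi>"
    and "w |- in_EL b y"
  shows "w |- \<chi>"
  by (rule LocE[OF assms(2)[unfolded in_EL_iff]]) (blast intro: assms(1))

text \<open>Every position carries a false condition. The element \<open>Zero\<close> is a
  placeholder: it would have to be a v-set only if that condition were true.\<close>

lemma empty_exists:
  "Loc w (\<lambda>v. \<exists>y. v |- Vset y \<and> (\<forall>u b. v \<sqsubseteq> u --> u |- in_EL b y --> u |- Bot))"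
proof -
  have "Loc w (\<lambda>v. \<exists>y. v |- Vset y \<and> (\<forall>u n p. v \<sqsubseteq> u --> u |- app_eq y n p -->
    frc u (eL p \<cdot> eR p \<cdot> n \<cdot> Var) (Tr (Var 1) \<^bold>\<longrightarrow> Bot)))"
  proof (rule Vset_exists, rule Loc_map[OF repr_False], elim exE, intro exI conjI)
    fix v c assume c: "repr v c (\<lambda>u. u |- Bot)"
    then show "v |- Meaningful c" "\<forall>u. v \<sqsubseteq> u --> u |- Tr c --> u |- Vset Zero"
      unfolding repr_def by (blast intro: prov.BotE)+
    fix n show "frc v (Zero \<cdot> c \<cdot> n \<cdot> Var) (Tr (Var 1) \<^bold>\<longrightarrow> Bot)"
      using c unfolding repr_def by (intro frc_impI) simp
  qed
  then show ?thesis
  proof (rule Loc_map, elim exE conjE, intro exI conjI allI impI)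
    fix v y u b assume y: "\<forall>u n p. v \<sqsubseteq> u --> u |- app_eq y n p -->
      frc u (eL p \<cdot> eR p \<cdot> n \<cdot> Var) (Tr (Var 1) \<^bold>\<longrightarrow> Bot)" and u: "v \<sqsubseteq> u" and "u |- in_EL b y"
    from this(3) show "u |- Bot"
    proof (rule in_EL_cases[rotated])
      fix t n p assume t: "u \<sqsubseteq> t" and p: "t |- app_eq y n p" "t |- Tr (eR p)"
      have "frc t (eL p \<cdot> eR p \<cdot> n \<cdot> Var) (Tr (Var 1) \<^bold>\<longrightarrow> Bot)" using y u t p(1) by blast
      from frc_mp[OF this] p(2) show "t |- Bot" by simp
    qed
  qed
qed

lemma Succ_eq_Zero: "w |- Succ t \<^bold>= Zero ==> w |- Bot"
  by (simp add: eq_iff_nf S_neq_Z)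

lemma Succ_eq_Succ: "w |- Succ s \<^bold>= Succ t ==> w |- s \<^bold>= t"
  by (rule prov.ImpE[OF prov.Axiom[OF axs.Succ_inject]])

lemma nat_cases: "Loc w (\<lambda>v. v |- t \<^bold>= Zero \<or> (\<exists>u. v |- t \<^bold>= Succ u))"
  using zero_or_Succ[of w t] by (simp add: eq_iff_nf)

text \<open>The set \<open>x\<close> together with \<open>x\<close> as a new element, by shifting
  the enumeration: position \<open>0\<close> carries \<open>x\<close> with a true condition,
  position \<open>m + 1\<close> repeats position \<open>m\<close> of \<open>x\<close>. Elements are
  described by equality of numbers, which is sharper than \<open>\<simeq>\<close>.\<close>

lemma succ_exists:
  assumes "w |- Vset x"
  shows "Loc w (\<lambda>v. \<exists>y. v |- Vset y \<and>
    (\<forall>u b. v \<sqsubseteq> u --> (u |- in_EL b y \<longleftrightarrow> u |- (b \<^bold>= x \<^bold>\<or> in_EL b x))))"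
proof -
  define \<theta> where "\<theta> = ((Var 2 \<^bold>= Zero \<^bold>\<longrightarrow> Var 0 \<^bold>= Var 3 \<^bold>\<and> Tr (Var 1)) \<^bold>\<and>
    All (All (Var 4 \<^bold>= Succ (Var 1) \<^bold>\<longrightarrow> app_eq (Var 5) (Var 1) (Var 0) \<^bold>\<longrightarrow>
      Var 2 \<^bold>= eL (Var 0) \<^bold>\<and> Var 3 \<^bold>= eR (Var 0))))"
  have \<theta>_iff: "frc v (a \<cdot> c \<cdot> n \<cdot> x \<cdot> Var) \<theta> \<longleftrightarrow>
    (\<forall>u. v \<sqsubseteq> u --> u |- n \<^bold>= Zero --> u |- a \<^bold>= x \<and> u |- Tr c) \<and>
    (\<forall>m p u. v \<sqsubseteq> u --> u |- n \<^bold>= Succ m --> (\<forall>t. u \<sqsubseteq> t --> t |- app_eq x m p -->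
      t |- a \<^bold>= eL p \<and> t |- c \<^bold>= eR p))" for v a c n
    unfolding \<theta>_def by (simp add: frc_Imp eval_nat_numeral cong del: imp_cong)
  have "Loc w (\<lambda>v. \<exists>y. v |- Vset y \<and> (\<forall>u n p. v \<sqsubseteq> u --> u |- app_eq y n p -->
    frc u (eL p \<cdot> eR p \<cdot> n \<cdot> x \<cdot> Var) \<theta>))"
  proof (rule Vset_exists)
    fix w' n assume w': "w \<sqsubseteq> w'"
    show "Loc w' (\<lambda>v. \<exists>a c. v |- Meaningful c \<and>
      (\<forall>u. v \<sqsubseteq> u --> u |- Tr c --> u |- Vset a) \<and> frc v (a \<cdot> c \<cdot> n \<cdot> x \<cdot> Var) \<theta>)"
    proof (rule Loc_bind[OF nat_cases[of w' n]], elim disjE exE)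
      fix v assume v: "w' \<sqsubseteq> v" and n: "v |- n \<^bold>= Zero"
      have "frc v (x \<cdot> Fn Xi [und, und] \<cdot> n \<cdot> x \<cdot> Var) \<theta>"
        unfolding \<theta>_iff
      proof (intro conjI allI impI)
        fix u assume "v \<sqsubseteq> u"
        show "u |- x \<^bold>= x" by (rule prov.EqRefl)
        show "u |- Tr (Fn Xi [und, und])" using repr_True[of u] unfolding repr_def by blast
      next
        fix m p u t assume "v \<sqsubseteq> u" "u |- n \<^bold>= Succ m" "u \<sqsubseteq> t"
        then have "t |- Succ m \<^bold>= Zero" by (meson n mono eq_sym eq_trans)
        then have "t |- Bot" by (rule Succ_eq_Zero)
        then show "t |- x \<^bold>= eL p" "t |- Fn Xi [und, und] \<^bold>= eR p" by (blast intro: prov.BotE)+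
      qed
      moreover have "v |- Meaningful (Fn Xi [und, und])" using repr_True[of v] unfolding repr_def by blast
      moreover have "u |- Vset x" if "v \<sqsubseteq> u" for u
        by (rule mono[OF assms]) (use w' v that in blast)
      ultimately show "Loc v (\<lambda>v. \<exists>a c. v |- Meaningful c \<and>
          (\<forall>u. v \<sqsubseteq> u --> u |- Tr c --> u |- Vset a) \<and> frc v (a \<cdot> c \<cdot> n \<cdot> x \<cdot> Var) \<theta>)"
        by (blast intro: LocI)
    next
      fix v m assume v: "w' \<sqsubseteq> v" and n: "v |- n \<^bold>= Succ m"
      have "v |- Vset x" by (rule mono[OF assms]) (use w' v in blast)
      from Vset_elim[OF this, of m]
      show "Loc v (\<lambda>v. \<exists>a c. v |- Meaningful c \<and>
          (\<forall>u. v \<sqsubseteq> u --> u |- Tr c --> u |- Vset a) \<and> frc v (a \<cdot> c \<cdot> n \<cdot> x \<cdot> Var) \<theta>)"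
      proof (rule Loc_map, elim exE conjE, intro exI conjI)
        fix u p assume u: "v \<sqsubseteq> u" and p: "u |- app_eq x m p"
        show "frc u (eL p \<cdot> eR p \<cdot> n \<cdot> x \<cdot> Var) \<theta>"
          unfolding \<theta>_iff
        proof (intro conjI allI impI)
          fix t assume "u \<sqsubseteq> t" "t |- n \<^bold>= Zero"
          then have "t |- Succ m \<^bold>= Zero" using u by (meson n mono eq_sym eq_trans)
          then have "t |- Bot" by (rule Succ_eq_Zero)
          then show "t |- eL p \<^bold>= x" "t |- Tr (eR p)" by (blast intro: prov.BotE)+
        next
          fix m' q t s assume t: "u \<sqsubseteq> t" "t |- n \<^bold>= Succ m'" "t \<sqsubseteq> s" and q: "s |- app_eq x m' q"
          then have "s |- Succ m' \<^bold>= Succ m" using u by (meson n mono eq_sym eq_trans)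
          from app_subst2[OF Succ_eq_Succ[OF this] q] have "s |- app_eq x m q" .
          moreover have "s |- app_eq x m p" by (rule mono[OF p]) (use t in blast)
          ultimately have "s |- p \<^bold>= q" by (blast intro: app_fun)
          then show "s |- eL p \<^bold>= eL q" "s |- eR p \<^bold>= eR q" by (rule eL_cong eR_cong)+
        qed
      qed
    qed
  qed
  then show ?thesis
  proof (rule Loc_map, elim exE conjE, intro exI conjI allI impI)
    fix v y u b assume v: "w \<sqsubseteq> v" and Vy: "v |- Vset y" and u: "v \<sqsubseteq> u"
      and y: "\<forall>u n p. v \<sqsubseteq> u --> u |- app_eq y n p --> frc u (eL p \<cdot> eR p \<cdot> n \<cdot> x \<cdot> Var) \<theta>"
    have y: "frc t (eL p \<cdot> eR p \<cdot> n \<cdot> x \<cdot> Var) \<theta>" if "u \<sqsubseteq> t" "t |- app_eq y n p" for t n p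
      using y u that by blast
    have Vx: "u |- Vset x" and Vy: "u |- Vset y" using assms Vy v u by (meson mono)+
    show "u |- in_EL b y \<longleftrightarrow> u |- (b \<^bold>= x \<^bold>\<or> in_EL b x)"
    proof
      assume "u |- in_EL b y"
      then show "u |- (b \<^bold>= x \<^bold>\<or> in_EL b x)"
      proof (rule in_EL_cases[rotated])
        fix t n p assume t: "u \<sqsubseteq> t" and p: "t |- app_eq y n p" "t |- Tr (eR p)" "t |- b \<^bold>= eL p"
        note \<theta> = y[OF t p(1), unfolded \<theta>_iff]
        show "t |- (b \<^bold>= x \<^bold>\<or> in_EL b x)"
        proof (rule LocE[OF nat_cases[of t n]], elim disjE exE)
          fix s assume s: "t \<sqsubseteq> s" and n: "s |- n \<^bold>= Zero"
          with \<theta> have "s |- eL p \<^bold>= x" by blast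
          with mono[OF p(3) s] have "s |- b \<^bold>= x" by (rule eq_trans)
          then show "s |- (b \<^bold>= x \<^bold>\<or> in_EL b x)" by (rule prov.OrI1)
        next
          fix s m assume s: "t \<sqsubseteq> s" and n: "s |- n \<^bold>= Succ m"
          have "s |- Vset x" by (rule mono[OF Vx]) (use t s in blast)
          from Vset_elim[OF this, of m] show "s |- (b \<^bold>= x \<^bold>\<or> in_EL b x)"
          proof (rule LocE, elim exE conjE)
            fix r q assume r: "s \<sqsubseteq> r" and q: "r |- app_eq x m q"
            have tr: "t \<sqsubseteq> r" using s r by blast
            have eq: "r |- eL p \<^bold>= eL q" "r |- eR p \<^bold>= eR q"
              using \<theta> tr mono[OF n r] q by blast+
            have "r |- in_EL b x"
              using q Tr_subst[OF eq(2) mono[OF p(2) tr]] eq_trans[OF mono[OF p(3) tr] eq(1)] by (rule in_EL_I)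
            then show "r |- (b \<^bold>= x \<^bold>\<or> in_EL b x)" by (rule prov.OrI2)
          qed
        qed
      qed
    next
      assume "u |- (b \<^bold>= x \<^bold>\<or> in_EL b x)"
      then show "u |- in_EL b y"
        unfolding proves_Or
      proof (rule LocE, elim disjE)
        fix t assume t: "u \<sqsubseteq> t" and b: "t |- b \<^bold>= x"
        show "t |- in_EL b y"
        proof (rule LocE[OF Vset_elim[OF mono[OF Vy t], of Zero]], elim exE conjE)
          fix s p assume s: "t \<sqsubseteq> s" and p: "s |- app_eq y Zero p"
          have us: "u \<sqsubseteq> s" using t s by blast
          have "s |- eL p \<^bold>= x" "s |- Tr (eR p)"
            using y[OF us p, unfolded \<theta>_iff] by (blast intro: prov.EqRefl)+
          then show "s |- in_EL b y"
            by (intro in_EL_I[OF p]) (blast intro: eq_trans[OF mono[OF b s] eq_sym])+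
        qed
      next
        fix t assume t: "u \<sqsubseteq> t" and "t |- in_EL b x"
        from this(2) show "t |- in_EL b y"
        proof (rule in_EL_cases[rotated])
          fix s m q assume s: "t \<sqsubseteq> s" and q: "s |- app_eq x m q" "s |- Tr (eR q)" "s |- b \<^bold>= eL q"
          have us: "u \<sqsubseteq> s" using t s by blast
          show "s |- in_EL b y"
          proof (rule LocE[OF Vset_elim[OF mono[OF Vy us], of "Succ m"]], elim exE conjE)
            fix r p assume r: "s \<sqsubseteq> r" and p: "r |- app_eq y (Succ m) p"
            have ur: "u \<sqsubseteq> r" using us r by blast
            have eq: "r |- eL p \<^bold>= eL q" "r |- eR p \<^bold>= eR q"
              using y[OF ur p, unfolded \<theta>_iff] mono[OF q(1) r] by (blast intro: prov.EqRefl)+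
            show "r |- in_EL b y"
              using p Tr_subst[OF eq_sym[OF eq(2)] mono[OF q(2) r]]
                eq_trans[OF mono[OF q(3) r] eq_sym[OF eq(1)]] by (rule in_EL_I)
          qed
        qed
      qed
    qed
  qed
qed


text \<open>The successor clause uses literal elements and equality of numbers, as the construction
  delivers them. The set-theoretic successor relation, up to \<open>\<simeq>\<close>, is derived
  later.\<close>

definition numerals :: "fm list \<Rightarrow> trm \<Rightarrow> bool" where
  "numerals w \<nu> \<longleftrightarrow>
    (\<forall>u k. w \<sqsubseteq> u --> Loc u (\<lambda>t. \<exists>a. t |- app_eq \<nu> k a \<and> t |- Vset a)) \<and>
    (\<forall>u a b. w \<sqsubseteq> u --> u |- app_eq \<nu> Zero a --> u |- in_EL b a --> u |- Bot) \<and>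
    (\<forall>u k a a' b. w \<sqsubseteq> u --> u |- app_eq \<nu> k a --> u |- app_eq \<nu> (Succ k) a' -->
      (u |- in_EL b a' \<longleftrightarrow> u |- (b \<^bold>= a \<^bold>\<or> in_EL b a)))"

lemma numerals_mono: "numerals w \<nu> ==> w \<sqsubseteq> v ==> numerals v \<nu>"
  unfolding numerals_def by (meson order_trans)

lemma numerals_total: "numerals w \<nu> ==> Loc w (\<lambda>t. \<exists>a. t |- app_eq \<nu> k a \<and> t |- Vset a)"
  unfolding numerals_def by blast

lemma numerals_Vset:
  assumes "numerals w \<nu>" "w |- app_eq \<nu> k a"
  shows "w |- Vset a"
proof (rule LocE[OF numerals_total[OF assms(1), of k]], elim exE conjE)
  fix v b assume v: "w \<sqsubseteq> v" and b: "v |- app_eq \<nu> k b" "v |- Vset b"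
  from app_fun[OF b(1) mono[OF assms(2) v]] b(2) show "v |- Vset a" by (rule Vset_subst)
qed

lemma numerals_Zero: "numerals w \<nu> ==> w |- app_eq \<nu> Zero a ==> w |- in_EL b a ==> w |- Bot"
  unfolding numerals_def by blast

lemma numerals_Succ:
  "numerals w \<nu> ==> w |- app_eq \<nu> k a ==> w |- app_eq \<nu> (Succ k) a' ==>
    w |- in_EL b a' \<longleftrightarrow> w |- (b \<^bold>= a \<^bold>\<or> in_EL b a)"
  unfolding numerals_def by blast

text \<open>The recursion theorem yields a value at \<open>k\<close> only under the condition
  \<open>A\<close> that the value at the predecessor exists and is a v-set, for only then can the
  successor set be formed. Totality follows afterwards by induction on \<open>k\<close>.\<close>

lemma numerals_exist: "Loc w (\<lambda>v. \<exists>\<nu>. numerals v \<nu>)"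
proof -
  define A where "A = All (Var 1 \<^bold>= Succ (Var 0) \<^bold>\<longrightarrow>
    dfd (Var 2) (Var 0) \<^bold>\<and> All (app_eq (Var 3) (Var 1) (Var 0) \<^bold>\<longrightarrow> Vset (Var 0)))"
  define \<psi> where "\<psi> = (Vset (Var 0) \<^bold>\<and> (Var 1 \<^bold>= Zero \<^bold>\<longrightarrow> All (in_EL (Var 0) (Var 1) \<^bold>\<longrightarrow> Bot)) \<^bold>\<and>
    All (All (Var 3 \<^bold>= Succ (Var 1) \<^bold>\<longrightarrow> app_eq (Var 4) (Var 1) (Var 0) \<^bold>\<longrightarrow>
      All (in_EL (Var 0) (Var 3) \<^bold>\<longleftrightarrow> Var 0 \<^bold>= Var 1 \<^bold>\<or> in_EL (Var 0) (Var 1)))))"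
  have an: "almost_negative A"
    unfolding A_def
    by (intro almost_negative.intros(5,6,7) almost_negative.intros(2) almost_negative_app)
      (intro almost_negative.intros(1) sigma1.intros delta0.intros)
  have A_iff: "frc v (k \<cdot> e \<cdot> Var) A \<longleftrightarrow> (\<forall>j u. v \<sqsubseteq> u --> u |- k \<^bold>= Succ j -->
    Loc u (\<lambda>t. \<exists>a. t |- app_eq e j a) \<and> (\<forall>a t. u \<sqsubseteq> t --> t |- app_eq e j a --> t |- Vset a))" for v k e
    unfolding A_def by (simp add: frc_Imp eval_nat_numeral cong del: imp_cong)
  have \<psi>_iff: "frc v (m \<cdot> k \<cdot> e \<cdot> Var) \<psi> \<longleftrightarrow> v |- Vset m \<and>
    (\<forall>u. v \<sqsubseteq> u --> u |- k \<^bold>= Zero --> (\<forall>b t. u \<sqsubseteq> t --> t |- in_EL b m --> t |- Bot)) \<and>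
    (\<forall>j a u. v \<sqsubseteq> u --> u |- k \<^bold>= Succ j --> (\<forall>t. u \<sqsubseteq> t --> t |- app_eq e j a -->
      (\<forall>b. (\<forall>s. t \<sqsubseteq> s --> s |- in_EL b m --> s |- (b \<^bold>= a \<^bold>\<or> in_EL b a)) \<and>
        (\<forall>s. t \<sqsubseteq> s --> s |- (b \<^bold>= a \<^bold>\<or> in_EL b a) --> s |- in_EL b m))))" for v m k e
    unfolding \<psi>_def by (simp add: frc_Imp proves_Or eval_nat_numeral cong del: imp_cong)
  have "Loc w (\<lambda>v. \<exists>\<nu>. \<forall>u k. v \<sqsubseteq> u --> frc u (k \<cdot> \<nu> \<cdot> Var) A -->
    Loc u (\<lambda>t. \<exists>m. t |- app_eq \<nu> k m \<and> frc t (m \<cdot> k \<cdot> \<nu> \<cdot> Var) \<psi>))"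
  proof (rule recursion_theorem[OF an])
    fix w' k e assume w': "w \<sqsubseteq> w'" and A: "frc w' (k \<cdot> e \<cdot> Var) A"
    show "Loc w' (\<lambda>v. \<exists>m. frc v (m \<cdot> k \<cdot> e \<cdot> Var) \<psi>)"
    proof (rule Loc_bind[OF nat_cases[of w' k]], elim disjE exE)
      fix v assume k: "v |- k \<^bold>= Zero"
      show "Loc v (\<lambda>v. \<exists>m. frc v (m \<cdot> k \<cdot> e \<cdot> Var) \<psi>)"
      proof (rule Loc_map[OF empty_exists], elim exE conjE)
        fix u y assume u: "v \<sqsubseteq> u" and y: "u |- Vset y" "\<forall>t b. u \<sqsubseteq> t --> t |- in_EL b y --> t |- Bot"
        have absurd: "s |- \<chi>" if "u \<sqsubseteq> t" "t |- k \<^bold>= Succ j" "t \<sqsubseteq> s" for t j s \<chi>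
        proof -
          have "s |- Succ j \<^bold>= Zero" using u that k by (meson mono eq_sym eq_trans)
          then show ?thesis by (blast intro: Succ_eq_Zero prov.BotE)
        qed
        have "frc u (y \<cdot> k \<cdot> e \<cdot> Var) \<psi>"
          unfolding \<psi>_iff
        proof (intro conjI allI impI)
          fix t b s assume "u \<sqsubseteq> t" "t \<sqsubseteq> s" "s |- in_EL b y"
          then show "s |- Bot" using y(2) by (meson order_trans)
        next
          fix j a t s b r assume "u \<sqsubseteq> t" "t |- k \<^bold>= Succ j" "t \<sqsubseteq> s" "s \<sqsubseteq> r"
          then show "r |- (b \<^bold>= a \<^bold>\<or> in_EL b a)" "r |- in_EL b y" by (meson absurd order_trans)+
        qed (rule y(1))
        then show "\<exists>m. frc u (m \<cdot> k \<cdot> e \<cdot> Var) \<psi>" by blast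
      qed
    next
      fix v j assume v: "w' \<sqsubseteq> v" and k: "v |- k \<^bold>= Succ j"
      from A[unfolded A_iff] v k have "Loc v (\<lambda>t. \<exists>a. t |- app_eq e j a)"
        and V: "\<And>a t. v \<sqsubseteq> t ==> t |- app_eq e j a ==> t |- Vset a" by blast+
      from this(1) show "Loc v (\<lambda>v. \<exists>m. frc v (m \<cdot> k \<cdot> e \<cdot> Var) \<psi>)"
      proof (rule Loc_bind, elim exE)
        fix u a assume u: "v \<sqsubseteq> u" and a: "u |- app_eq e j a"
        show "Loc u (\<lambda>v. \<exists>m. frc v (m \<cdot> k \<cdot> e \<cdot> Var) \<psi>)"
        proof (rule Loc_map[OF succ_exists[OF V[OF u a]]], elim exE conjE)
          fix t y assume t: "u \<sqsubseteq> t" and y: "t |- Vset y"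
            and yEL: "\<forall>u b. t \<sqsubseteq> u --> (u |- in_EL b y \<longleftrightarrow> u |- (b \<^bold>= a \<^bold>\<or> in_EL b a))"
          have "frc t (y \<cdot> k \<cdot> e \<cdot> Var) \<psi>"
            unfolding \<psi>_iff
          proof (intro conjI allI impI)
            fix s b r assume "t \<sqsubseteq> s" "s |- k \<^bold>= Zero" "s \<sqsubseteq> r"
            then have "r |- Succ j \<^bold>= Zero" using u t k by (meson mono eq_sym eq_trans)
            then show "r |- Bot" by (rule Succ_eq_Zero)
          next
            fix j' a' s r b q
            assume s: "t \<sqsubseteq> s" "s |- k \<^bold>= Succ j'" "s \<sqsubseteq> r" "r |- app_eq e j' a'" "r \<sqsubseteq> q"
            then have "q |- Succ j' \<^bold>= Succ j" using u t k by (meson mono eq_sym eq_trans)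
            from Succ_eq_Succ[OF this] have "q |- app_eq e j a'"
              by (rule app_subst2) (rule mono[OF s(4,5)])
            moreover have "q |- app_eq e j a" by (rule mono[OF a]) (use t s in blast)
            ultimately have eq: "q |- a \<^bold>= a'" by (blast intro: app_fun)
            have iff: "q |- (b \<^bold>= a \<^bold>\<or> in_EL b a) \<longleftrightarrow> q |- (b \<^bold>= a' \<^bold>\<or> in_EL b a')"
              using eq_subst[OF eq, of Var "lift b \<^bold>= Var 0 \<^bold>\<or> in_EL (lift b) (Var 0)"]
                eq_subst[OF eq_sym[OF eq], of Var "lift b \<^bold>= Var 0 \<^bold>\<or> in_EL (lift b) (Var 0)"]
              by (auto simp: proves_Or)
            have q: "t \<sqsubseteq> q" using s by blast
            show "q |- in_EL b y ==> q |- (b \<^bold>= a' \<^bold>\<or> in_EL b a')"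
              "q |- (b \<^bold>= a' \<^bold>\<or> in_EL b a') ==> q |- in_EL b y"
              using yEL q iff by blast+
          qed (rule y)
          then show "\<exists>m. frc t (m \<cdot> k \<cdot> e \<cdot> Var) \<psi>" by blast
        qed
      qed
    qed
  qed
  then show ?thesis
  proof (rule Loc_map, elim exE)
    fix v \<nu> assume *: "\<forall>u k. v \<sqsubseteq> u --> frc u (k \<cdot> \<nu> \<cdot> Var) A -->
      Loc u (\<lambda>t. \<exists>m. t |- app_eq \<nu> k m \<and> frc t (m \<cdot> k \<cdot> \<nu> \<cdot> Var) \<psi>)"
    then have \<nu>: "Loc u (\<lambda>t. \<exists>m. t |- app_eq \<nu> k m \<and> frc t (m \<cdot> k \<cdot> \<nu> \<cdot> Var) \<psi>)"
      if "v \<sqsubseteq> u" "frc u (k \<cdot> \<nu> \<cdot> Var) A" for u k using that by blast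
    \<comment> \<open>Totality with v-set values, stated as a formula so that arithmetical induction
      applies; it may be existential, since ECT is not involved any more.\<close>
    define \<tau> where "\<tau> = Ex (app_eq (Var 2) (Var 1) (Var 0) \<^bold>\<and> Vset (Var 0))"
    have \<tau>_iff: "frc u (k \<cdot> \<nu> \<cdot> Var) \<tau> \<longleftrightarrow> Loc u (\<lambda>t. \<exists>a. t |- app_eq \<nu> k a \<and> t |- Vset a)" for u k
      unfolding \<tau>_def by (simp add: eval_nat_numeral)
    have A_\<tau>: "frc u (k \<cdot> \<nu> \<cdot> Var) \<tau>" if "v \<sqsubseteq> u" "frc u (k \<cdot> \<nu> \<cdot> Var) A" for u k
      unfolding \<tau>_iff by (rule Loc_map[OF \<nu>[OF that]]) (unfold \<psi>_iff, blast)
    \<comment> \<open>\<open>A\<close> at \<open>k\<close> concerns only a predecessor of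
      \<open>k\<close>, so it is vacuous at zero and follows from the induction hypothesis at a
      successor.\<close>
    have \<tau>_A: "frc u (k \<cdot> \<nu> \<cdot> Var) A"
      if "\<And>j t. u \<sqsubseteq> t ==> t |- k \<^bold>= Succ j ==> frc t (j \<cdot> \<nu> \<cdot> Var) \<tau>" for u k
      unfolding A_iff
    proof (intro allI impI conjI)
      fix j t assume t: "u \<sqsubseteq> t" "t |- k \<^bold>= Succ j"
      note \<tau> = that[OF t]
      from \<tau>[unfolded \<tau>_iff] show "Loc t (\<lambda>t. \<exists>a. t |- app_eq \<nu> j a)" by (rule Loc_map) blast
      fix a s assume s: "t \<sqsubseteq> s" and a: "s |- app_eq \<nu> j a"
      from frc_mono[OF \<tau> s, unfolded \<tau>_iff] show "s |- Vset a"
      proof (rule LocE, elim exE conjE)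
        fix r b assume r: "s \<sqsubseteq> r" and b: "r |- app_eq \<nu> j b" "r |- Vset b"
        from app_fun[OF b(1) mono[OF a r]] b(2) show "r |- Vset a" by (rule Vset_subst)
      qed
    qed
    have total: "frc u (k \<cdot> \<nu> \<cdot> Var) \<tau>" if u: "v \<sqsubseteq> u" for u k
    proof (rule HA_induct)
      show "frc u (Zero \<cdot> \<nu> \<cdot> Var) \<tau>"
      proof (rule A_\<tau>[OF u], rule \<tau>_A)
        fix j t assume "t |- Zero \<^bold>= Succ j"
        then have "t |- Bot" by (blast intro: Succ_eq_Zero eq_sym)
        then show "frc t (j \<cdot> \<nu> \<cdot> Var) \<tau>" unfolding frc_def by (rule prov.BotE)
      qed
    next
      fix u' k assume u': "u \<sqsubseteq> u'" and \<tau>: "frc u' (k \<cdot> \<nu> \<cdot> Var) \<tau>"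
      have "v \<sqsubseteq> u'" using u u' by blast
      then show "frc u' (Succ k \<cdot> \<nu> \<cdot> Var) \<tau>"
      proof (rule A_\<tau>, intro \<tau>_A)
        fix j t assume t: "u' \<sqsubseteq> t" and "t |- Succ k \<^bold>= Succ j"
        from Succ_eq_Succ[OF this(2)] frc_mono[OF \<tau> t] show "frc t (j \<cdot> \<nu> \<cdot> Var) \<tau>" by (rule eq_subst)
      qed
    qed
    have spec: "frc u (m \<cdot> k \<cdot> \<nu> \<cdot> Var) \<psi>" if u: "v \<sqsubseteq> u" and m: "u |- app_eq \<nu> k m" for u k m
    proof -
      have "frc u (k \<cdot> \<nu> \<cdot> Var) A" by (rule \<tau>_A, rule total) (use u in blast)
      from \<nu>[OF u this] show ?thesis
      proof (rule frc_LocE, elim exE conjE)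
        fix t m' assume t: "u \<sqsubseteq> t" and m': "t |- app_eq \<nu> k m'" "frc t (m' \<cdot> k \<cdot> \<nu> \<cdot> Var) \<psi>"
        from app_fun[OF m'(1) mono[OF m t]] m'(2) show "frc t (m \<cdot> k \<cdot> \<nu> \<cdot> Var) \<psi>" by (rule eq_subst)
      qed
    qed
    have "numerals v \<nu>"
      unfolding numerals_def
    proof (intro conjI allI impI)
      fix u k assume "v \<sqsubseteq> u"
      then show "Loc u (\<lambda>t. \<exists>a. t |- app_eq \<nu> k a \<and> t |- Vset a)" using total \<tau>_iff by blast
    next
      fix u a b assume u: "v \<sqsubseteq> u" and a: "u |- app_eq \<nu> Zero a" and b: "u |- in_EL b a"
      then show "u |- Bot" using spec[OF u a, unfolded \<psi>_iff] by (blast intro: prov.EqRefl)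
    next
      fix u k a a' b assume u: "v \<sqsubseteq> u" and a: "u |- app_eq \<nu> k a" and a': "u |- app_eq \<nu> (Succ k) a'"
      show "u |- in_EL b a' \<longleftrightarrow> u |- (b \<^bold>= a \<^bold>\<or> in_EL b a)"
        using spec[OF u a', unfolded \<psi>_iff] a prov.EqRefl[of "axs Xi" u "Succ k"] by blast
    qed
    then show "\<exists>\<nu>. numerals v \<nu>" by blast
  qed
qed

text \<open>Separation from the numerals: position \<open>n\<close> carries the element
  \<open>\<nu>(n)\<close> and a condition representing \<open>\<beta>(n)\<close>. A trivially true
  \<open>\<beta>\<close> gives \<open>\<omega>\<close>, the diagonal formula gives Cantor's
  set.\<close>

lemma numeral_set_exists:
  assumes \<nu>: "numerals w \<nu>"
    and \<beta>: "\<And>w' n. w \<sqsubseteq> w' ==> Loc w' (\<lambda>v. \<exists>c. repr v c (\<lambda>u. frc u (n \<cdot> \<rho>) \<beta>))"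
  shows "Loc w (\<lambda>v. \<exists>y. v |- Vset y \<and> (\<forall>u b. v \<sqsubseteq> u -->
    (u |- in_EL b y \<longleftrightarrow> Loc u (\<lambda>t. \<exists>n. t |- app_eq \<nu> n b \<and> frc t (n \<cdot> \<rho>) \<beta>))))"
proof -
  define \<theta> where "\<theta> = (app_eq (Var 3) (Var 2) (Var 0) \<^bold>\<and>
    sub (Var 1 \<cdot> Var 2 \<cdot> (\<lambda>i. Var (i + 4))) (repr_fm \<beta>))"
  have \<theta>_iff: "frc v (a \<cdot> c \<cdot> n \<cdot> \<nu> \<cdot> \<rho>) \<theta> \<longleftrightarrow> v |- app_eq \<nu> n a \<and> repr v c (\<lambda>u. frc u (n \<cdot> \<rho>) \<beta>)" for v a c n
    unfolding \<theta>_def frc_repr_fm[symmetric] by (simp add: subt_scons eval_nat_numeral)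
  have "Loc w (\<lambda>v. \<exists>y. v |- Vset y \<and> (\<forall>u n p. v \<sqsubseteq> u --> u |- app_eq y n p -->
    frc u (eL p \<cdot> eR p \<cdot> n \<cdot> \<nu> \<cdot> \<rho>) \<theta>))"
  proof (rule Vset_exists)
    fix w' n assume w': "w \<sqsubseteq> w'"
    show "Loc w' (\<lambda>v. \<exists>a c. v |- Meaningful c \<and>
      (\<forall>u. v \<sqsubseteq> u --> u |- Tr c --> u |- Vset a) \<and> frc v (a \<cdot> c \<cdot> n \<cdot> \<nu> \<cdot> \<rho>) \<theta>)"
    proof (rule Loc_bind[OF \<beta>[OF w', of n]], elim exE)
      fix v c assume v: "w' \<sqsubseteq> v" and c: "repr v c (\<lambda>u. frc u (n \<cdot> \<rho>) \<beta>)"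
      have "numerals v \<nu>" by (rule numerals_mono[OF \<nu>]) (use w' v in blast)
      from numerals_total[OF this, of n]
      show "Loc v (\<lambda>v. \<exists>a c. v |- Meaningful c \<and>
        (\<forall>u. v \<sqsubseteq> u --> u |- Tr c --> u |- Vset a) \<and> frc v (a \<cdot> c \<cdot> n \<cdot> \<nu> \<cdot> \<rho>) \<theta>)"
      proof (rule Loc_map, elim exE conjE)
        fix u a assume u: "v \<sqsubseteq> u" and a: "u |- app_eq \<nu> n a" "u |- Vset a"
        have c: "repr u c (\<lambda>u. frc u (n \<cdot> \<rho>) \<beta>)" by (rule repr_mono[OF c u])
        have "u |- Meaningful c" using c unfolding repr_def by blast
        with a c show "\<exists>a c. u |- Meaningful c \<and>
          (\<forall>t. u \<sqsubseteq> t --> t |- Tr c --> t |- Vset a) \<and> frc u (a \<cdot> c \<cdot> n \<cdot> \<nu> \<cdot> \<rho>) \<theta>"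
          unfolding \<theta>_iff using mono by blast
      qed
    qed
  qed
  then show ?thesis
  proof (rule Loc_map, elim exE conjE, intro exI conjI allI impI)
    fix v y u b assume v: "w \<sqsubseteq> v" and Vy: "v |- Vset y" and u: "v \<sqsubseteq> u"
      and y: "\<forall>u n p. v \<sqsubseteq> u --> u |- app_eq y n p --> frc u (eL p \<cdot> eR p \<cdot> n \<cdot> \<nu> \<cdot> \<rho>) \<theta>"
    have y: "t |- app_eq \<nu> n (eL p)" "repr t (eR p) (\<lambda>u. frc u (n \<cdot> \<rho>) \<beta>)"
      if "u \<sqsubseteq> t" "t |- app_eq y n p" for t n p
      using y u that unfolding \<theta>_iff by blast+
    show "u |- in_EL b y \<longleftrightarrow> Loc u (\<lambda>t. \<exists>n. t |- app_eq \<nu> n b \<and> frc t (n \<cdot> \<rho>) \<beta>)"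
    proof
      assume "u |- in_EL b y"
      from this[unfolded in_EL_iff] show "Loc u (\<lambda>t. \<exists>n. t |- app_eq \<nu> n b \<and> frc t (n \<cdot> \<rho>) \<beta>)"
      proof (rule Loc_map, elim exE conjE)
        fix t n p assume t: "u \<sqsubseteq> t" and p: "t |- app_eq y n p" "t |- Tr (eR p)" "t |- b \<^bold>= eL p"
        have "t |- app_eq \<nu> n b" using eq_sym[OF p(3)] y(1)[OF t p(1)] by (rule app_subst3)
        moreover have "frc t (n \<cdot> \<rho>) \<beta>" using y(2)[OF t p(1)] p(2) unfolding repr_def by blast
        ultimately show "\<exists>n. t |- app_eq \<nu> n b \<and> frc t (n \<cdot> \<rho>) \<beta>" by blast
      qed
    next
      assume "Loc u (\<lambda>t. \<exists>n. t |- app_eq \<nu> n b \<and> frc t (n \<cdot> \<rho>) \<beta>)"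
      then show "u |- in_EL b y"
      proof (rule LocE, elim exE conjE)
        fix t n assume t: "u \<sqsubseteq> t" and b: "t |- app_eq \<nu> n b" and \<beta>: "frc t (n \<cdot> \<rho>) \<beta>"
        have "t |- Vset y" by (rule mono[OF Vy]) (use u t in blast)
        from Vset_elim[OF this, of n] show "t |- in_EL b y"
        proof (rule LocE, elim exE conjE)
          fix s p assume s: "t \<sqsubseteq> s" and p: "s |- app_eq y n p"
          have us: "u \<sqsubseteq> s" using t s by blast
          have "s |- Tr (eR p)" using y(2)[OF us p] frc_mono[OF \<beta> s] unfolding repr_def by blast
          with p show "s |- in_EL b y"
            using app_fun[OF mono[OF b s] y(1)[OF us p]] by (rule in_EL_I)
        qed
      qed
    qed
  qed
qed


section \<open>Decidable equality of numbers and injectivity of the numerals\<close>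

lemma Succ_cong: "w |- s \<^bold>= t ==> w |- Succ s \<^bold>= Succ t"
  unfolding eq_iff_nf by (simp only: nf_fold) (rule S_cong)

text \<open>Induction on \<open>s\<close> for a formula that quantifies over \<open>t\<close>, with
  a split of \<open>t\<close> into zero and successor in both cases.\<close>

lemma eq_decidable: "Loc w (\<lambda>v. v |- s \<^bold>= t \<or> (\<forall>u. v \<sqsubseteq> u --> u |- s \<^bold>= t --> u |- Bot))"
proof -
  define \<phi> where "\<phi> = All (Var 1 \<^bold>= Var 0 \<^bold>\<or> (Var 1 \<^bold>= Var 0 \<^bold>\<longrightarrow> Bot))"
  have \<phi>_iff: "frc w (s \<cdot> Var) \<phi> \<longleftrightarrow> (\<forall>t. Loc w (\<lambda>v. v |- s \<^bold>= t \<or>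
    (\<forall>u. v \<sqsubseteq> u --> u |- s \<^bold>= t --> u |- Bot)))" for w s
    unfolding \<phi>_def by (simp add: frc_Imp cong del: imp_cong)
  have "frc w (s \<cdot> Var) \<phi>"
  proof (rule HA_induct)
    show "frc w (Zero \<cdot> Var) \<phi>"
      unfolding \<phi>_iff
    proof (intro allI)
      fix t
      show "Loc w (\<lambda>v. v |- Zero \<^bold>= t \<or> (\<forall>u. v \<sqsubseteq> u --> u |- Zero \<^bold>= t --> u |- Bot))"
      proof (rule Loc_map[OF nat_cases[of w t]], elim disjE exE)
        fix v assume "v |- t \<^bold>= Zero"
        then show "v |- Zero \<^bold>= t \<or> (\<forall>u. v \<sqsubseteq> u --> u |- Zero \<^bold>= t --> u |- Bot)"
          by (blast intro: eq_sym)
      next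
        fix v t' assume t: "v |- t \<^bold>= Succ t'"
        have "u |- Bot" if "v \<sqsubseteq> u" "u |- Zero \<^bold>= t" for u
          using eq_sym[OF eq_trans[OF that(2) mono[OF t that(1)]]] by (rule Succ_eq_Zero)
        then show "v |- Zero \<^bold>= t \<or> (\<forall>u. v \<sqsubseteq> u --> u |- Zero \<^bold>= t --> u |- Bot)" by blast
      qed
    qed
  next
    fix w' s assume IH: "frc w' (s \<cdot> Var) \<phi>"
    show "frc w' (Succ s \<cdot> Var) \<phi>"
      unfolding \<phi>_iff
    proof (intro allI)
      fix t
      show "Loc w' (\<lambda>v. v |- Succ s \<^bold>= t \<or> (\<forall>u. v \<sqsubseteq> u --> u |- Succ s \<^bold>= t --> u |- Bot))"
      proof (rule Loc_bind[OF nat_cases[of w' t]], elim disjE exE)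
        fix v assume v: "w' \<sqsubseteq> v" and t: "v |- t \<^bold>= Zero"
        have "u |- Bot" if "v \<sqsubseteq> u" "u |- Succ s \<^bold>= t" for u
          using eq_trans[OF that(2) mono[OF t that(1)]] by (rule Succ_eq_Zero)
        then show "Loc v (\<lambda>v. v |- Succ s \<^bold>= t \<or> (\<forall>u. v \<sqsubseteq> u --> u |- Succ s \<^bold>= t --> u |- Bot))"
          by (blast intro: LocI)
      next
        fix v t' assume v: "w' \<sqsubseteq> v" and t: "v |- t \<^bold>= Succ t'"
        from frc_mono[OF IH v, unfolded \<phi>_iff, THEN spec, of t']
        show "Loc v (\<lambda>v. v |- Succ s \<^bold>= t \<or> (\<forall>u. v \<sqsubseteq> u --> u |- Succ s \<^bold>= t --> u |- Bot))"
        proof (rule Loc_map, elim disjE)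
          fix u assume u: "v \<sqsubseteq> u" and "u |- s \<^bold>= t'"
          from eq_trans[OF Succ_cong[OF this(2)] eq_sym[OF mono[OF t u]]]
          show "u |- Succ s \<^bold>= t \<or> (\<forall>r. u \<sqsubseteq> r --> r |- Succ s \<^bold>= t --> r |- Bot)" by blast
        next
          fix u assume u: "v \<sqsubseteq> u" and neq: "\<forall>r. u \<sqsubseteq> r --> r |- s \<^bold>= t' --> r |- Bot"
          have "r |- Bot" if r: "u \<sqsubseteq> r" "r |- Succ s \<^bold>= t" for r
          proof -
            have "r |- t \<^bold>= Succ t'" by (rule mono[OF t]) (use u r in blast)
            from Succ_eq_Succ[OF eq_trans[OF r(2) this]] neq r(1) show ?thesis by blast
          qed
          then show "u |- Succ s \<^bold>= t \<or> (\<forall>r. u \<sqsubseteq> r --> r |- Succ s \<^bold>= t --> r |- Bot)" by blast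
        qed
      qed
    qed
  qed
  then show ?thesis unfolding \<phi>_iff by blast
qed

lemma numerals_mem_Succ:
  assumes \<nu>: "numerals w \<nu>" and a: "w |- app_eq \<nu> k a" "w |- app_eq \<nu> (Succ k) a'" and m: "w |- mem c a'"
  shows "Loc w (\<lambda>v. v |- mem c a \<or> v |- c \<simeq> a)"
proof (rule Loc_bind[OF m[unfolded mem_iff]], elim exE conjE)
  fix v b assume v: "w \<sqsubseteq> v" and b: "v |- in_EL b a'" "v |- c \<simeq> b"
  have "v |- (b \<^bold>= a \<^bold>\<or> in_EL b a)"
    using numerals_Succ[OF numerals_mono[OF \<nu> v] mono[OF a(1) v] mono[OF a(2) v]] b(1) by blast
  from this[unfolded proves_Or] show "Loc v (\<lambda>v. v |- mem c a \<or> v |- c \<simeq> a)"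
  proof (rule Loc_map, elim disjE)
    fix u assume "v \<sqsubseteq> u" "u |- b \<^bold>= a"
    then show "u |- mem c a \<or> u |- c \<simeq> a" using rel_subst2[OF _ mono[OF b(2)]] by blast
  next
    fix u assume "v \<sqsubseteq> u" "u |- in_EL b a"
    then show "u |- mem c a \<or> u |- c \<simeq> a" using memI[OF _ mono[OF b(2)]] by blast
  qed
qed

lemma numerals_mem_Succ_self:
  assumes "numerals w \<nu>" "w |- app_eq \<nu> k a" "w |- app_eq \<nu> (Succ k) a'"
  shows "w |- mem a a'"
proof (rule memI)
  show "w |- in_EL a a'"
    unfolding numerals_Succ[OF assms] by (intro prov.OrI1 prov.EqRefl)
  show "w |- a \<simeq> a" by (rule ext_refl[OF numerals_Vset[OF assms(1,2)]])
qed

text \<open>Induction on \<open>i\<close>, uniformly in \<open>j\<close>. Between zero and a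
  successor equality fails because one value is empty and the other is not. For two successors the
  predecessor values \<open>a0\<close> and \<open>b0\<close> each belong to the successor set of the
  other; either they are equal and the hypothesis applies, or they are members of each other, which
  \<open>no_two_cycle\<close> excludes.\<close>

lemma numerals_inject:
  assumes \<nu>: "numerals w \<nu>" and ab: "w |- app_eq \<nu> i a" "w |- app_eq \<nu> j b" "w |- a \<simeq> b"
  shows "w |- i \<^bold>= j"
proof -
  define \<phi> where "\<phi> = All (All (All (app_eq (Var 4) (Var 3) (Var 1) \<^bold>\<longrightarrow> app_eq (Var 4) (Var 2) (Var 0) \<^bold>\<longrightarrow>
    Var 1 \<simeq> Var 0 \<^bold>\<longrightarrow> Var 3 \<^bold>= Var 2)))"
  have \<phi>I: "frc v (i \<cdot> \<nu> \<cdot> Var) \<phi>"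
    if "\<And>j a b u. v \<sqsubseteq> u ==> u |- app_eq \<nu> i a ==> u |- app_eq \<nu> j b ==> u |- a \<simeq> b ==> u |- i \<^bold>= j" for v i
    unfolding \<phi>_def frc_All
  proof (intro allI frc_impI)
    fix j a b v1 v2 v3 assume v: "v \<sqsubseteq> v1" "v1 \<sqsubseteq> v2" "v2 \<sqsubseteq> v3"
      and "frc v1 (b \<cdot> a \<cdot> j \<cdot> i \<cdot> \<nu> \<cdot> Var) (app_eq (Var 4) (Var 3) (Var 1))"
        "frc v2 (b \<cdot> a \<cdot> j \<cdot> i \<cdot> \<nu> \<cdot> Var) (app_eq (Var 4) (Var 2) (Var 0))"
        "frc v3 (b \<cdot> a \<cdot> j \<cdot> i \<cdot> \<nu> \<cdot> Var) (Var 1 \<simeq> Var 0)"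
    then have *: "v1 |- app_eq \<nu> i a" "v2 |- app_eq \<nu> j b" "v3 |- a \<simeq> b" by (simp_all add: eval_nat_numeral)
    have "v3 |- i \<^bold>= j"
      by (rule that[OF _ mono[OF *(1)] mono[OF *(2)] *(3)]) (use v in blast)+
    then show "frc v3 (b \<cdot> a \<cdot> j \<cdot> i \<cdot> \<nu> \<cdot> Var) (Var 3 \<^bold>= Var 2)" by (simp add: eval_nat_numeral)
  qed
  have \<phi>D: "v |- i \<^bold>= j" if "frc v (i \<cdot> \<nu> \<cdot> Var) \<phi>" "v |- app_eq \<nu> i a" "v |- app_eq \<nu> j b" "v |- a \<simeq> b" for v i j a b
  proof -
    have "frc v (b \<cdot> a \<cdot> j \<cdot> i \<cdot> \<nu> \<cdot> Var) (app_eq (Var 4) (Var 3) (Var 1) \<^bold>\<longrightarrow> app_eq (Var 4) (Var 2) (Var 0) \<^bold>\<longrightarrow>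
        Var 1 \<simeq> Var 0 \<^bold>\<longrightarrow> Var 3 \<^bold>= Var 2)"
      using that(1) unfolding \<phi>_def by (blast intro: frc_spec)
    from frc_mp[OF frc_mp[OF frc_mp[OF this]]] show ?thesis using that(2-) by (simp add: eval_nat_numeral)
  qed
  have "frc w (i \<cdot> \<nu> \<cdot> Var) \<phi>"
  proof (rule HA_induct)
    show "frc w (Zero \<cdot> \<nu> \<cdot> Var) \<phi>"
    proof (rule \<phi>I)
      fix j a b v assume v: "w \<sqsubseteq> v" and a: "v |- app_eq \<nu> Zero a" and b: "v |- app_eq \<nu> j b" and eq: "v |- a \<simeq> b"
      show "v |- Zero \<^bold>= j"
      proof (rule LocE[OF nat_cases[of v j]], elim disjE exE)
        fix u assume "u |- j \<^bold>= Zero" then show "u |- Zero \<^bold>= j" by (rule eq_sym)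
      next
        fix u j' assume u: "v \<sqsubseteq> u" and j: "u |- j \<^bold>= Succ j'"
        have \<nu>u: "numerals u \<nu>" by (rule numerals_mono[OF \<nu>]) (use v u in blast)
        show "u |- Zero \<^bold>= j"
        proof (rule LocE[OF numerals_total[OF \<nu>u, of j']], elim exE conjE)
          fix t c assume t: "u \<sqsubseteq> t" and c: "t |- app_eq \<nu> j' c" "t |- Vset c"
          have vt: "v \<sqsubseteq> t" using u t by blast
          note \<nu>t = numerals_mono[OF \<nu>u t]
          have b': "t |- app_eq \<nu> (Succ j') b" by (rule app_subst2[OF mono[OF j t] mono[OF b vt]])
          note V = numerals_Vset[OF \<nu>t mono[OF a vt]] numerals_Vset[OF \<nu>t b']
          have "t |- mem c a"
            by (rule mem_cong_right[OF c(2) V(2,1) ext_sym[OF V mono[OF eq vt]] numerals_mem_Succ_self[OF \<nu>t c(1) b']])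
          from this[unfolded mem_iff] have "t |- Bot"
            by (rule LocE) (meson a mono numerals_Zero numerals_mono[OF \<nu>t] vt order_trans)
          then show "t |- Zero \<^bold>= j" by (rule prov.BotE)
        qed
      qed
    qed
  next
    fix w' i assume w': "w \<sqsubseteq> w'" and IH: "frc w' (i \<cdot> \<nu> \<cdot> Var) \<phi>"
    show "frc w' (Succ i \<cdot> \<nu> \<cdot> Var) \<phi>"
    proof (rule \<phi>I)
      fix j a b v assume v: "w' \<sqsubseteq> v" and a: "v |- app_eq \<nu> (Succ i) a" and b: "v |- app_eq \<nu> j b" and eq: "v |- a \<simeq> b"
      have \<nu>v: "numerals v \<nu>" by (rule numerals_mono[OF \<nu>]) (use w' v in blast)
      show "v |- Succ i \<^bold>= j"
      proof (rule LocE[OF numerals_total[OF \<nu>v, of i]], elim exE conjE)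
        fix u a0 assume u: "v \<sqsubseteq> u" and a0: "u |- app_eq \<nu> i a0" "u |- Vset a0"
        note \<nu>u = numerals_mono[OF \<nu>v u]
        note V = numerals_Vset[OF \<nu>u mono[OF a u]] numerals_Vset[OF \<nu>u mono[OF b u]]
        have a0b: "u |- mem a0 b"
          by (rule mem_cong_right[OF a0(2) V mono[OF eq u] numerals_mem_Succ_self[OF \<nu>u a0(1) mono[OF a u]]])
        show "u |- Succ i \<^bold>= j"
        proof (rule LocE[OF nat_cases[of u j]], elim disjE exE)
          fix t assume t: "u \<sqsubseteq> t" and j: "t |- j \<^bold>= Zero"
          have "t |- app_eq \<nu> Zero b" by (rule app_subst2[OF j mono[OF b]]) (use u t in blast)
          note Z = numerals_Zero[OF numerals_mono[OF \<nu>u] mono[OF this]]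
          from mono[OF a0b t, unfolded mem_iff] have "t |- Bot"
            by (rule LocE) (use Z t in blast)
          then show "t |- Succ i \<^bold>= j" by (rule prov.BotE)
        next
          fix t j' assume t: "u \<sqsubseteq> t" and j: "t |- j \<^bold>= Succ j'"
          note \<nu>t = numerals_mono[OF \<nu>u t]
          show "t |- Succ i \<^bold>= j"
          proof (rule LocE[OF numerals_total[OF \<nu>t, of j']], elim exE conjE)
            fix s b0 assume s: "t \<sqsubseteq> s" and b0: "s |- app_eq \<nu> j' b0" "s |- Vset b0"
            have us: "u \<sqsubseteq> s" and vs: "v \<sqsubseteq> s" and ws: "w' \<sqsubseteq> s" using v u t s by blast+
            note \<nu>s = numerals_mono[OF \<nu>t s] and a' = mono[OF a vs] and a0s = a0[THEN mono, OF us]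
            have b': "s |- app_eq \<nu> (Succ j') b" by (rule app_subst2[OF mono[OF j s] mono[OF b vs]])
            have b0a: "s |- mem b0 a"
              by (rule mem_cong_right[OF b0(2) V(2,1)[THEN mono, OF us]
                ext_sym[OF V[THEN mono, OF us] mono[OF eq vs]] numerals_mem_Succ_self[OF \<nu>s b0(1) b']])
            have goal: "r |- Succ i \<^bold>= j" if r: "s \<sqsubseteq> r" and e: "r |- a0 \<simeq> b0" for r
            proof -
              have "r |- i \<^bold>= j'"
                by (rule \<phi>D[OF frc_mono[OF IH] mono[OF a0s(1) r] mono[OF b0(1) r] e]) (use ws r in blast)
              from eq_trans[OF Succ_cong[OF this] eq_sym[OF mono[OF j]]] show ?thesis
                using s r by blast
            qed
            show "s |- Succ i \<^bold>= j"
            proof (rule LocE[OF numerals_mem_Succ[OF \<nu>s b0(1) b' mono[OF a0b us]]], elim disjE)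
              fix r assume "s \<sqsubseteq> r" "r |- a0 \<simeq> b0" then show "r |- Succ i \<^bold>= j" by (rule goal)
            next
              fix r assume r: "s \<sqsubseteq> r" and m: "r |- mem a0 b0"
              note V0 = mono[OF a0s(2) r] mono[OF b0(2) r]
              show "r |- Succ i \<^bold>= j"
              proof (rule LocE[OF numerals_mem_Succ[OF numerals_mono[OF \<nu>s r] mono[OF a0s(1) r] mono[OF a' r] mono[OF b0a r]]],
                  elim disjE)
                fix q assume q: "r \<sqsubseteq> q" and "q |- mem b0 a0"
                with no_two_cycle[OF V0[THEN mono, OF q] mono[OF m q]] have "q |- Bot" by blast
                then show "q |- Succ i \<^bold>= j" by (rule prov.BotE)
              next
                fix q assume q: "r \<sqsubseteq> q" and "q |- b0 \<simeq> a0"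
                from ext_sym[OF V0(2,1)[THEN mono, OF q] this(2)] show "q |- Succ i \<^bold>= j"
                  by (intro goal) (use r q in blast)
              qed
            qed
          qed
        qed
      qed
    qed
  qed
  from \<phi>D[OF this ab] show ?thesis .
qed

section \<open>The set of natural numbers\<close>

definition succ_at :: "fm list \<Rightarrow> trm \<Rightarrow> trm \<Rightarrow> bool" where
  "succ_at w x y \<longleftrightarrow> (\<forall>a v. w \<sqsubseteq> v --> v |- in_EL a y --> Loc v (\<lambda>u. u |- mem a x \<or> u |- a \<simeq> x)) \<and>
    sub_at w x y \<and> w |- mem x y"

definition inductive_at :: "fm list \<Rightarrow> trm \<Rightarrow> bool" where
  "inductive_at w x \<longleftrightarrow>
    Loc w (\<lambda>v. \<exists>a. v |- in_EL a x \<and> (\<forall>b u. v \<sqsubseteq> u --> u |- in_EL b a --> u |- Bot)) \<and>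
    (\<forall>a v. w \<sqsubseteq> v --> v |- in_EL a x --> Loc v (\<lambda>u. \<exists>b. u |- in_EL b x \<and> succ_at u a b))"

definition omega_at :: "fm list \<Rightarrow> trm \<Rightarrow> bool" where
  "omega_at w x \<longleftrightarrow> inductive_at w x \<and>
    (\<forall>z v. w \<sqsubseteq> v --> v |- Vset z --> (\<forall>u. v \<sqsubseteq> u --> inductive_at u z --> sub_at u x z))"

definition power_at :: "fm list \<Rightarrow> trm \<Rightarrow> trm \<Rightarrow> bool" where
  "power_at w x P \<longleftrightarrow> (\<forall>y v. w \<sqsubseteq> v --> v |- Vset y -->
    (\<forall>u. v \<sqsubseteq> u --> (u |- mem y P \<longleftrightarrow> sub_at u y x)))"

section \<open>Forcing clauses of the set-theoretic formulas\<close>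

lemma frc_SMem [simp]: "frc w \<rho> (interp E (SMem x y)) \<longleftrightarrow> w |- mem (\<rho> x) (\<rho> y)"
  by (simp add: mem_iff)

lemma frc_s_subset: "frc w \<rho> (interp E (s_subset x y)) \<longleftrightarrow> sub_at w (\<rho> x) (\<rho> y)"
  unfolding s_subset_def sub_at_def by (simp add: frc_Imp mem_iff cong del: imp_cong)

lemma frc_s_succ: "frc w \<rho> (interp E (s_succ x y)) \<longleftrightarrow> succ_at w (\<rho> x) (\<rho> y)"
  unfolding s_succ_def succ_at_def by (simp add: frc_Imp frc_s_subset mem_iff cong del: imp_cong)

lemma frc_s_inductive: "frc w \<rho> (interp E (s_inductive x)) \<longleftrightarrow> inductive_at w (\<rho> x)"
  unfolding s_inductive_def inductive_at_def s_empty_def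
  by (simp add: frc_Imp frc_s_succ cong del: imp_cong)

lemma frc_s_omega: "frc w \<rho> (interp E (s_omega x)) \<longleftrightarrow> omega_at w (\<rho> x)"
  unfolding s_omega_def omega_at_def
  by (simp add: frc_Imp frc_s_inductive frc_s_subset cong del: imp_cong)

lemma frc_s_has_power: "frc w \<rho> (interp E (s_has_power x)) \<longleftrightarrow>
  Loc w (\<lambda>v. \<exists>P. v |- Vset P \<and> power_at v (\<rho> x) P)"
proof -
  have "frc v (y \<cdot> P \<cdot> \<rho>) (interp E (SIff (SMem 0 1) (s_subset 0 (x + 2)))) \<longleftrightarrow>
      (\<forall>u. v \<sqsubseteq> u --> (u |- mem y P \<longleftrightarrow> sub_at u y (\<rho> x)))" for v y P
    unfolding interp.simps(4,6) frc_Iff frc_SMem frc_s_subset by simp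
  then show ?thesis
    unfolding s_has_power_def power_at_def by (simp add: frc_Imp del: interp.simps(4) cong del: imp_cong)
qed

text \<open>Weakening is inherited from the formula whose forcing clause this is.\<close>

lemma inductive_at_mono: "inductive_at w x ==> w \<sqsubseteq> v ==> inductive_at v x"
  using frc_mono[of w "x \<cdot> Var" "interp E (s_inductive 0)" v] by (simp add: frc_s_inductive)

lemma succ_at_mono: "succ_at w x y ==> w \<sqsubseteq> v ==> succ_at v x y"
  using frc_mono[of w "x \<cdot> y \<cdot> Var" "interp E (s_succ 0 1)" v] by (simp add: frc_s_succ)

lemma omega_at_mono: "omega_at w x ==> w \<sqsubseteq> v ==> omega_at v x"
  using frc_mono[of w "x \<cdot> Var" "interp E (s_omega 0)" v] by (simp add: frc_s_omega)

lemma power_at_mono: "power_at w x P ==> w \<sqsubseteq> v ==> power_at v x P"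
  unfolding power_at_def by (meson order_trans)

text \<open>Applied in both directions this shows that successors are unique up to
  \<open>\<simeq>\<close>, which carries the comparison of the numerals with an arbitrary inductive
  set.\<close>

lemma succ_at_sub:
  assumes V: "w |- Vset a" "w |- Vset a'" "w |- Vset b" "w |- Vset b'"
    and s: "succ_at w a a'" "succ_at w b b'" and eq: "w |- a \<simeq> b"
  shows "sub_at w a' b'"
  unfolding sub_at_def
proof (intro allI impI)
  fix c v assume v: "w \<sqsubseteq> v" and c: "v |- in_EL c a'"
  with s(1) have "Loc v (\<lambda>u. u |- mem c a \<or> u |- c \<simeq> a)" unfolding succ_at_def by blast
  then show "v |- mem c b'"
  proof (rule LocE)
    fix u assume u: "v \<sqsubseteq> u" and *: "u |- mem c a \<or> u |- c \<simeq> a"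
    have wu: "w \<sqsubseteq> u" using v u by blast
    note V = V[THEN mono, OF wu] and eq = mono[OF eq wu] and s = succ_at_mono[OF s(2) wu, unfolded succ_at_def]
    have Vc: "u |- Vset c" by (rule in_EL_Vset[OF V(2) mono[OF c u]])
    from * show "u |- mem c b'"
    proof
      assume "u |- mem c a"
      then have "u |- mem c b" by (rule mem_cong_right[OF Vc V(1,3) eq])
      then show ?thesis using s by (blast intro: mem_sub[OF Vc V(3,4)])
    next
      assume "u |- c \<simeq> a"
      then have "u |- c \<simeq> b" using eq by (rule ext_trans[OF Vc V(1,3)])
      then show ?thesis using s by (blast intro: mem_cong_left[OF V(3) Vc V(4)])
    qed
  qed
qed

lemma numerals_succ_at:
  assumes \<nu>: "numerals w \<nu>" and a: "w |- app_eq \<nu> k a" "w |- app_eq \<nu> (Succ k) a'"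
  shows "succ_at w a a'"
  unfolding succ_at_def
proof (intro conjI allI impI)
  show "w |- mem a a'" by (rule numerals_mem_Succ_self[OF \<nu> a])
  show "sub_at w a a'"
    unfolding sub_at_def
  proof (intro allI impI)
    fix c v assume v: "w \<sqsubseteq> v" and c: "v |- in_EL c a"
    note \<nu>' = numerals_mono[OF \<nu> v] and a = a[THEN mono, OF v]
    have "v |- in_EL c a'" unfolding numerals_Succ[OF \<nu>' a] using c by (rule prov.OrI2)
    then show "v |- mem c a'" by (rule in_EL_mem[OF numerals_Vset[OF \<nu>' a(2)]])
  qed
next
  fix c v assume v: "w \<sqsubseteq> v" and c: "v |- in_EL c a'"
  note \<nu>' = numerals_mono[OF \<nu> v] and a = a[THEN mono, OF v]
  show "Loc v (\<lambda>u. u |- mem c a \<or> u |- c \<simeq> a)"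
    by (rule numerals_mem_Succ[OF \<nu>' a in_EL_mem[OF numerals_Vset[OF \<nu>' a(2)] c]])
qed

text \<open>Closure under successor is immediate from \<open>\<nu>\<close>. For leastness, induction
  on \<open>n\<close> shows that the value of \<open>\<nu>\<close> at \<open>n\<close> belongs, up
  to \<open>\<simeq>\<close>, to every inductive set.\<close>

lemma omega_at_numerals:
  assumes \<nu>: "numerals w \<nu>" and x: "w |- Vset x"
    and EL: "\<And>u b. w \<sqsubseteq> u ==> u |- in_EL b x \<longleftrightarrow> Loc u (\<lambda>t. \<exists>n. t |- app_eq \<nu> n b)"
  shows "omega_at w x"
proof -
  have EL_I: "u |- in_EL b x" if "w \<sqsubseteq> u" "u |- app_eq \<nu> n b" for u n b
    unfolding EL[OF that(1)] using that(2) by (blast intro: LocI)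
  have "inductive_at w x"
    unfolding inductive_at_def
  proof (intro conjI allI impI)
    show "Loc w (\<lambda>v. \<exists>a. v |- in_EL a x \<and> (\<forall>b u. v \<sqsubseteq> u --> u |- in_EL b a --> u |- Bot))"
    proof (rule Loc_map[OF numerals_total[OF \<nu>, of Zero]], elim exE conjE)
      fix v a assume v: "w \<sqsubseteq> v" and a: "v |- app_eq \<nu> Zero a"
      have "u |- Bot" if "v \<sqsubseteq> u" "u |- in_EL b a" for u b
        by (rule numerals_Zero[OF numerals_mono[OF \<nu>] mono[OF a that(1)] that(2)]) (use v that in blast)
      with EL_I[OF v a] show "\<exists>a. v |- in_EL a x \<and> (\<forall>b u. v \<sqsubseteq> u --> u |- in_EL b a --> u |- Bot)" by blast
    qed
  next
    fix a v assume v: "w \<sqsubseteq> v" and "v |- in_EL a x"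
    then have "Loc v (\<lambda>t. \<exists>n. t |- app_eq \<nu> n a)" using EL by blast
    then show "Loc v (\<lambda>u. \<exists>b. u |- in_EL b x \<and> succ_at u a b)"
    proof (rule Loc_bind, elim exE)
      fix u n assume u: "v \<sqsubseteq> u" and a: "u |- app_eq \<nu> n a"
      have wu: "w \<sqsubseteq> u" using v u by blast
      show "Loc u (\<lambda>u. \<exists>b. u |- in_EL b x \<and> succ_at u a b)"
      proof (rule Loc_map[OF numerals_total[OF numerals_mono[OF \<nu> wu], of "Succ n"]], elim exE conjE)
        fix t b assume t: "u \<sqsubseteq> t" and b: "t |- app_eq \<nu> (Succ n) b"
        have wt: "w \<sqsubseteq> t" using wu t by blast
        from numerals_succ_at[OF numerals_mono[OF \<nu> wt] mono[OF a t] b] EL_I[OF wt b]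
        show "\<exists>b. t |- in_EL b x \<and> succ_at t a b" by blast
      qed
    qed
  qed
  moreover have "sub_at u x z" if wu: "w \<sqsubseteq> u" and Vz: "u |- Vset z" and z: "inductive_at u z" for u z
  proof -
    define \<phi> where "\<phi> = All (app_eq (Var 2) (Var 1) (Var 0) \<^bold>\<longrightarrow> mem (Var 0) (Var 3))"
    have \<phi>_iff: "frc v (n \<cdot> \<nu> \<cdot> z \<cdot> Var) \<phi> \<longleftrightarrow> (\<forall>a t. v \<sqsubseteq> t --> t |- app_eq \<nu> n a --> t |- mem a z)" for v n
      unfolding \<phi>_def by (simp add: frc_Imp eval_nat_numeral cong del: imp_cong)
    have \<phi>: "frc u (n \<cdot> \<nu> \<cdot> z \<cdot> Var) \<phi>" for n
    proof (rule HA_induct)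
      show "frc u (Zero \<cdot> \<nu> \<cdot> z \<cdot> Var) \<phi>"
        unfolding \<phi>_iff
      proof (intro allI impI)
        fix a t assume t: "u \<sqsubseteq> t" and a: "t |- app_eq \<nu> Zero a"
        have \<nu>t: "numerals t \<nu>" by (rule numerals_mono[OF \<nu>]) (use wu t in blast)
        have "Loc t (\<lambda>v. \<exists>a. v |- in_EL a z \<and> (\<forall>b u. v \<sqsubseteq> u --> u |- in_EL b a --> u |- Bot))"
          using inductive_at_mono[OF z t] unfolding inductive_at_def by blast
        then show "t |- mem a z"
        proof (rule LocE, elim exE conjE)
          fix s c assume s: "t \<sqsubseteq> s" and c: "s |- in_EL c z" "\<forall>b r. s \<sqsubseteq> r --> r |- in_EL b c --> r |- Bot"
          note \<nu>s = numerals_mono[OF \<nu>t s] and as = mono[OF a s]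
          have Vc: "s |- Vset c" by (rule in_EL_Vset[OF mono[OF Vz] c(1)]) (use t s in blast)
          have "sub_at s a c" "sub_at s c a"
            unfolding sub_at_def using c(2) numerals_Zero[OF numerals_mono[OF \<nu>s] mono[OF as]]
            by (blast intro: prov.BotE)+
          then have "s |- a \<simeq> c" using ext_eq_iff[OF numerals_Vset[OF \<nu>s as] Vc] by blast
          with c(1) show "s |- mem a z" by (rule memI)
        qed
      qed
    next
      fix v n assume v: "u \<sqsubseteq> v" and IH: "frc v (n \<cdot> \<nu> \<cdot> z \<cdot> Var) \<phi>"
      show "frc v (Succ n \<cdot> \<nu> \<cdot> z \<cdot> Var) \<phi>"
        unfolding \<phi>_iff
      proof (intro allI impI)
        fix a' t assume t: "v \<sqsubseteq> t" and a': "t |- app_eq \<nu> (Succ n) a'"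
        have \<nu>t: "numerals t \<nu>" by (rule numerals_mono[OF \<nu>]) (use wu v t in blast)
        show "t |- mem a' z"
        proof (rule LocE[OF numerals_total[OF \<nu>t, of n]], elim exE conjE)
          fix s a assume s: "t \<sqsubseteq> s" and a: "s |- app_eq \<nu> n a"
          have "v \<sqsubseteq> s" using t s by blast
          with IH a have "s |- mem a z" unfolding \<phi>_iff by blast
          from this[unfolded mem_iff] show "s |- mem a' z"
          proof (rule LocE, elim exE conjE)
            fix r b assume r: "s \<sqsubseteq> r" and b: "r |- in_EL b z" "r |- a \<simeq> b"
            have ur: "u \<sqsubseteq> r" using v t s r by blast
            have "Loc r (\<lambda>u. \<exists>d. u |- in_EL d z \<and> succ_at u b d)"
              using inductive_at_mono[OF z ur] b(1) unfolding inductive_at_def by blast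
            then show "r |- mem a' z"
            proof (rule LocE, elim exE conjE)
              fix q d assume q: "r \<sqsubseteq> q" and d: "q |- in_EL d z" "succ_at q b d"
              have tq: "t \<sqsubseteq> q" and sq: "s \<sqsubseteq> q" and uq: "u \<sqsubseteq> q" using s r q ur by blast+
              note \<nu>q = numerals_mono[OF \<nu>t tq] and a = mono[OF a sq] and a' = mono[OF a' tq]
              note Va = numerals_Vset[OF \<nu>q a] and Va' = numerals_Vset[OF \<nu>q a']
                and Vb = in_EL_Vset[OF mono[OF Vz uq] mono[OF b(1) q]] and Vd = in_EL_Vset[OF mono[OF Vz uq] d(1)]
                and sa = numerals_succ_at[OF \<nu>q a a'] and eq = mono[OF b(2) q]
              \<comment> \<open>The successor \<open>d\<close> that \<open>z\<close> provides for
                \<open>b \<simeq> a\<close> coincides with the next numeral.\<close>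
              have "q |- a' \<simeq> d"
                unfolding ext_eq_iff[OF Va' Vd]
                using succ_at_sub[OF Va Va' Vb Vd sa d(2) eq] succ_at_sub[OF Vb Vd Va Va' d(2) sa ext_sym[OF Va Vb eq]]
                by blast
              with d(1) show "q |- mem a' z" by (rule memI)
            qed
          qed
        qed
      qed
    qed
    show "sub_at u x z"
      unfolding sub_at_def
    proof (intro allI impI)
      fix a v assume v: "u \<sqsubseteq> v" and "v |- in_EL a x"
      moreover have "w \<sqsubseteq> v" using wu v by blast
      ultimately have "Loc v (\<lambda>t. \<exists>n. t |- app_eq \<nu> n a)" using EL by blast
      then show "v |- mem a z"
        by (rule LocE) (use \<phi>[unfolded \<phi>_iff] v in blast)
    qed
  qed
  ultimately show ?thesis
    unfolding omega_at_def by (meson mono order_trans)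
qed

lemma omega_exists: "Loc w (\<lambda>v. \<exists>\<nu> x. numerals v \<nu> \<and> v |- Vset x \<and> omega_at v x \<and>
  (\<forall>u b. v \<sqsubseteq> u --> (u |- in_EL b x \<longleftrightarrow> Loc u (\<lambda>t. \<exists>n. t |- app_eq \<nu> n b))))"
proof (rule Loc_bind[OF numerals_exist], elim exE)
  fix v \<nu> assume \<nu>: "numerals v \<nu>"
  have "Loc v (\<lambda>v. \<exists>y. v |- Vset y \<and> (\<forall>u b. v \<sqsubseteq> u -->
      (u |- in_EL b y \<longleftrightarrow> Loc u (\<lambda>t. \<exists>n. t |- app_eq \<nu> n b \<and> frc t (n \<cdot> Var) (Zero \<^bold>= Zero)))))"
    by (rule numeral_set_exists[OF \<nu>]) (use repr_True in \<open>auto simp: prov.EqRefl intro!: LocI\<close>)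
  then show "Loc v (\<lambda>v. \<exists>\<nu> x. numerals v \<nu> \<and> v |- Vset x \<and> omega_at v x \<and>
    (\<forall>u b. v \<sqsubseteq> u --> (u |- in_EL b x \<longleftrightarrow> Loc u (\<lambda>t. \<exists>n. t |- app_eq \<nu> n b))))"
  proof (rule Loc_map, elim exE conjE)
    fix u x assume u: "v \<sqsubseteq> u" and x: "u |- Vset x" and "\<forall>t b. u \<sqsubseteq> t -->
      (t |- in_EL b x \<longleftrightarrow> Loc t (\<lambda>s. \<exists>n. s |- app_eq \<nu> n b \<and> frc s (n \<cdot> Var) (Zero \<^bold>= Zero)))"
    then have EL: "t |- in_EL b x \<longleftrightarrow> Loc t (\<lambda>s. \<exists>n. s |- app_eq \<nu> n b)" if "u \<sqsubseteq> t" for t b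
      using that by (simp add: prov.EqRefl)
    note \<nu>u = numerals_mono[OF \<nu> u]
    from omega_at_numerals[OF \<nu>u x EL] \<nu>u x EL
    show "\<exists>\<nu> x. numerals u \<nu> \<and> u |- Vset x \<and> omega_at u x \<and>
      (\<forall>t b. u \<sqsubseteq> t --> (t |- in_EL b x \<longleftrightarrow> Loc t (\<lambda>t. \<exists>n. t |- app_eq \<nu> n b)))" by blast
  qed
qed


section \<open>The diagonal argument\<close>

lemma frc_BotE: "w |- Bot ==> frc w \<rho> \<phi>"
  unfolding frc_def by (rule prov.BotE)

text \<open>
  Equality with a fixed numeral is a decidable condition on elements of a subset of \<open>\<omega>\<close>, although
  extensional equality of v-sets is not a condition in general.
\<close>

lemma repr_not_mem:
  assumes \<nu>: "numerals w \<nu>" and x: "w |- Vset x" and a: "w |- app_eq \<nu> k a"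
    and sub: "\<And>v b. w \<sqsubseteq> v ==> v |- in_EL b x ==> Loc v (\<lambda>u. \<exists>i c. u |- app_eq \<nu> i c \<and> u |- b \<simeq> c)"
  shows "Loc w (\<lambda>v. \<exists>c. repr v c (\<lambda>u. \<forall>t. u \<sqsubseteq> t --> t |- mem a x --> t |- Bot))"
proof -
  define \<rho> where "\<rho> = x \<cdot> a \<cdot> Var"
  define \<alpha> where "\<alpha> = at_app (Var 1) (Var 0) (Tr (eR (Var 0)))"
  \<comment> \<open>With \<open>\<alpha>(j)\<close> saying that \<open>cd_x(j)\<close> is true and
    \<open>\<beta>(j)\<close> that \<open>el_x(j)\<close> differs from \<open>a\<close>,
    non-membership of \<open>a\<close> in \<open>x\<close> becomes a bounded universal
    implication.\<close>
  define \<beta> where "\<beta> = All (app_eq (Var 2) (Var 1) (Var 0) \<^bold>\<longrightarrow> eL (Var 0) \<simeq> Var 3 \<^bold>\<longrightarrow> Bot)"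
  have \<alpha>_iff: "frc u (j \<cdot> \<rho>) \<alpha> \<longleftrightarrow> Loc u (\<lambda>v. \<exists>p. v |- app_eq x j p \<and> v |- Tr (eR p))" for u j
    unfolding \<alpha>_def \<rho>_def by simp
  have \<beta>_iff: "frc u (j \<cdot> \<rho>) \<beta> \<longleftrightarrow> (\<forall>p t. u \<sqsubseteq> t --> t |- app_eq x j p -->
    (\<forall>s. t \<sqsubseteq> s --> s |- eL p \<simeq> a --> s |- Bot))" for u j
    unfolding \<beta>_def \<rho>_def by (simp add: frc_Imp eval_nat_numeral cong del: imp_cong)
  note Va = numerals_Vset[OF \<nu> a]
  have "Loc w (\<lambda>v. \<exists>c. repr v c (\<lambda>u. frc u \<rho> (All (\<alpha> \<^bold>\<longrightarrow> \<beta>))))"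
  proof (rule repr_All)
    fix v j assume v: "w \<sqsubseteq> v"
    show "Loc v (\<lambda>v. \<exists>c. repr v c (\<lambda>u. frc u (j \<cdot> \<rho>) \<alpha>))"
      unfolding \<alpha>_iff by (rule repr_cd[OF mono[OF x v]])
  next
    fix v j assume v: "w \<sqsubseteq> v" and "frc v (j \<cdot> \<rho>) \<alpha>"
    from this(2)[unfolded \<alpha>_iff] show "Loc v (\<lambda>v. \<exists>c. repr v c (\<lambda>u. frc u (j \<cdot> \<rho>) \<beta>))"
    proof (rule Loc_bind, elim exE conjE)
      fix u p assume u: "v \<sqsubseteq> u" and p: "u |- app_eq x j p" "u |- Tr (eR p)"
      have wu: "w \<sqsubseteq> u" using v u by blast
      have z: "u |- in_EL (eL p) x" using p by (rule in_EL_I) (rule prov.EqRefl)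
      note Vz = in_EL_Vset[OF mono[OF x wu] z]
      show "Loc u (\<lambda>v. \<exists>c. repr v c (\<lambda>u. frc u (j \<cdot> \<rho>) \<beta>))"
      proof (rule Loc_bind[OF sub[OF wu z]], elim exE conjE)
        fix t i c assume t: "u \<sqsubseteq> t" and c: "t |- app_eq \<nu> i c" "t |- eL p \<simeq> c"
        have wt: "w \<sqsubseteq> t" using wu t by blast
        show "Loc t (\<lambda>v. \<exists>c. repr v c (\<lambda>u. frc u (j \<cdot> \<rho>) \<beta>))"
        \<comment> \<open>As \<open>el_x(j)\<close> equals the numeral at \<open>i\<close>,
          \<open>\<beta>(j)\<close> amounts to \<open>i\<close> being different from
          \<open>k\<close>. It is therefore represented by the false condition if
          \<open>i = k\<close> and, by injectivity of the numerals, by the true one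
          otherwise.\<close>
        proof (rule Loc_bind[OF eq_decidable[of t i k]], elim disjE)
          fix s assume s: "t \<sqsubseteq> s" and ik: "s |- i \<^bold>= k"
          have us: "u \<sqsubseteq> s" and ws: "w \<sqsubseteq> s" using t s wu by blast+
          have "s |- c \<^bold>= a" by (rule app_fun[OF app_subst2[OF ik mono[OF c(1) s]] mono[OF a ws]])
          from rel_subst2[OF this mono[OF c(2) s]] have za: "s |- eL p \<simeq> a" .
          have "r |- Bot \<longleftrightarrow> frc r (j \<cdot> \<rho>) \<beta>" if r: "s \<sqsubseteq> r" for r
          proof
            assume \<beta>: "frc r (j \<cdot> \<rho>) \<beta>"
            have "r |- app_eq x j p" by (rule mono[OF p(1)]) (use us r in blast)
            with \<beta> mono[OF za r] show "r |- Bot" unfolding \<beta>_iff by blast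
          qed (rule frc_BotE)
          then have "repr r c (\<lambda>u. frc u (j \<cdot> \<rho>) \<beta>)" if "s \<sqsubseteq> r" "repr r c (\<lambda>u. u |- Bot)" for r c
            using that(1) by (intro repr_cong[OF that(2)]) blast
          then show "Loc s (\<lambda>v. \<exists>c. repr v c (\<lambda>u. frc u (j \<cdot> \<rho>) \<beta>))"
            by (intro Loc_map[OF repr_False]) blast
        next
          fix s assume s: "t \<sqsubseteq> s" and ik: "\<forall>r. s \<sqsubseteq> r --> r |- i \<^bold>= k --> r |- Bot"
          have "frc r (j \<cdot> \<rho>) \<beta>" if r: "s \<sqsubseteq> r" for r
            unfolding \<beta>_iff
          proof (intro allI impI)
            fix q r1 r2 assume r1: "r \<sqsubseteq> r1" and q: "r1 |- app_eq x j q" and r2: "r1 \<sqsubseteq> r2" and qa: "r2 |- eL q \<simeq> a"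
            have le: "u \<sqsubseteq> r2" "t \<sqsubseteq> r2" "w \<sqsubseteq> r2" "s \<sqsubseteq> r2" using t s r r1 r2 wu by blast+
            note \<nu>2 = numerals_mono[OF \<nu> le(3)] and c2 = c[THEN mono, OF le(2)] and a2 = mono[OF a le(3)]
            have "r2 |- eL q \<^bold>= eL p" by (rule eL_cong[OF app_fun[OF mono[OF q r2] mono[OF p(1) le(1)]]])
            from rel_subst1[OF this qa] have pa: "r2 |- eL p \<simeq> a" .
            note V = numerals_Vset[OF \<nu>2 c2(1)] mono[OF Vz le(1)] mono[OF Va le(3)]
            have "r2 |- c \<simeq> a" by (rule ext_trans[OF V ext_sym[OF V(2,1) c2(2)] pa])
            from numerals_inject[OF \<nu>2 c2(1) a2 this] ik le(4) show "r2 |- Bot" by blast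
          qed
          then have "repr s (Fn Xi [und, und]) (\<lambda>u. frc u (j \<cdot> \<rho>) \<beta>)"
            by (intro repr_cong[OF repr_True]) blast
          then show "Loc s (\<lambda>v. \<exists>c. repr v c (\<lambda>u. frc u (j \<cdot> \<rho>) \<beta>))" by (blast intro: LocI)
        qed
      qed
    qed
  qed
  moreover have "frc u \<rho> (All (\<alpha> \<^bold>\<longrightarrow> \<beta>)) \<longleftrightarrow> (\<forall>t. u \<sqsubseteq> t --> t |- mem a x --> t |- Bot)" if wu: "w \<sqsubseteq> u" for u
  proof
    assume all: "frc u \<rho> (All (\<alpha> \<^bold>\<longrightarrow> \<beta>))"
    show "\<forall>t. u \<sqsubseteq> t --> t |- mem a x --> t |- Bot"
    proof (intro allI impI)
      fix t assume t: "u \<sqsubseteq> t" and m: "t |- mem a x"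
      from m[unfolded mem_iff] show "t |- Bot"
      proof (rule LocE, elim exE conjE)
        fix s b assume s: "t \<sqsubseteq> s" and b: "s |- in_EL b x" "s |- a \<simeq> b"
        have ws: "w \<sqsubseteq> s" using wu t s by blast
        note Vb = in_EL_Vset[OF mono[OF x ws] b(1)]
        have ba: "s |- b \<simeq> a" by (rule ext_sym[OF mono[OF Va ws] Vb b(2)])
        from b(1) show "s |- Bot"
        proof (rule in_EL_cases[rotated])
          fix r n p assume r: "s \<sqsubseteq> r" and p: "r |- app_eq x n p" "r |- Tr (eR p)" "r |- b \<^bold>= eL p"
          have ur: "u \<sqsubseteq> r" using t s r by blast
          have "frc r (n \<cdot> \<rho>) \<alpha>" unfolding \<alpha>_iff using p by (blast intro: LocI)
          from frc_mp[OF frc_spec[OF frc_mono[OF all ur]] this] rel_subst1[OF p(3) mono[OF ba r]] p(1)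
          show "r |- Bot" unfolding \<beta>_iff by blast
        qed
      qed
    qed
  next
    assume nm: "\<forall>t. u \<sqsubseteq> t --> t |- mem a x --> t |- Bot"
    show "frc u \<rho> (All (\<alpha> \<^bold>\<longrightarrow> \<beta>))"
      unfolding frc_All
    proof (intro allI frc_impI)
      fix j t assume t: "u \<sqsubseteq> t" and \<alpha>: "frc t (j \<cdot> \<rho>) \<alpha>"
      show "frc t (j \<cdot> \<rho>) \<beta>"
        unfolding \<beta>_iff
      proof (intro allI impI)
        fix p s r assume s: "t \<sqsubseteq> s" and p: "s |- app_eq x j p" and r: "s \<sqsubseteq> r" and eq: "r |- eL p \<simeq> a"
        have "t \<sqsubseteq> r" using s r by blast
        from frc_mono[OF \<alpha> this, unfolded \<alpha>_iff] show "r |- Bot"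
        proof (rule LocE, elim exE conjE)
          fix q p' assume q: "r \<sqsubseteq> q" and p': "q |- app_eq x j p'" "q |- Tr (eR p')"
          have le: "w \<sqsubseteq> q" "u \<sqsubseteq> q" "s \<sqsubseteq> q" using wu t s r q by blast+
          have EL: "q |- in_EL (eL p) x"
            using p' by (rule in_EL_I) (rule eL_cong[OF app_fun[OF mono[OF p le(3)] p'(1)]])
          note Vp = in_EL_Vset[OF mono[OF x le(1)] EL]
          have "q |- mem a x" using EL ext_sym[OF Vp mono[OF Va le(1)] mono[OF eq q]] by (rule memI)
          with nm le(2) show "q |- Bot" by blast
        qed
      qed
    qed
  qed
  ultimately show ?thesis
  proof (elim Loc_map, elim exE)
    fix v c assume iff: "\<And>u. w \<sqsubseteq> u ==> frc u \<rho> (All (\<alpha> \<^bold>\<longrightarrow> \<beta>)) \<longleftrightarrow> (\<forall>t. u \<sqsubseteq> t --> t |- mem a x --> t |- Bot)"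
      and v: "w \<sqsubseteq> v" and c: "repr v c (\<lambda>u. frc u \<rho> (All (\<alpha> \<^bold>\<longrightarrow> \<beta>)))"
    have "repr v c (\<lambda>u. \<forall>t. u \<sqsubseteq> t --> t |- mem a x --> t |- Bot)"
      by (rule repr_cong[OF c iff]) (use v in blast)
    then show "\<exists>c. repr v c (\<lambda>u. \<forall>t. u \<sqsubseteq> t --> t |- mem a x --> t |- Bot)" by blast
  qed
qed

text \<open>Cantor's argument with \<open>\<omega>\<close> replaced by the range of
  \<open>\<nu>\<close>. Elements of members of \<open>P\<close> are numerals only up to
  \<open>\<simeq>\<close>, whereas \<open>all\<close> has to supply membership in \<open>P\<close>
  just for sets that enumerate numerals literally, as the diagonal set does.\<close>

lemma diagonal:
  assumes \<nu>: "numerals w \<nu>" and P: "w |- Vset P"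
    and sub: "\<And>v x b. w \<sqsubseteq> v ==> v |- in_EL x P ==> v |- in_EL b x ==>
      Loc v (\<lambda>u. \<exists>i c. u |- app_eq \<nu> i c \<and> u |- b \<simeq> c)"
    and all: "\<And>v y. w \<sqsubseteq> v ==> v |- Vset y ==>
      (\<And>u b. v \<sqsubseteq> u ==> u |- in_EL b y ==> Loc u (\<lambda>t. \<exists>n. t |- app_eq \<nu> n b)) ==> v |- mem y P"
  shows "w |- Bot"
proof -
  define \<rho> where "\<rho> = P \<cdot> \<nu> \<cdot> Var"
  \<comment> \<open>Variable \<open>0\<close> is a dummy \<open>m\<close> on which neither
    \<open>\<alpha>\<close> nor \<open>\<beta>\<close> depends: \<open>\<Xi>\<close> represents
    universally quantified implications, so a plain implication is written with a vacuous
    quantifier.\<close>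
  define \<alpha> where "\<alpha> = at_app (Var 2) (Var 1) (Tr (eR (Var 0)))"
  define \<beta> where "\<beta> = All (All (app_eq (Var 4) (Var 3) (Var 1) \<^bold>\<longrightarrow> app_eq (Var 5) (Var 3) (Var 0) \<^bold>\<longrightarrow>
    mem (Var 0) (eL (Var 1)) \<^bold>\<longrightarrow> Bot))"
  have \<alpha>_iff: "frc u (m \<cdot> n \<cdot> \<rho>) \<alpha> \<longleftrightarrow> Loc u (\<lambda>v. \<exists>p. v |- app_eq P n p \<and> v |- Tr (eR p))" for u m n
    unfolding \<alpha>_def \<rho>_def by (simp add: eval_nat_numeral)
  have \<beta>_iff': "frc u (m \<cdot> n \<cdot> \<rho>) \<beta> \<longleftrightarrow> (\<forall>p a t. u \<sqsubseteq> t --> t |- app_eq P n p -->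
    (\<forall>s. t \<sqsubseteq> s --> s |- app_eq \<nu> n a --> (\<forall>r. s \<sqsubseteq> r --> r |- mem a (eL p) --> r |- Bot)))" for u m n
    unfolding \<beta>_def \<rho>_def by (simp add: frc_Imp eval_nat_numeral cong del: imp_cong)
  have \<beta>_iff: "frc u (m \<cdot> n \<cdot> \<rho>) \<beta> \<longleftrightarrow> (\<forall>r. u \<sqsubseteq> r --> r |- mem a x --> r |- Bot)"
    if p: "u |- app_eq P n p" "u |- x \<^bold>= eL p" and a: "u |- app_eq \<nu> n a" for u m n p a x
  proof
    assume \<beta>: "frc u (m \<cdot> n \<cdot> \<rho>) \<beta>"
    show "\<forall>r. u \<sqsubseteq> r --> r |- mem a x --> r |- Bot"
    proof (intro allI impI)
      fix r assume r: "u \<sqsubseteq> r" and "r |- mem a x"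
      from mem_subst(2)[OF mono[OF p(2) r] this(2)] show "r |- Bot"
        using \<beta>[unfolded \<beta>_iff'] p(1) a r by blast
    qed
  next
    assume nm: "\<forall>r. u \<sqsubseteq> r --> r |- mem a x --> r |- Bot"
    show "frc u (m \<cdot> n \<cdot> \<rho>) \<beta>"
      unfolding \<beta>_iff'
    proof (intro allI impI)
      fix q b t s r assume t: "u \<sqsubseteq> t" and q: "t |- app_eq P n q" and s: "t \<sqsubseteq> s" and b: "s |- app_eq \<nu> n b"
        and r: "s \<sqsubseteq> r" and m: "r |- mem b (eL q)"
      have le: "u \<sqsubseteq> r" "t \<sqsubseteq> r" using t s r by blast+
      have "r |- b \<^bold>= a" by (rule app_fun[OF mono[OF b r] mono[OF a le(1)]])
      from mem_subst(1)[OF this m] have m: "r |- mem a (eL q)" .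
      have "r |- eL q \<^bold>= eL p" by (rule eL_cong[OF app_fun[OF mono[OF q le(2)] mono[OF p(1) le(1)]]])
      from mem_subst(2)[OF eq_trans[OF this eq_sym[OF mono[OF p(2) le(1)]]] m] nm le(1)
      show "r |- Bot" by blast
    qed
  qed
  have cond: "Loc v (\<lambda>v. \<exists>c. repr v c (\<lambda>u. frc u (n \<cdot> \<rho>) (All (\<alpha> \<^bold>\<longrightarrow> \<beta>))))" if wv: "w \<sqsubseteq> v" for v n
  proof (rule repr_All)
    fix u m assume u: "v \<sqsubseteq> u"
    have wu: "w \<sqsubseteq> u" using wv u by blast
    show "Loc u (\<lambda>v. \<exists>c. repr v c (\<lambda>u. frc u (m \<cdot> n \<cdot> \<rho>) \<alpha>))"
      unfolding \<alpha>_iff by (rule repr_cd[OF mono[OF P wu]])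
  next
    fix u m assume u: "v \<sqsubseteq> u" and "frc u (m \<cdot> n \<cdot> \<rho>) \<alpha>"
    from this(2)[unfolded \<alpha>_iff] show "Loc u (\<lambda>v. \<exists>c. repr v c (\<lambda>u. frc u (m \<cdot> n \<cdot> \<rho>) \<beta>))"
    proof (rule Loc_bind, elim exE conjE)
      fix t p assume t: "u \<sqsubseteq> t" and p: "t |- app_eq P n p" "t |- Tr (eR p)"
      have wt: "w \<sqsubseteq> t" using wv u t by blast
      have x: "t |- in_EL (eL p) P" using p by (rule in_EL_I) (rule prov.EqRefl)
      \<comment> \<open>The truth of \<open>cd_P(n)\<close> has been assumed, so
        \<open>el_P(n)\<close> is an element of \<open>P\<close>, hence a v-set of numerals, and
        \<open>repr_not_mem\<close> applies.\<close>
      show "Loc t (\<lambda>v. \<exists>c. repr v c (\<lambda>u. frc u (m \<cdot> n \<cdot> \<rho>) \<beta>))"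
      proof (rule Loc_bind[OF numerals_total[OF numerals_mono[OF \<nu> wt], of n]], elim exE conjE)
        fix s a assume s: "t \<sqsubseteq> s" and a: "s |- app_eq \<nu> n a"
        have ws: "w \<sqsubseteq> s" using wt s by blast
        have "Loc s (\<lambda>v. \<exists>c. repr v c (\<lambda>u. \<forall>r. u \<sqsubseteq> r --> r |- mem a (eL p) --> r |- Bot))"
        proof (rule repr_not_mem[OF numerals_mono[OF \<nu> ws] _ a])
          show "s |- Vset (eL p)" by (rule in_EL_Vset[OF mono[OF P ws] mono[OF x s]])
          show "Loc r (\<lambda>u. \<exists>i c. u |- app_eq \<nu> i c \<and> u |- b \<simeq> c)" if "s \<sqsubseteq> r" "r |- in_EL b (eL p)" for r b
            by (rule sub[OF _ mono[OF x] that(2)]) (use ws s that in blast)+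
        qed
        then show "Loc s (\<lambda>v. \<exists>c. repr v c (\<lambda>u. frc u (m \<cdot> n \<cdot> \<rho>) \<beta>))"
        proof (rule Loc_map, elim exE)
          fix r c assume r: "s \<sqsubseteq> r" and c: "repr r c (\<lambda>u. \<forall>r. u \<sqsubseteq> r --> r |- mem a (eL p) --> r |- Bot)"
          have "repr r c (\<lambda>u. frc u (m \<cdot> n \<cdot> \<rho>) \<beta>)"
          proof (rule repr_cong[OF c])
            fix q assume q: "r \<sqsubseteq> q"
            have "q |- app_eq P n p" by (rule mono[OF p(1)]) (use s r q in blast)
            moreover have "q |- app_eq \<nu> n a" by (rule mono[OF a]) (use r q in blast)
            ultimately show "(\<forall>r. q \<sqsubseteq> r --> r |- mem a (eL p) --> r |- Bot) \<longleftrightarrow> frc q (m \<cdot> n \<cdot> \<rho>) \<beta>"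
              using \<beta>_iff[OF _ prov.EqRefl] by blast
          qed
          then show "\<exists>c. repr r c (\<lambda>u. frc u (m \<cdot> n \<cdot> \<rho>) \<beta>)" by blast
        qed
      qed
    qed
  qed
  \<comment> \<open>The diagonal condition at \<open>n\<close>: if \<open>cd_P(n)\<close> is true,
    then \<open>\<nu>(n)\<close> is not a member of \<open>el_P(n)\<close>.\<close>
  define \<gamma> where "\<gamma> = All (\<alpha> \<^bold>\<longrightarrow> \<beta>)"
  have "Loc w (\<lambda>v. \<exists>y. v |- Vset y \<and> (\<forall>u b. v \<sqsubseteq> u -->
    (u |- in_EL b y \<longleftrightarrow> Loc u (\<lambda>t. \<exists>n. t |- app_eq \<nu> n b \<and> frc t (n \<cdot> \<rho>) \<gamma>))))"
    unfolding \<gamma>_def by (rule numeral_set_exists[OF \<nu> cond])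
  then show ?thesis
  proof (rule LocE, elim exE conjE)
    fix v y assume wv: "w \<sqsubseteq> v" and Vy: "v |- Vset y" and EL: "\<forall>u b. v \<sqsubseteq> u -->
      (u |- in_EL b y \<longleftrightarrow> Loc u (\<lambda>t. \<exists>n. t |- app_eq \<nu> n b \<and> frc t (n \<cdot> \<rho>) \<gamma>))"
    have "v |- mem y P"
    proof (rule all[OF wv Vy])
      fix u b assume "v \<sqsubseteq> u" "u |- in_EL b y"
      with EL have "Loc u (\<lambda>t. \<exists>n. t |- app_eq \<nu> n b \<and> frc t (n \<cdot> \<rho>) \<gamma>)" by blast
      then show "Loc u (\<lambda>t. \<exists>n. t |- app_eq \<nu> n b)" by (rule Loc_map) blast
    qed
    from this[unfolded mem_iff] show "v |- Bot"
    proof (rule LocE, elim exE conjE)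
      fix u x assume u: "v \<sqsubseteq> u" and x: "u |- in_EL x P" and yx: "u |- y \<simeq> x"
      have wu: "w \<sqsubseteq> u" using wv u by blast
      note Vx = in_EL_Vset[OF mono[OF P wu] x] and Vy = mono[OF Vy u]
      from x show "u |- Bot"
      proof (rule in_EL_cases[rotated])
        fix t n p assume t: "u \<sqsubseteq> t" and p: "t |- app_eq P n p" "t |- Tr (eR p)" "t |- x \<^bold>= eL p"
        have wt: "w \<sqsubseteq> t" using wu t by blast
        show "t |- Bot"
        proof (rule LocE[OF numerals_total[OF numerals_mono[OF \<nu> wt], of n]], elim exE conjE)
          fix s a assume s: "t \<sqsubseteq> s" and a: "s |- app_eq \<nu> n a" and Va: "s |- Vset a"
          have us: "u \<sqsubseteq> s" and vs: "v \<sqsubseteq> s" and ws: "w \<sqsubseteq> s" using u t s wu by blast+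
          note p = p[THEN mono, OF s] and Vx = mono[OF Vx us] and Vy = mono[OF Vy us] and yx = mono[OF yx us]
          have \<gamma>_iff: "frc r (n \<cdot> \<rho>) \<gamma> \<longleftrightarrow> (\<forall>q. r \<sqsubseteq> q --> q |- mem a x --> q |- Bot)" if r: "s \<sqsubseteq> r" for r
          proof -
            have \<alpha>: "frc q (m \<cdot> n \<cdot> \<rho>) \<alpha>" if "s \<sqsubseteq> q" for q m
              unfolding \<alpha>_iff using p[THEN mono, OF that] by (blast intro: LocI)
            have \<beta>: "frc q (m \<cdot> n \<cdot> \<rho>) \<beta> \<longleftrightarrow> (\<forall>r. q \<sqsubseteq> r --> r |- mem a x --> r |- Bot)" if "s \<sqsubseteq> q" for q m
              by (rule \<beta>_iff[OF p(1,3)[THEN mono, OF that] mono[OF a that]])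
            show ?thesis
              unfolding \<gamma>_def frc_All
            proof
              assume *: "\<forall>m. frc r (m \<cdot> n \<cdot> \<rho>) (\<alpha> \<^bold>\<longrightarrow> \<beta>)"
              from frc_mp[OF *[THEN spec, of Zero] \<alpha>[OF r]]
              show "\<forall>q. r \<sqsubseteq> q --> q |- mem a x --> q |- Bot" unfolding \<beta>[OF r] .
            next
              assume *: "\<forall>q. r \<sqsubseteq> q --> q |- mem a x --> q |- Bot"
              show "\<forall>m. frc r (m \<cdot> n \<cdot> \<rho>) (\<alpha> \<^bold>\<longrightarrow> \<beta>)"
              proof (intro allI frc_impI)
                fix m q assume q: "r \<sqsubseteq> q"
                have sq: "s \<sqsubseteq> q" using r q by blast
                show "frc q (m \<cdot> n \<cdot> \<rho>) \<beta>" unfolding \<beta>[OF sq] using * q by (meson order_trans)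
              qed
            qed
          qed
          \<comment> \<open>If \<open>a = \<nu>(n)\<close> were in \<open>x\<close>, it would be in
            the diagonal set \<open>y\<close> and so equal some \<open>\<nu>(n')\<close> with
            \<open>\<gamma>(n')\<close>. Injectivity gives \<open>n = n'\<close>, and
            \<open>\<gamma>(n)\<close> says that \<open>a\<close> is not in
            \<open>x\<close>.\<close>
          have notin: "r |- Bot" if r: "s \<sqsubseteq> r" and m: "r |- mem a x" for r
          proof -
            note Va = mono[OF Va r] and Vx = mono[OF Vx r] and Vy = mono[OF Vy r]
            have "r |- mem a y" by (rule mem_cong_right[OF Va Vx Vy ext_sym[OF Vy Vx mono[OF yx r]] m])
            from this[unfolded mem_iff] show ?thesis
            proof (rule LocE, elim exE conjE)
              fix q z assume q: "r \<sqsubseteq> q" and z: "q |- in_EL z y" "q |- a \<simeq> z"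
              have "v \<sqsubseteq> q" using vs r q by blast
              with EL z(1) have "Loc q (\<lambda>t. \<exists>n. t |- app_eq \<nu> n z \<and> frc t (n \<cdot> \<rho>) \<gamma>)" by blast
              then show "q |- Bot"
              proof (rule LocE, elim exE conjE)
                fix w4 n' assume w4: "q \<sqsubseteq> w4" and n': "w4 |- app_eq \<nu> n' z" "frc w4 (n' \<cdot> \<rho>) \<gamma>"
                have so: "s \<sqsubseteq> w4" and wo: "w \<sqsubseteq> w4" and ro: "r \<sqsubseteq> w4" using r q w4 ws by blast+
                have "w4 |- n \<^bold>= n'"
                  by (rule numerals_inject[OF numerals_mono[OF \<nu> wo] mono[OF a so] n'(1) mono[OF z(2) w4]])
                from eq_subst[OF eq_sym[OF this] n'(2)] mono[OF m ro]
                show "w4 |- Bot" unfolding \<gamma>_iff[OF so] by blast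
              qed
            qed
          qed
          \<comment> \<open>The refutation just obtained is \<open>\<gamma>(n)\<close>; it places
            \<open>a\<close> into \<open>y\<close>, hence into \<open>x\<close>, and contradicts
            itself.\<close>
          then have "frc s (n \<cdot> \<rho>) \<gamma>" unfolding \<gamma>_iff[OF order_refl] by blast
          with EL vs a have "s |- in_EL a y" by (blast intro: LocI)
          from mem_cong_right[OF Va Vy Vx yx in_EL_mem[OF Vy this]] show "s |- Bot" by (rule notin[OF order_refl])
        qed
      qed
    qed
  qed
qed

text \<open>Transfers the diagonal argument from the explicit set of numerals to an arbitrary
  \<open>x\<close> that satisfies the definition of \<open>\<omega>\<close>.\<close>

lemma no_power_of_omega:
  assumes Vx: "w |- Vset x" and x: "omega_at w x" and P: "w |- Vset P" and pow: "power_at w x P"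
  shows "w |- Bot"
proof (rule LocE[OF omega_exists], elim exE conjE)
  fix v \<nu> y assume v: "w \<sqsubseteq> v" and \<nu>: "numerals v \<nu>" and Vy: "v |- Vset y" and y: "omega_at v y"
    and EL: "\<forall>u b. v \<sqsubseteq> u --> (u |- in_EL b y \<longleftrightarrow> Loc u (\<lambda>t. \<exists>n. t |- app_eq \<nu> n b))"
  note Vx = mono[OF Vx v] and x = omega_at_mono[OF x v] and P = mono[OF P v] and pow = power_at_mono[OF pow v]
  \<comment> \<open>Both sets are inductive and both are least, so each is included in the
    other.\<close>
  have xy: "sub_at v x y" and yx: "sub_at v y x"
    using x y Vx Vy unfolding omega_at_def by blast+
  show "v |- Bot"
  proof (rule diagonal[OF \<nu> P])
    fix u z b assume u: "v \<sqsubseteq> u" and z: "u |- in_EL z P" and b: "u |- in_EL b z"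
    note Vz = in_EL_Vset[OF mono[OF P u] z]
    have "sub_at u z x" using pow u Vz in_EL_mem[OF mono[OF P u] z] unfolding power_at_def by blast
    with b have "u |- mem b x" unfolding sub_at_def by blast
    from mem_sub[OF in_EL_Vset[OF Vz b] mono[OF Vx u] mono[OF Vy u] sub_at_mono[OF xy u] this]
    have "u |- mem b y" .
    from this[unfolded mem_iff] show "Loc u (\<lambda>u. \<exists>i c. u |- app_eq \<nu> i c \<and> u |- b \<simeq> c)"
    proof (rule Loc_bind, elim exE conjE)
      fix t c assume t: "u \<sqsubseteq> t" and c: "t |- in_EL c y" "t |- b \<simeq> c"
      have "v \<sqsubseteq> t" using u t by blast
      with EL c(1) have "Loc t (\<lambda>t. \<exists>n. t |- app_eq \<nu> n c)" by blast
      then show "Loc t (\<lambda>u. \<exists>i c. u |- app_eq \<nu> i c \<and> u |- b \<simeq> c)"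
        by (rule Loc_map) (use mono[OF c(2)] in blast)
    qed
  next
    fix u z assume u: "v \<sqsubseteq> u" and Vz: "u |- Vset z"
      and z: "\<And>t b. u \<sqsubseteq> t ==> t |- in_EL b z ==> Loc t (\<lambda>t. \<exists>n. t |- app_eq \<nu> n b)"
    have "sub_at u z x"
      unfolding sub_at_def
    proof (intro allI impI)
      fix b t assume t: "u \<sqsubseteq> t" and b: "t |- in_EL b z"
      have vt: "v \<sqsubseteq> t" using u t by blast
      with EL z[OF t b] have "t |- in_EL b y" by blast
      with yx vt show "t |- mem b x" unfolding sub_at_def by blast
    qed
    with pow u Vz show "u |- mem z P" unfolding power_at_def by blast
  qed
qed

end

theorem theorem17:
  fixes Xi :: prfun and E :: fm
  assumes Xi_inj: "\<And>f g f' g'. peval Xi [f, g] = peval Xi [f', g'] \<Longrightarrow> f = f' \<and> g = g'"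
    and E_ext: "extensional_equality Xi E"
  shows "is_false Xi E Power_Set \<and>
    holds Xi E (SEx (s_omega 0)) \<and>
    holds Xi E (SAll (SImp (s_omega 0) (SNot (s_has_power 0))))"
proof -
  interpret vset_extensional Xi E by unfold_locales (rule E_ext)
  have no_power: "v |- Bot" if "v |- Vset x" "omega_at v x" "frc v (x \<cdot> \<rho>) (interp E (s_has_power 0))" for v x \<rho>
    using that(3) unfolding frc_s_has_power
    by (rule LocE) (use that(1,2) in \<open>auto intro: no_power_of_omega mono omega_at_mono\<close>)
  have "frc [] Var (interp E (SNot Power_Set))"
    unfolding interp.simps(6)
  proof (rule frc_impI)
    fix w assume pow: "frc w Var (interp E Power_Set)"
    have "w |- Bot"
    \<comment> \<open>Power Set is refuted at \<open>\<omega>\<close>. Its existence is local, which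
      suffices because the goal is the derivability of \<open>Bot\<close>.\<close>
    proof (rule LocE[OF omega_exists], elim exE conjE)
      fix v \<nu> x assume v: "w \<sqsubseteq> v" and x: "v |- Vset x" "omega_at v x"
      have "frc v (x \<cdot> Var) (interp E (s_has_power 0))"
        by (rule frc_mp[OF frc_spec[OF frc_mono[OF pow v, unfolded Power_Set_def interp.simps(7)]]])
          (simp add: x(1))
      with x show "v |- Bot" by (rule no_power)
    qed
    then show "frc w Var (interp E SBot)" by simp
  qed
  moreover have "frc [] Var (interp E (SEx (s_omega 0)))"
    unfolding interp.simps(8) frc_Ex
    by (rule Loc_map[OF omega_exists]) (auto simp: frc_s_omega)
  moreover have "frc [] Var (interp E (SAll (SImp (s_omega 0) (SNot (s_has_power 0)))))"
    unfolding interp.simps(6,7) frc_All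
  proof (intro allI frc_impI)
    fix x w1 w2 w3 assume w: "w1 \<sqsubseteq> w2" "w2 \<sqsubseteq> w3"
      and x: "frc w1 (x \<cdot> Var) (Vset (Var 0))" "frc w2 (x \<cdot> Var) (interp E (s_omega 0))"
      and pow: "frc w3 (x \<cdot> Var) (interp E (s_has_power 0))"
    have "w3 |- Vset x" using frc_mono[OF x(1), of w3] w by auto
    moreover have "omega_at w3 x" using frc_mono[OF x(2) w(2)] by (simp add: frc_s_omega)
    ultimately have "w3 |- Bot" using pow by (rule no_power)
    then show "frc w3 (x \<cdot> Var) (interp E SBot)" by simp
  qed
  ultimately show ?thesis
    unfolding is_false_def holds_def frc_def sub_Var by blast
qed

end
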